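(* Let $m\in\mathbb{N}_+$ and let $X_{1:m}=(X_1,\dots,X_m)$ be a tuple of random variables with joint distribution $P_{X_{1:m}}$, where $X_i$ takes values in a finite set $\mathcal{X}_i$. Let $R^*(X_{1:m})$ be the resource rate and $C(X_{1:m})$ the total correlation of $X_{1:m}$. Then $R^*(X_{1:m})=C(X_{1:m})$ holds if and only if there exist a sequence of causal models $\{(G^{(n)},\Theta^{(n)})\}_{n}$ compatible with $P_{X_{1:m}}$ and a sequence of positive reals $\delta=\delta_n$ with $\delta_n\to 0$ as $n\to\infty$ such that $$H(\omega_i\mid X_i^n)\le n\delta_n\qquad\text{for all } i\in\{1,\dots,m\}.$$ Otherwise (i.e. if no such compatible sequence exists), $R^*(X_{1:m})>C(X_{1:m})$.
   Context: All logarithms are to base 2. $H$ is Shannon entropy, $I(\cdot;\cdot)$ and $I(\cdot;\cdot\mid\cdot)$ are (conditional) mutual information, $\mathrm{TV}$ is total variation distance. $\mathcal{M}=\{1,\dots,m\}$. Total correlation: $C(X_{1:m})=\sum_{i=1}^m H(X_i)-H(X_{1:m})$. Causal model: for $n\in\mathbb{N}_+$, a causal model $(G^{(n)},\Theta^{(n)})$ of an $m$-partite system consists of the following. - A directed bipartite graph $G^{(n)}=(\Gamma,V,E)$. Here $\Gamma=\{X_1^n,\dots,X_m^n\}$ is the set of observed variables, with $X_i^n$ taking values in $\mathcal{X}_i^n$. $V=\{\omega_{i,j}\}_{i,j\in\mathcal{M},\,i\ne j}$ is the set of latent variables, where $\omega_{i,j}$ and $\omega_{j,i}$ are the same vertex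 (so there is one latent variable per unordered pair) and $\omega_{i,j}$ is a random variable supported on a finite set $\Omega_{i,j}$. The edges $E$ go only from $\omega_{i,j}$ to $X_i^n$ and $X_j^n$. Write $\omega_i=\{\omega_{i,j}\}_{j\in\mathcal{M},\,j\neq i}$ for the collection of neighbours of $X_i^n$, supported on $\Omega_i\subset\prod_{j\ne i}\Omega_{i,j}$. - Structural equations $\Theta^{(n)}=\{f_i\}_{i\in\mathcal{M}}$, $f_i:\Omega_i\times\mathcal{U}_i\to\mathcal{X}_i^n$, with $X_i^n=f_i(\omega_i,u_i)$, where $u_i$ is a local random variable with values in $\mathcal{U}_i$. The collection of structural equations may be chosen at random; $\mathbb{E}_{\Theta^{(n)}}$ denotes expectation over this choice. The rate of the model is $R(G^{(n)},\Theta^{(n)})=\frac1n\sum_{\{i,j\}}\log|\Omega_{i,j}|$, the sum being over unordered pairs $i\neq j$. Compatibility: a sequence $\{(G^{(n)},\Theta^{(n)})\}_n$ is compatible with $P_{X_{1:m}}$ if: (Condition 1) $\lim_{n\to\infty}\mathbb{E}_{\Theta^{(n)}}\big[\mathrm{TV}(P_{X^n_{1:m}},P_{X_{1:m}}^{\otimes n})\big]=0$, where $P_{X^n_{1:m}}$ is the joint law of the observed variables of the $n$-th model and $P_{X_{1:m}}^{\otimes n}$ is the law of $n$ i.i.d. copies of $X_{1:m}$. (Condition 2) There is a permutation $\iota:\mathcal{M}\to\mathcal{M}$ such that for all $i\in\{1,\dots,m-1\}$, $$I\big(\omega_{\iota(1):\iota(i)};\,\omega_{\iota(i+1),\iota(i+2):\iota(m)}\,\big|\,\omega_{\iota(1):\iota(i),\iota(i+1)}\big)=0,$$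 where $\omega_{\iota(1):\iota(i)}=(\omega_{\iota(1)},\dots,\omega_{\iota(i)})$, $\omega_{\iota(i+1),\iota(i+2):\iota(m)}=(\omega_{\iota(i+1),\iota(k)})_{k=i+2}^{m}$ (empty if $i=m-1$) and $\omega_{\iota(1):\iota(i),\iota(i+1)}=(\omega_{\iota(k),\iota(i+1)})_{k=1}^{i}$. Moreover $I(\{\omega_{i,j}\}_{i,j};\{u_i\}_i)=0$, and $I(u_i;u_j)=0$ for all $i\ne j$. Resource rate: the rate of a sequence is $R(\{(G^{(n)},\Theta^{(n)})\})=\limsup_{n\to\infty}R(G^{(n)},\Theta^{(n)})$, and $R^*(X_{1:m})=\inf R(\{(G^{(n)},\Theta^{(n)})\})$, the infimum being over all sequences compatible with $P_{X_{1:m}}$.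
   Formalization: The local variables u_i are required to be mutually independent, not just pairwise (with pairwise independence the claim fails: m=3, u_3 = u_1 xor u_2); sample, local and Theta spaces are carried by the real numbers, latent alphabets by naturals, which changes no achievable rate. *)

theory Defs
  imports "HOL-Probability.Probability" "HOL-Combinatorics.Permutations"
begin

subsection \<open>Information measures, to base 2\<close>

text \<open>Shannon quantities of finitely-valued random variables on a probability space.\<close>

definition shannon_entropy :: "'a measure \<Rightarrow> ('a \<Rightarrow> 'b) \<Rightarrow> real" where
  "shannon_entropy M X = prob_space.entropy M 2 (count_space (X ` space M)) X"

definition cond_entropy :: "'a measure \<Rightarrow> ('a \<Rightarrow> 'b) \<Rightarrow> ('a \<Rightarrow> 'c) \<Rightarrow> real" where
  "cond_entropy M X Y =
     prob_space.conditional_entropy M 2 (count_space (X ` space M)) (count_space (Y ` space M)) X Y"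

definition cond_mutual_info ::
  "'a measure \<Rightarrow> ('a \<Rightarrow> 'b) \<Rightarrow> ('a \<Rightarrow> 'c) \<Rightarrow> ('a \<Rightarrow> 'd) \<Rightarrow> real" where
  "cond_mutual_info M X Y Z =
     prob_space.conditional_mutual_information M 2
       (count_space (X ` space M)) (count_space (Y ` space M)) (count_space (Z ` space M)) X Y Z"

text \<open>
  Mutual information of arbitrary random variables. The library's real-valued
  \<^const>\<open>prob_space.mutual_information\<close> is a meaningless number (possibly 0) when the joint law is
  not absolutely continuous with respect to the product of the marginals, or when the entropy
  density is not integrable; the mutual information is infinite in these cases.
\<close>
definition mutual_info ::
  "'a measure \<Rightarrow> 'b measure \<Rightarrow> 'c measure \<Rightarrow> ('a \<Rightarrow> 'b) \<Rightarrow> ('a \<Rightarrow> 'c) \<Rightarrow> ereal" where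
  "mutual_info M S T X Y =
     (let P = distr M S X \<Otimes>\<^sub>M distr M T Y;
          Q = distr M (S \<Otimes>\<^sub>M T) (\<lambda>a. (X a, Y a))
      in if absolutely_continuous P Q \<and> integrable Q (entropy_density 2 P Q)
         then ereal (prob_space.mutual_information M 2 S T X Y) else \<infinity>)"

definition tv_dist :: "'a measure \<Rightarrow> 'a measure \<Rightarrow> real" where
  "tv_dist P Q = (SUP A\<in>sets P. \<bar>measure P A - measure Q A\<bar>)"

definition total_correlation :: "nat \<Rightarrow> 'a measure \<Rightarrow> (nat \<Rightarrow> 'a \<Rightarrow> 'x) \<Rightarrow> real" where
  "total_correlation m M X =
     (\<Sum>i=1..m. shannon_entropy M (X i)) - shannon_entropy M (\<lambda>a. \<lambda>i\<in>{1..m}. X i a)"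

definition joint_law ::
  "nat \<Rightarrow> (nat \<Rightarrow> 'x set) \<Rightarrow> 'a measure \<Rightarrow> (nat \<Rightarrow> 'a \<Rightarrow> 'x) \<Rightarrow> (nat \<Rightarrow> 'x) measure" where
  "joint_law m \<X> M X =
     distr M (PiM {1..m} (\<lambda>i. count_space (\<X> i))) (\<lambda>a. \<lambda>i\<in>{1..m}. X i a)"


subsection \<open>Causal models\<close>

definition pairs :: "nat \<Rightarrow> nat set set" where
  "pairs m = {{i, j} | i j. i \<in> {1..m} \<and> j \<in> {1..m} \<and> i \<noteq> j}"

text \<open>
  The latent variable attached to the pair of \<open>i\<close> and \<open>j\<close> is \<open>latent G {i, j}\<close>, so that
  the two orders of the indices give the same variable. Its only edges go to the observed
  variables \<open>i\<close> and \<open>j\<close>; as the graph is thus determined by the number of parties, it is not stored.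

  The random choice of the structural equations is \<open>struct_eq G t\<close> with \<open>t\<close> drawn from
  \<open>theta_space G\<close>, which is separate from the space \<open>sample G\<close> that carries the latent and local
  variables: the choice is independent of them.

  All carriers are represented on fixed types: finite latent alphabets on \<^typ>\<open>nat\<close>, all
  other spaces on \<^typ>\<open>real\<close>, with arbitrary sigma-algebras.
\<close>
record 'x causal_model =
  sample :: "real measure"
  latent_alph :: "nat set \<Rightarrow> nat set"
  latent :: "nat set \<Rightarrow> real \<Rightarrow> nat"
  loc_space :: "nat \<Rightarrow> real measure"
  loc :: "nat \<Rightarrow> real \<Rightarrow> real"
  theta_space :: "real measure"
  struct_eq :: "real \<Rightarrow> nat \<Rightarrow> (nat \<Rightarrow> nat) \<Rightarrow> real \<Rightarrow> (nat \<Rightarrow> 'x)"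

definition block_alph :: "nat \<Rightarrow> (nat \<Rightarrow> 'x set) \<Rightarrow> nat \<Rightarrow> (nat \<Rightarrow> 'x) set" where
  "block_alph n \<X> i = PiE {..<n} (\<lambda>_. \<X> i)"

definition neighbours :: "nat \<Rightarrow> 'x causal_model \<Rightarrow> nat \<Rightarrow> real \<Rightarrow> (nat \<Rightarrow> nat)" where
  "neighbours m G i a = (\<lambda>j\<in>{1..m} - {i}. latent G {i, j} a)"

text \<open>
  ``Local'' is read as mutual independence of the \<open>loc G i\<close>. Pairwise independence
  would not do: for three parties, \<open>u\<^sub>3 = u\<^sub>1 xor u\<^sub>2\<close> would be allowed, and would
  generate one bit of total correlation without any latent variable.
\<close>
definition is_causal_model :: "nat \<Rightarrow> nat \<Rightarrow> (nat \<Rightarrow> 'x set) \<Rightarrow> 'x causal_model \<Rightarrow> bool" where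
  "is_causal_model m n \<X> G \<longleftrightarrow>
     prob_space (sample G) \<and> prob_space (theta_space G) \<and>
     (\<forall>e\<in>pairs m. finite (latent_alph G e) \<and>
        latent G e \<in> measurable (sample G) (count_space (latent_alph G e))) \<and>
     prob_space.indep_vars (sample G) (loc_space G) (loc G) {1..m} \<and>
     (\<forall>i\<in>{1..m}. \<forall>w\<in>PiE ({1..m} - {i}) (\<lambda>j. latent_alph G {i, j}).
        (\<lambda>(t, v). struct_eq G t i w v)
          \<in> measurable (theta_space G \<Otimes>\<^sub>M loc_space G i) (count_space (block_alph n \<X> i)))"

definition observed :: "nat \<Rightarrow> 'x causal_model \<Rightarrow> real \<Rightarrow> nat \<Rightarrow> real \<Rightarrow> (nat \<Rightarrow> 'x)" where
  "observed m G t i a = struct_eq G t i (neighbours m G i a) (loc G i a)"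

definition observed_law ::
  "nat \<Rightarrow> nat \<Rightarrow> (nat \<Rightarrow> 'x set) \<Rightarrow> 'x causal_model \<Rightarrow> real \<Rightarrow> (nat \<Rightarrow> nat \<Rightarrow> 'x) measure" where
  "observed_law m n \<X> G t =
     distr (sample G) (count_space (PiE {1..m} (block_alph n \<X>)))
       (\<lambda>a. \<lambda>i\<in>{1..m}. observed m G t i a)"

text \<open>The law of \<open>n\<close> i.i.d. copies of \<open>P\<close>, regrouped as \<open>m\<close> blocks of length \<open>n\<close>.\<close>
definition iid_law ::
  "nat \<Rightarrow> nat \<Rightarrow> (nat \<Rightarrow> 'x set) \<Rightarrow> (nat \<Rightarrow> 'x) measure \<Rightarrow> (nat \<Rightarrow> nat \<Rightarrow> 'x) measure" where
  "iid_law m n \<X> P =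
     distr (PiM {..<n} (\<lambda>_. P)) (count_space (PiE {1..m} (block_alph n \<X>)))
       (\<lambda>x. \<lambda>i\<in>{1..m}. \<lambda>k\<in>{..<n}. x k i)"

definition model_rate :: "nat \<Rightarrow> nat \<Rightarrow> 'x causal_model \<Rightarrow> real" where
  "model_rate m n G = 1 / real n * (\<Sum>e\<in>pairs m. log 2 (real (card (latent_alph G e))))"


subsection \<open>Compatibility and the resource rate\<close>

definition latents_ordered :: "nat \<Rightarrow> (nat \<Rightarrow> nat) \<Rightarrow> 'x causal_model \<Rightarrow> bool" where
  "latents_ordered m \<iota> G \<longleftrightarrow>
     (\<forall>i\<in>{1..<m}.
        cond_mutual_info (sample G)
          (\<lambda>a. \<lambda>k\<in>{1..i}. neighbours m G (\<iota> k) a)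
          (\<lambda>a. \<lambda>k\<in>{i+2..m}. latent G {\<iota> (i+1), \<iota> k} a)
          (\<lambda>a. \<lambda>k\<in>{1..i}. latent G {\<iota> k, \<iota> (i+1)} a) = 0)"

definition sources_independent :: "nat \<Rightarrow> 'x causal_model \<Rightarrow> bool" where
  "sources_independent m G \<longleftrightarrow>
     mutual_info (sample G)
       (PiM (pairs m) (\<lambda>e. count_space (latent_alph G e))) (PiM {1..m} (loc_space G))
       (\<lambda>a. \<lambda>e\<in>pairs m. latent G e a) (\<lambda>a. \<lambda>i\<in>{1..m}. loc G i a) = 0 \<and>
     (\<forall>i\<in>{1..m}. \<forall>j\<in>{1..m}. i \<noteq> j \<longrightarrow>
        mutual_info (sample G) (loc_space G i) (loc_space G j) (loc G i) (loc G j) = 0)"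

text \<open>Block lengths are positive; the entry of a sequence at index 0 plays no role.\<close>
definition compatible ::
  "nat \<Rightarrow> (nat \<Rightarrow> 'x set) \<Rightarrow> (nat \<Rightarrow> 'x) measure \<Rightarrow> (nat \<Rightarrow> 'x causal_model) \<Rightarrow> bool" where
  "compatible m \<X> P Gs \<longleftrightarrow>
     (\<forall>n\<ge>1. is_causal_model m n \<X> (Gs n)) \<and>
     (\<lambda>n. LINT t|theta_space (Gs n). tv_dist (observed_law m n \<X> (Gs n) t) (iid_law m n \<X> P))
       \<longlonglongrightarrow> 0 \<and>
     (\<exists>\<iota>. \<iota> permutes {1..m} \<and> (\<forall>n\<ge>1. latents_ordered m \<iota> (Gs n))) \<and>
     (\<forall>n\<ge>1. sources_independent m (Gs n))"

definition sequence_rate :: "nat \<Rightarrow> (nat \<Rightarrow> 'x causal_model) \<Rightarrow> ereal" where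
  "sequence_rate m Gs = limsup (\<lambda>n. ereal (model_rate m n (Gs n)))"

definition resource_rate :: "nat \<Rightarrow> (nat \<Rightarrow> 'x set) \<Rightarrow> (nat \<Rightarrow> 'x) measure \<Rightarrow> ereal" where
  "resource_rate m \<X> P = (INF Gs\<in>{Gs. compatible m \<X> P Gs}. sequence_rate m Gs)"

text \<open>
  As the observed variables depend on the choice \<open>t\<close> of the structural equations, the
  conditional entropy of \<open>\<omega>\<^sub>i\<close> given \<open>X\<^sub>i\<^sup>n\<close> is averaged over this choice.
\<close>
definition latents_recoverable :: "nat \<Rightarrow> (nat \<Rightarrow> 'x causal_model) \<Rightarrow> (nat \<Rightarrow> real) \<Rightarrow> bool" where
  "latents_recoverable m Gs \<delta> \<longleftrightarrow>
     (\<forall>n\<ge>1. \<forall>i\<in>{1..m}.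
        (LINT t|theta_space (Gs n).
           cond_entropy (sample (Gs n)) (neighbours m (Gs n) i) (observed m (Gs n) t i))
        \<le> real n * \<delta> n)"

end

(* Put the vertices in the order of the Markov condition and let W_{p,q} be the latent variable of
   the edge {p,q}. For fixed structural equations the Markov condition gives
   sum_i H(omega_i) - H(omega) = sum_q H(W_{<q,q}), which is at most the sum of the logarithms of the
   alphabet sizes. As X_i^n depends on omega_i and on local randomness only, the left-hand side is
   C(X^n) + sum_i H(omega_i | X_i^n) - H(omega | X^n). All vertices but one see every edge up to the
   order, so the rate exceeds C by at least H(omega_v | X_v^n) / n, and continuity of entropy replaces
   C(X^n) by n C(X). Hence a rate close to C forces every omega_i to be recoverable from X_i^n.

   Conversely, let the omega_i be recoverable. Take N copies of a block whose length tends to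
   infinity while N stays fixed, and hash every edge variable at rate H(W_{p,q} | W_{<p,q}), so that
   both of its end points can decode it. The latent variables are replaced by hash
   values, generated by a chain that decodes W_{<p,p}, resamples W_{p,>p} and hashes again; its law dominates the original one on the event that decoding succeeds. Recoverability
   bounds the information densities by a multiple of n, so that Chebyshev's inequality for truncated
   variables controls the error. The rates come within every epsilon of C, and a diagonal argument
   gives a single sequence. *)
theory Submission
  imports Defs
begin

section \<open>Entropy of functions on a finitely supported distribution\<close>

text \<open>A recoverable sequence need not be cheap: the rate is read off the alphabets, whereas
  recoverability controls only entropies. Hashing turns these entropies into alphabet sizes. But
  hash values of the latent variables need not satisfy the Markov condition, which must hold exactly
  for every n; this is why they are regenerated by a chain, for which it holds by construction. The
  distance of a block from the i.i.d. law tends to 0 at an unknown speed, and N copies multiply it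
  by N, so N cannot grow with the block length n. With N fixed, Chebyshev's inequality leaves an
  error of order 1/N, free of n because the densities and the permitted deviation both scale with n.
  So a single construction reaches only a given \<epsilon>. Combining them diagonally requires one
  order of the parties for all \<epsilon>, which exists as there are finitely many. The conditions
  are stated on average over the structural equations, while the entropy balance holds for each
  choice t. The bounds are therefore kept affine in the total variation distance, so that they can
  be averaged.\<close>

definition pr :: "'a pmf \<Rightarrow> ('a \<Rightarrow> 'b) \<Rightarrow> 'a \<Rightarrow> real" where
  "pr p f x = measure_pmf.prob p {y. f y = f x}"

definition info :: "'a pmf \<Rightarrow> ('a \<Rightarrow> 'b) \<Rightarrow> 'a \<Rightarrow> real" where
  "info p f x = - log 2 (pr p f x)"

definition ent :: "'a pmf \<Rightarrow> ('a \<Rightarrow> 'b) \<Rightarrow> real" where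
  "ent p f = measure_pmf.expectation p (info p f)"

text \<open>Only points of the support are compared, because entropies do not see the others; this
  lets canonicity of assignments, known on the support only, enter entropy identities.\<close>

definition determines :: "'a pmf \<Rightarrow> ('a \<Rightarrow> 'b) \<Rightarrow> ('a \<Rightarrow> 'c) \<Rightarrow> bool" where
  "determines p f g \<longleftrightarrow> (\<forall>x\<in>set_pmf p. \<forall>y\<in>set_pmf p. f x = f y \<longrightarrow> g x = g y)"

lemma determinesI: "(\<And>x y. f x = f y \<Longrightarrow> g x = g y) \<Longrightarrow> determines p f g"
  unfolding determines_def by blast

lemma determines_refl: "determines p f f"
  by (simp add: determines_def)

lemma determines_trans: "determines p f g \<Longrightarrow> determines p g h \<Longrightarrow> determines p f h"
  unfolding determines_def by blast

lemma determines_pair: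
  "determines p a b \<Longrightarrow> determines p a c \<Longrightarrow> determines p a (\<lambda>x. (b x, c x))"
  unfolding determines_def prod.inject by blast

lemma pr_eq_pmf: "pr p f x = pmf (map_pmf f p) (f x)"
  by (simp add: pr_def pmf_map vimage_def)

lemma pr_pos: "x \<in> set_pmf p \<Longrightarrow> pr p f x > 0"
  by (simp add: pr_eq_pmf pmf_positive)

lemma pr_le_1: "pr p f x \<le> 1"
  by (simp add: pr_def)

lemma pr_nonneg: "pr p f x \<ge> 0"
  by (simp add: pr_def)

lemma pr_cong: "(\<And>y. y \<in> set_pmf p \<Longrightarrow> f y = f x \<longleftrightarrow> g y = g x) \<Longrightarrow> pr p f x = pr p g x"
  unfolding pr_def by (intro measure_pmf.finite_measure_eq_AE) (auto simp: AE_measure_pmf_iff)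

lemma pr_mono: "(\<And>y. y \<in> set_pmf p \<Longrightarrow> f y = f x \<Longrightarrow> g y = g x) \<Longrightarrow> pr p f x \<le> pr p g x"
  unfolding pr_def by (intro measure_pmf.finite_measure_mono_AE) (auto simp: AE_measure_pmf_iff)

lemma pr_map: "pr (map_pmf h p) f (h x) = pr p (f \<circ> h) x"
  by (simp add: pr_def vimage_def)

lemma info_map: "info (map_pmf h p) f (h x) = info p (f \<circ> h) x"
  by (simp add: info_def pr_map)

lemma ent_map: "ent (map_pmf h p) f = ent p (f \<circ> h)"
  by (simp add: ent_def info_map)

lemma ent_eq_ent_id: "ent p f = ent (map_pmf f p) (\<lambda>x. x)"
  by (simp add: ent_map comp_def)

lemma info_nonneg: "info p f x \<ge> 0"
proof (cases "pr p f x = 0")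
  case False
  then have "0 < pr p f x" using pr_nonneg[of p f x] by linarith
  then show ?thesis using pr_le_1[of p f x] by (simp add: info_def)
\<comment> \<open>The logarithm of 0 evaluates to 0.\<close>
qed (simp add: info_def log_def)

lemma pr_le_iff_info: "x \<in> set_pmf p \<Longrightarrow> pr p f x \<le> pr p g x \<longleftrightarrow> info p g x \<le> info p f x"
  by (simp add: info_def pr_pos)

lemma info_mono: "determines p f g \<Longrightarrow> x \<in> set_pmf p \<Longrightarrow> info p g x \<le> info p f x"
  by (subst pr_le_iff_info[symmetric]) (auto intro!: pr_mono simp: determines_def)

lemma integrable_finite_pmf [simp]:
  "finite (set_pmf p) \<Longrightarrow> integrable (measure_pmf p) (f :: _ \<Rightarrow> real)"
  by (rule integrable_measure_pmf_finite)

lemma expectation_finite: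
  "finite (set_pmf p) \<Longrightarrow> measure_pmf.expectation p f = (\<Sum>x\<in>set_pmf p. pmf p x * (f x :: real))"
  by (subst integral_measure_pmf_real) (auto simp: mult.commute set_pmf_iff)

lemma expectation_mono:
  assumes "finite (set_pmf p)" "\<And>x. x \<in> set_pmf p \<Longrightarrow> f x \<le> (g x :: real)"
  shows "measure_pmf.expectation p f \<le> measure_pmf.expectation p g"
  using assms by (intro integral_mono_AE) (auto simp: AE_measure_pmf_iff)

lemma expectation_cong:
  assumes "\<And>x. x \<in> set_pmf p \<Longrightarrow> f x = (g x :: real)"
  shows "measure_pmf.expectation p f = measure_pmf.expectation p g"
  using assms by (intro integral_cong_AE) (auto simp: AE_measure_pmf_iff)

lemma ent_nonneg: "ent p f \<ge> 0"
  unfolding ent_def by (intro integral_nonneg_AE) (simp add: info_nonneg)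

lemma ent_mono: "finite (set_pmf p) \<Longrightarrow> determines p f g \<Longrightarrow> ent p g \<le> ent p f"
  unfolding ent_def by (intro expectation_mono info_mono)

lemma info_cong:
  "determines p f g \<Longrightarrow> determines p g f \<Longrightarrow> x \<in> set_pmf p \<Longrightarrow> info p f x = info p g x"
  using info_mono[of p f g x] info_mono[of p g f x] by simp

lemma ent_cong: "determines p f g \<Longrightarrow> determines p g f \<Longrightarrow> ent p f = ent p g"
  unfolding ent_def by (intro expectation_cong info_cong)

lemma ent_const: "determines p (\<lambda>_. ()) f \<Longrightarrow> ent p f = 0"
proof -
  assume *: "determines p (\<lambda>_. ()) f"
  have "ent p f = ent p (\<lambda>_. ())" by (rule ent_cong[OF _ *]) (simp add: determines_def)
  also have "\<dots> = 0" by (simp add: ent_def info_def[abs_def] pr_def[abs_def])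
  finally show ?thesis .
qed

subsection \<open>Submodularity\<close>

text \<open>Dividing by \<open>pr\<close> removes the weight of the law, so that likelihood ratios
  integrate to plain sums over attained values. Submodularity and the tail bound
  \<open>info_upper_tail\<close> both rest on this.\<close>

lemma sum_density_image:
  assumes fin: "finite (set_pmf p)"
  shows "measure_pmf.expectation p (\<lambda>x. F (f x) / pr p f x) = (\<Sum>v\<in>f ` set_pmf p. F v)"
proof -
  let ?S = "set_pmf p"
  have "measure_pmf.expectation p (\<lambda>x. F (f x) / pr p f x) = (\<Sum>x\<in>?S. pmf p x * (F (f x) / pr p f x))"
    by (rule expectation_finite[OF fin])
  also have "\<dots> = (\<Sum>v\<in>f ` ?S. \<Sum>x\<in>{x\<in>?S. f x = v}. pmf p x * (F (f x) / pr p f x))"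
    by (rule sum.image_gen[OF fin])
  also have "\<dots> = (\<Sum>v\<in>f ` ?S. F v)"
  proof (rule sum.cong[OF refl])
    fix v assume "v \<in> f ` ?S"
    then obtain y where y: "y \<in> ?S" "v = f y" by auto
    have "(\<Sum>x\<in>{x\<in>?S. f x = v}. pmf p x) = pr p f y"
      using fin y unfolding pr_def
      by (subst measure_Int_set_pmf[symmetric]) (auto simp: measure_measure_pmf_finite intro!: sum.cong)
    moreover have "(\<Sum>x\<in>{x\<in>?S. f x = v}. pmf p x * (F (f x) / pr p f x))
        = (\<Sum>x\<in>{x\<in>?S. f x = v}. pmf p x) * (F v / pr p f y)"
      by (subst sum_distrib_right) (auto intro!: sum.cong simp: y pr_def)
    ultimately show "(\<Sum>x\<in>{x\<in>?S. f x = v}. pmf p x * (F (f x) / pr p f x)) = F v"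
      using pr_pos[OF y(1), of f] by simp
  qed
  finally show ?thesis .
qed

text \<open>\<open>pr p b x * pr p c x / pr p d x\<close> is the law under which \<open>b\<close>
  and \<open>c\<close> are conditionally independent given \<open>d\<close>. The expectation is the
  mass that this law gives to the pairs attained under the true joint law, hence at most 1.\<close>

lemma expectation_ratio_le_1:
  assumes fin: "finite (set_pmf p)" and bd: "determines p b d" and cd: "determines p c d"
  shows "measure_pmf.expectation p
     (\<lambda>x. pr p b x * pr p c x / (pr p (\<lambda>x. (b x, c x)) x * pr p d x)) \<le> 1"
proof -
  let ?S = "set_pmf p" and ?B = "pmf (map_pmf b p)" and ?C = "pmf (map_pmf c p)" 
    and ?E = "pmf (map_pmf d p)"
  \<comment> \<open>\<open>\<delta>\<close> reads the value of \<open>d\<close> off the value of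
    \<open>b\<close>, which is possible because \<open>b\<close> determines
    \<open>d\<close>.\<close>
  define \<delta> where "\<delta> \<beta> = d (SOME x. x \<in> ?S \<and> b x = \<beta>)" for \<beta>
  have \<delta>: "\<delta> (b x) = d x" if "x \<in> ?S" for x
  proof -
    have "(SOME y. y \<in> ?S \<and> b y = b x) \<in> ?S \<and> b (SOME y. y \<in> ?S \<and> b y = b x) = b x"
      by (rule someI[of _ x]) (use that in simp)
    then show ?thesis using bd that unfolding \<delta>_def determines_def by blast
  qed
  define F where "F = (\<lambda>(\<beta>, \<gamma>). ?B \<beta> * ?C \<gamma> / ?E (\<delta> \<beta>))"
  have "measure_pmf.expectation p
     (\<lambda>x. pr p b x * pr p c x / (pr p (\<lambda>x. (b x, c x)) x * pr p d x))
     = measure_pmf.expectation p (\<lambda>x. F (b x, c x) / pr p (\<lambda>x. (b x, c x)) x)"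
    by (intro expectation_cong) (simp add: F_def \<delta> pr_eq_pmf field_simps)
  also have "\<dots> = (\<Sum>v\<in>(\<lambda>x. (b x, c x)) ` ?S. F v)"
    by (rule sum_density_image[OF fin])
  \<comment> \<open>Enlarging the sum from jointly attained pairs to all pairs with the same value
    of \<open>d\<close> makes it an iterated sum.\<close>
  also have "\<dots> \<le> (\<Sum>v\<in>Sigma (b ` ?S) (\<lambda>\<beta>. c ` {x\<in>?S. d x = \<delta> \<beta>}). F v)"
    using fin by (intro sum_mono2) (auto simp: F_def \<delta> intro!: finite_imageI)
  also have "\<dots> = (\<Sum>\<beta>\<in>b ` ?S. \<Sum>\<gamma>\<in>c ` {x\<in>?S. d x = \<delta> \<beta>}. ?B \<beta> * ?C \<gamma> / ?E (\<delta> \<beta>))"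
    using fin by (subst sum.Sigma) (auto simp: F_def intro!: sum.cong)
  also have "\<dots> \<le> (\<Sum>\<beta>\<in>b ` ?S. ?B \<beta>)"
  proof (rule sum_mono)
    fix \<beta> assume "\<beta> \<in> b ` ?S"
    then obtain x where x: "x \<in> ?S" "\<beta> = b x" by auto
    have "(\<Sum>\<gamma>\<in>c ` {y\<in>?S. d y = d x}. ?C \<gamma>)
        = measure (measure_pmf p) (\<Union>\<gamma>\<in>c ` {y\<in>?S. d y = d x}. {y. c y = \<gamma>})"
      using fin by (subst measure_pmf.finite_measure_finite_Union)
        (auto simp: pmf_map vimage_def disjoint_family_on_def)
    also have "\<dots> \<le> ?E (d x)"
      unfolding pmf_map
    proof (intro measure_pmf.finite_measure_mono_AE AE_pmfI impI)
      fix y assume "y \<in> ?S" "y \<in> (\<Union>\<gamma>\<in>c ` {y\<in>?S. d y = d x}. {y. c y = \<gamma>})"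
      then obtain z where "z \<in> ?S" "d z = d x" "c y = c z" by auto
      with cd \<open>y \<in> ?S\<close> have "d y = d x" unfolding determines_def by metis
      then show "y \<in> d -` {d x}" by simp
    qed simp
    finally have *: "(\<Sum>\<gamma>\<in>c ` {y\<in>?S. d y = d x}. ?C \<gamma>) \<le> ?E (d x)" .
    have "?E (d x) > 0" using x by (simp add: pmf_positive)
    then have "?B \<beta> / ?E (d x) * (\<Sum>\<gamma>\<in>c ` {y\<in>?S. d y = d x}. ?C \<gamma>) \<le> ?B \<beta> / ?E (d x) * ?E (d x)"
      using * by (intro mult_left_mono) auto
    also have "\<dots> = ?B \<beta>" using \<open>?E (d x) > 0\<close> by simp
    finally show "(\<Sum>\<gamma>\<in>c ` {x\<in>?S. d x = \<delta> \<beta>}. ?B \<beta> * ?C \<gamma> / ?E (\<delta> \<beta>)) \<le> ?B \<beta>"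
      unfolding x \<delta>[OF x(1)] by (simp add: sum_distrib_left)
  qed
  also have "\<dots> = 1"
    using fin by (intro sum_pmf_eq_1) auto
  finally show ?thesis .
qed

text \<open>Jensen's inequality through ln r \<le> r - 1. The gap is nonnegative at every point, so
  if the expectation of the logarithm vanishes, the gap is 0 on the whole support, and ln r = r - 1
  holds only at 1.\<close>

lemma log_ratio_expectation:
  assumes fin: "finite (set_pmf p)" and r: "\<And>x. x \<in> set_pmf p \<Longrightarrow> r x > 0"
    and E: "measure_pmf.expectation p r \<le> 1"
  shows "measure_pmf.expectation p (\<lambda>x. log 2 (r x)) \<le> 0"
    and "measure_pmf.expectation p (\<lambda>x. log 2 (r x)) = 0 \<Longrightarrow> x \<in> set_pmf p \<Longrightarrow> r x = 1"
proof -
  have *: "measure_pmf.expectation p (\<lambda>x. r x - 1 - ln (r x))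
      = measure_pmf.expectation p r - 1 - measure_pmf.expectation p (\<lambda>x. ln (r x))"
    using fin by simp
  have L: "measure_pmf.expectation p (\<lambda>x. log 2 (r x)) = measure_pmf.expectation p (\<lambda>x. ln (r x)) / ln 2"
    by (simp add: log_def)
  have nn: "0 \<le> r x - 1 - ln (r x)" if "x \<in> set_pmf p" for x
    using ln_le_minus_one[OF r[OF that]] by simp
  have "0 \<le> measure_pmf.expectation p (\<lambda>x. r x - 1 - ln (r x))"
    by (intro integral_nonneg_AE AE_pmfI nn)
  with * E have "measure_pmf.expectation p (\<lambda>x. ln (r x)) \<le> 0" by simp
  then show "measure_pmf.expectation p (\<lambda>x. log 2 (r x)) \<le> 0" unfolding L by (simp add: field_simps)
  assume "measure_pmf.expectation p (\<lambda>x. log 2 (r x)) = 0" and x: "x \<in> set_pmf p"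
  then have "measure_pmf.expectation p (\<lambda>x. r x - 1 - ln (r x)) \<le> 0" unfolding L * using E by simp
  then have "(\<Sum>x\<in>set_pmf p. pmf p x * (r x - 1 - ln (r x))) \<le> 0"
    by (simp add: expectation_finite[OF fin])
  moreover have "(\<Sum>x\<in>set_pmf p. pmf p x * (r x - 1 - ln (r x))) \<ge> 0"
    by (intro sum_nonneg mult_nonneg_nonneg nn) auto
  ultimately have "(\<Sum>x\<in>set_pmf p. pmf p x * (r x - 1 - ln (r x))) = 0" by linarith
  then have "\<forall>x\<in>set_pmf p. pmf p x * (r x - 1 - ln (r x)) = 0"
    by (simp only: sum_nonneg_eq_0_iff[OF fin mult_nonneg_nonneg[OF pmf_nonneg nn]])
  then have "pmf p x * (r x - 1 - ln (r x)) = 0" using x by blast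
  then have "ln (r x) = r x - 1" using x by (simp add: set_pmf_iff)
  then show "r x = 1" using ln_eq_minus_one r x by blast
qed

lemma log_ratio_info:
  assumes "x \<in> set_pmf p"
  shows "log 2 (pr p b x * pr p c x / (pr p a x * pr p d x)) = info p a x + info p d x - info p b x - info p c x"
  using pr_pos[OF assms, of a] pr_pos[OF assms, of b] pr_pos[OF assms, of c] pr_pos[OF assms, of d]
  by (simp add: log_mult log_divide info_def)

text \<open>In the lattice form the joint variables do not have to be spelled out as tuples.\<close>

lemma ent_submod:
  assumes fin: "finite (set_pmf p)" and bd: "determines p b d" and cd: "determines p c d"
    and a: "determines p (\<lambda>x. (b x, c x)) a"
  shows "ent p a + ent p d \<le> ent p b + ent p c"
proof -
  let ?a = "\<lambda>x. (b x, c x)"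
  have "ent p ?a + ent p d - ent p b - ent p c
      = measure_pmf.expectation p (\<lambda>x. info p ?a x + info p d x - info p b x - info p c x)"
    unfolding ent_def using fin by simp
  also have "\<dots> = measure_pmf.expectation p (\<lambda>x. log 2 (pr p b x * pr p c x / (pr p ?a x * pr p d x)))"
    by (intro expectation_cong) (simp only: log_ratio_info)
  also have "\<dots> \<le> 0"
    by (intro log_ratio_expectation(1) fin expectation_ratio_le_1 bd cd) (simp add: pr_pos)
  finally show ?thesis using ent_mono[OF fin a] by simp
qed

text \<open>Equality in submodularity forces the likelihood ratio to be 1 at every point of the
  support. An identity between entropies thus becomes one between information densities, which is
  how the Markov condition yields a factorization of the law.\<close>

lemma ent_submod_eq:
  assumes fin: "finite (set_pmf p)" and bd: "determines p b d" and cd: "determines p c d"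
    and a: "determines p (\<lambda>x. (b x, c x)) a" and ab: "determines p a b" and ac: "determines p a c"
    and eq: "ent p a + ent p d = ent p b + ent p c" and x: "x \<in> set_pmf p"
  shows "info p a x + info p d x = info p b x + info p c x"
proof -
  let ?a = "\<lambda>x. (b x, c x)"
  let ?r = "\<lambda>x. pr p b x * pr p c x / (pr p ?a x * pr p d x)"
  have a': "determines p a ?a" by (rule determines_pair[OF ab ac])
  have "ent p ?a + ent p d - ent p b - ent p c
      = measure_pmf.expectation p (\<lambda>x. info p ?a x + info p d x - info p b x - info p c x)"
    unfolding ent_def using fin by simp
  also have "\<dots> = measure_pmf.expectation p (\<lambda>x. log 2 (?r x))"
    by (intro expectation_cong) (simp only: log_ratio_info)
  finally have "measure_pmf.expectation p (\<lambda>x. log 2 (?r x)) = 0"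
    using eq ent_cong[OF a a'] by simp
  then have "?r x = 1"
    by (intro log_ratio_expectation(2)[OF fin _ expectation_ratio_le_1[OF fin bd cd] _ x])
      (simp_all add: pr_pos)
  then have "log 2 (?r x) = 0" by (simp only: log_one)
  then have "info p ?a x + info p d x - info p b x - info p c x = 0"
    unfolding log_ratio_info[OF x] .
  then show ?thesis using info_cong[OF a a' x] by simp
qed

lemma ent_pair_le:
  "finite (set_pmf p) \<Longrightarrow> determines p (\<lambda>x. (b x, c x)) a \<Longrightarrow> ent p a \<le> ent p b + ent p c"
  using ent_nonneg[of p "\<lambda>_. ()"]
  by (intro order_trans[OF _ ent_submod[of p b "\<lambda>_. ()" c a]]) (auto simp: determines_def[of p _ "\<lambda>_. ()"])

subsection \<open>Gibbs' inequality and continuity of entropy\<close>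

lemma ent_le_cross_entropy:
  assumes fin: "finite (set_pmf p)" and r: "\<And>x. x \<in> set_pmf p \<Longrightarrow> r x > 0"
    and s: "(\<Sum>x\<in>set_pmf p. r x) \<le> 1"
  shows "ent p (\<lambda>x. x) \<le> measure_pmf.expectation p (\<lambda>x. - log 2 (r x))"
proof -
  have "measure_pmf.expectation p (\<lambda>x. r x / pmf p x) \<le> 1"
    using s by (simp add: expectation_finite[OF fin] set_pmf_iff)
  then have "measure_pmf.expectation p (\<lambda>x. log 2 (r x / pmf p x)) \<le> 0"
    by (intro log_ratio_expectation(1) fin) (auto intro!: divide_pos_pos r pmf_positive)
  moreover have "measure_pmf.expectation p (\<lambda>x. log 2 (r x / pmf p x))
      = measure_pmf.expectation p (\<lambda>x. info p (\<lambda>x. x) x - (- log 2 (r x)))"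
  proof (intro expectation_cong)
    fix x assume x: "x \<in> set_pmf p"
    show "log 2 (r x / pmf p x) = info p (\<lambda>x. x) x - (- log 2 (r x))"
      using r[OF x] pmf_positive[OF x] by (simp add: info_def pr_eq_pmf log_divide)
  qed
  moreover have "\<dots> = ent p (\<lambda>x. x) - measure_pmf.expectation p (\<lambda>x. - log 2 (r x))"
    unfolding ent_def using fin by (subst Bochner_Integration.integral_diff) auto
  ultimately show ?thesis by simp
qed

lemma ent_le_log_card:
  assumes "finite A" "set_pmf p \<subseteq> A" 
  shows "ent p (\<lambda>x. x) \<le> log 2 (card A)"
proof -
  have ne: "A \<noteq> {}" using assms set_pmf_not_empty[of p] by auto
  have fin: "finite (set_pmf p)" using assms finite_subset by auto
  have "ent p (\<lambda>x. x) \<le> measure_pmf.expectation p (\<lambda>x. - log 2 (1 / card A))"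
  proof (rule ent_le_cross_entropy[OF fin])
    show "(\<Sum>x\<in>set_pmf p. 1 / real (card A)) \<le> 1"
      using assms ne by (simp add: divide_le_eq card_gt_0_iff card_mono)
  qed (use assms ne in \<open>auto simp: card_gt_0_iff\<close>)
  then show ?thesis using assms ne by (simp add: log_divide card_gt_0_iff)
qed

text \<open>Total variation distance at most \<open>e\<close>. The one-sided form says the same,
  since complements give the reverse inequality (\<open>close_sym\<close>).\<close>

definition close :: "real \<Rightarrow> 'a pmf \<Rightarrow> 'a pmf \<Rightarrow> bool" where
  "close e p q \<longleftrightarrow> (\<forall>A. measure_pmf.prob p A \<le> measure_pmf.prob q A + e)"

lemma close_sym: "close e p q \<Longrightarrow> close e q p"
  unfolding close_def
proof
  fix A assume *: "\<forall>A. measure_pmf.prob p A \<le> measure_pmf.prob q A + e"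
  have "measure_pmf.prob q A = 1 - measure_pmf.prob q (- A)" "measure_pmf.prob p A = 1 - measure_pmf.prob p (- A)"
    using measure_pmf.prob_compl[of A p] measure_pmf.prob_compl[of A q] by (simp_all add: Compl_eq_Diff_UNIV)
  with *[rule_format, of "- A"] show "measure_pmf.prob q A \<le> measure_pmf.prob p A + e" by simp
qed

lemma close_mono: "close e p q \<Longrightarrow> e \<le> e' \<Longrightarrow> close e' p q"
  unfolding close_def by (meson add_left_mono order_trans)

lemma close_refl: "close 0 p p"
  by (simp add: close_def)

lemma close_trans: "close e p q \<Longrightarrow> close e' q r \<Longrightarrow> close (e + e') p r"
  unfolding close_def by (smt (verit))

lemma close_map: "close e p q \<Longrightarrow> close e (map_pmf f p) (map_pmf f q)"
  by (simp add: close_def)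

text \<open>The worst case is \<open>h = H\<close> where \<open>p\<close> exceeds \<open>q\<close>
  and \<open>h = 0\<close> elsewhere; this excess has mass at most \<open>e\<close>.\<close>

lemma close_expectation:
  assumes c: "close e p q" and fin: "finite (set_pmf p)" "finite (set_pmf q)"
    and h: "\<And>x. x \<in> set_pmf p \<union> set_pmf q \<Longrightarrow> 0 \<le> h x \<and> h x \<le> H"
  shows "measure_pmf.expectation p h \<le> measure_pmf.expectation q h + e * (H::real)"
proof -
  let ?U = "set_pmf p \<union> set_pmf q"
  let ?A = "{x\<in>?U. pmf q x < pmf p x}"
  have fU: "finite ?U" using fin by simp
  have H: "H \<ge> 0" using h set_pmf_not_empty[of p] by force
  have E: "measure_pmf.expectation p h = (\<Sum>x\<in>?U. pmf p x * h x)"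
       "measure_pmf.expectation q h = (\<Sum>x\<in>?U. pmf q x * h x)"
    using fU by (auto simp: integral_measure_pmf_real[of ?U] mult.commute)
  have "measure_pmf.expectation p h - measure_pmf.expectation q h = (\<Sum>x\<in>?U. (pmf p x - pmf q x) * h x)"
    unfolding E by (simp add: sum_subtractf algebra_simps)
  also have "\<dots> \<le> (\<Sum>x\<in>?U. if x \<in> ?A then (pmf p x - pmf q x) * H else 0)"
  proof (rule sum_mono)
    fix x assume x: "x \<in> ?U"
    show "(pmf p x - pmf q x) * h x \<le> (if x \<in> ?A then (pmf p x - pmf q x) * H else 0)"
      using h[OF x] x by (auto intro!: mult_left_mono mult_nonpos_nonneg)
  qed
  also have "\<dots> = (\<Sum>x\<in>?A. (pmf p x - pmf q x) * H)"
    using fU by (simp add: sum.If_cases Int_def)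
  also have "\<dots> = (measure_pmf.prob p ?A - measure_pmf.prob q ?A) * H"
    using fU by (simp add: measure_measure_pmf_finite sum_subtractf sum_distrib_right[symmetric])
  also have "\<dots> \<le> e * H" using c H by (intro mult_right_mono) (auto simp: close_def algebra_simps)
  finally show ?thesis by simp
qed

lemma prob_bind_pmf:
  "measure_pmf.prob (bind_pmf p k) A = measure_pmf.expectation p (\<lambda>x. measure_pmf.prob (k x) A)"
  unfolding measure_pmf_bind
  by (subst measure_pmf.measure_bind[where N="count_space UNIV"])
    (auto simp: space_subprob_algebra prob_space_imp_subprob_space measure_pmf.prob_space_axioms)

lemma close_bind_left:
  assumes c: "close e p q" and fin: "finite (set_pmf p)" "finite (set_pmf q)"
  shows "close e (bind_pmf p k) (bind_pmf q k)"
  unfolding close_def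
proof
  fix A
  show "measure_pmf.prob (bind_pmf p k) A \<le> measure_pmf.prob (bind_pmf q k) A + e"
    using close_expectation[OF c fin, of "\<lambda>x. measure_pmf.prob (k x) A" 1] by (simp add: prob_bind_pmf)
qed

lemma close_bind_right:
  assumes c: "\<And>x. x \<in> set_pmf p \<Longrightarrow> close e (k x) (l x)"  and fin: "finite (set_pmf p)"
  shows "close e (bind_pmf p k) (bind_pmf p l)"
  unfolding close_def
proof
  fix A
  have "measure_pmf.expectation p (\<lambda>x. measure_pmf.prob (k x) A) \<le> measure_pmf.expectation p (\<lambda>x. measure_pmf.prob (l x) A + e)"
    using c by (intro expectation_mono fin) (auto simp: close_def)
  then show "measure_pmf.prob (bind_pmf p k) A \<le> measure_pmf.prob (bind_pmf p l) A + e"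
    using fin by (simp add: prob_bind_pmf)
qed

text \<open>Coordinates are exchanged one at a time, each at cost \<open>e\<close>.\<close>

lemma close_Pi_pmf:
  fixes e :: real
  assumes "close e p q" "finite (set_pmf p)" "finite (set_pmf q)" "finite I"
  shows "close (card I * e) (Pi_pmf I d (\<lambda>_. p)) (Pi_pmf I d (\<lambda>_. q))"
  using assms(4)
proof induction
  case empty then show ?case by (simp add: close_refl)
next
  case (insert i I)
  have fP: "finite (set_pmf (Pi_pmf I d (\<lambda>_. r)))" if "finite (set_pmf r)" for r
    using that insert(1) by (simp add: set_Pi_pmf finite_PiE_dflt)
  have P: "Pi_pmf (insert i I) d (\<lambda>_. r) = bind_pmf r (\<lambda>y. map_pmf (\<lambda>f. f(i := y)) (Pi_pmf I d (\<lambda>_. r)))" for r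
    using insert by (simp add: Pi_pmf_insert' map_pmf_def)
  have "close (e + card I * e) (Pi_pmf (insert i I) d (\<lambda>_. p)) (Pi_pmf (insert i I) d (\<lambda>_. q))"
    unfolding P
    by (rule close_trans[OF close_bind_left close_bind_right]) (auto intro!: assms close_map insert.IH)
  then show ?case using insert by (simp add: algebra_simps)
qed

text \<open>The bound comes from Gibbs' inequality with the mixture of \<^term>\<open>q\<close> and the uniform
  distribution, which is at least half of either.\<close>

lemma ent_continuous:
  assumes A: "finite A" "set_pmf p \<subseteq> A" "set_pmf q \<subseteq> A" and c: "close e p q" "e \<le> 1"
  shows "ent p (\<lambda>x. x) \<le> ent q (\<lambda>x. x) + 2 + e * log 2 (card A)"
proof -
  have ne: "A \<noteq> {}" using assms set_pmf_not_empty[of p] by auto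
  define k where "k = real (card A)"
  have k: "k \<ge> 1" using A(1) ne unfolding k_def by (simp add: Suc_leI card_gt_0_iff)
  have fin: "finite (set_pmf p)" "finite (set_pmf q)" using A finite_subset by auto
  define r where "r x = pmf q x / 2 + 1 / (2 * k)" for x
  have r: "r x \<ge> 1 / (2 * k)" "r x \<ge> pmf q x / 2" "r x > 0" for x
    using k by (auto simp: r_def add_nonneg_pos)
  have r1: "r x \<le> 1" for x
  proof -
    have "1 / (2 * k) \<le> 1 / 2" using k by (simp add: field_simps)
    then show ?thesis using pmf_le_1[of q x] by (simp add: r_def)
  qed
  have "(\<Sum>x\<in>set_pmf p. r x) \<le> (\<Sum>x\<in>A. r x)"
    using A r by (intro sum_mono2) (auto intro: less_imp_le)
  also have "\<dots> = 1" using k sum_pmf_eq_1[OF A(1,3)]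
    by (simp add: r_def sum.distrib sum_divide_distrib[symmetric] flip: k_def)
  finally have "ent p (\<lambda>x. x) \<le> measure_pmf.expectation p (\<lambda>x. - log 2 (r x))"
    using r by (intro ent_le_cross_entropy fin) auto
  also have "\<dots> \<le> measure_pmf.expectation q (\<lambda>x. - log 2 (r x)) + e * (1 + log 2 k)"
  proof (rule close_expectation[OF c(1) fin])
    fix x
    have "- log 2 (r x) \<le> - log 2 (1 / (2 * k))"
      using r(1)[of x] k by (subst neg_le_iff_le, subst log_le_cancel_iff) (auto intro: r)
    then show "0 \<le> - log 2 (r x) \<and> - log 2 (r x) \<le> 1 + log 2 k"
      using r1[of x] r(3)[of x] k by (auto simp: log_divide log_mult)
  qed
  also have "measure_pmf.expectation q (\<lambda>x. - log 2 (r x)) \<le> measure_pmf.expectation q (\<lambda>x. info q (\<lambda>x. x) x + 1)"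
  proof (rule expectation_mono[OF fin(2)])
    fix x assume x: "x \<in> set_pmf q"
    then have "- log 2 (r x) \<le> - log 2 (pmf q x / 2)"
      using r(2)[of x] by (subst neg_le_iff_le, subst log_le_cancel_iff) (auto intro: r pmf_positive)
    then show "- log 2 (r x) \<le> info q (\<lambda>x. x) x + 1"
      using pmf_positive[OF x] by (simp add: info_def pr_eq_pmf log_divide)
  qed
  also have "\<dots> = ent q (\<lambda>x. x) + 1" using fin by (simp add: ent_def)
  finally have "ent p (\<lambda>x. x) \<le> ent q (\<lambda>x. x) + 1 + e * (1 + log 2 k)" by simp
  also have "e * (1 + log 2 k) \<le> 1 + e * log 2 k" using c(2) by (simp add: algebra_simps)
  finally show ?thesis by (simp add: k_def)
qed

section \<open>Independent copies\<close>

lemma prob_eq_expectation: "measure_pmf.prob p A = measure_pmf.expectation p (indicator A)"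
  by simp

lemma prob_markov:
  assumes fin: "finite (set_pmf p)" and h: "\<And>x. x \<in> set_pmf p \<Longrightarrow> 0 \<le> h x" and a: "a > (0::real)"
  shows "measure_pmf.prob p {x. a \<le> h x} \<le> measure_pmf.expectation p h / a"
proof -
  have "a * measure_pmf.prob p {x. a \<le> h x} = measure_pmf.expectation p (\<lambda>x. a * indicator {x. a \<le> h x} x)"
    by simp
  also have "\<dots> \<le> measure_pmf.expectation p h"
    using h by (intro expectation_mono fin) (auto simp: indicator_def)
  finally show ?thesis using a by (simp add: field_simps)
qed

lemma expectation_pair_pmf:
  assumes "finite (set_pmf p)" "finite (set_pmf q)"
  shows "measure_pmf.expectation (pair_pmf p q) h =
    measure_pmf.expectation p (\<lambda>x. measure_pmf.expectation q (\<lambda>y. h (x, y) :: real))"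
proof -
  have "(\<Sum>z\<in>set_pmf p \<times> set_pmf q. pmf (pair_pmf p q) z * h z)
      = (\<Sum>(x, y)\<in>set_pmf p \<times> set_pmf q. pmf p x * (pmf q y * h (x, y)))"
    by (intro sum.cong) (auto simp: pmf_pair)
  also have "\<dots> = (\<Sum>x\<in>set_pmf p. pmf p x * (\<Sum>y\<in>set_pmf q. pmf q y * h (x, y)))"
    by (simp add: sum_distrib_left sum.cartesian_product)
  moreover have "finite (set_pmf (pair_pmf p q))" using assms by simp
  ultimately show ?thesis
    by (simp only: expectation_finite[OF assms(1)] expectation_finite[OF assms(2)] expectation_finite set_pair_pmf)
qed

lemma finite_set_Pi_pmf:
  "finite I \<Longrightarrow> (\<And>i. i \<in> I \<Longrightarrow> finite (set_pmf (p i))) \<Longrightarrow> finite (set_pmf (Pi_pmf I d p))"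
  by (auto simp: set_Pi_pmf intro!: finite_PiE_dflt)

lemma expectation_Pi_pmf_component:
  assumes "finite I" "i \<in> I"
  shows "measure_pmf.expectation (Pi_pmf I d p) (\<lambda>f. g (f i)) = measure_pmf.expectation (p i) (g :: _ \<Rightarrow> real)"
proof -
  have "measure_pmf.expectation (p i) g = measure_pmf.expectation (map_pmf (\<lambda>f. f i) (Pi_pmf I d p)) g"
    using assms by (simp add: Pi_pmf_component)
  then show ?thesis by simp
qed

lemma Pi_pmf_second_moment:
  assumes fin: "finite (set_pmf p)" and g: "measure_pmf.expectation p g = 0" and "finite I"
  shows "measure_pmf.expectation (Pi_pmf I d (\<lambda>_. p)) (\<lambda>f. (\<Sum>i\<in>I. g (f i))\<^sup>2)
    = real (card I) * measure_pmf.expectation p (\<lambda>x. (g x)\<^sup>2)"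
  using assms(3)
proof induction
  case empty then show ?case by simp
next
  case (insert i I)
  let ?P = "Pi_pmf I d (\<lambda>_. p)"
  let ?S = "\<lambda>f. \<Sum>j\<in>I. g (f j)"
  have fP: "finite (set_pmf ?P)" using insert(1) fin by (intro finite_set_Pi_pmf)
  have S: "measure_pmf.expectation ?P ?S = 0"
    using fP insert(1) by (simp add: expectation_Pi_pmf_component g)
  have S': "(\<Sum>j\<in>I. g (if j = i then y else f j)) = ?S f" for y f
    using insert(2) by (intro sum.cong) auto
  have "measure_pmf.expectation (Pi_pmf (insert i I) d (\<lambda>_. p)) (\<lambda>f. (\<Sum>i\<in>insert i I. g (f i))\<^sup>2)
     = measure_pmf.expectation (pair_pmf p ?P) (\<lambda>(y, f). (g y + ?S f)\<^sup>2)"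
    using insert(1,2) by (simp add: Pi_pmf_insert case_prod_unfold S')
  also have "\<dots> = measure_pmf.expectation p (\<lambda>y. measure_pmf.expectation ?P (\<lambda>f. (g y)\<^sup>2 + 2 * g y * ?S f + (?S f)\<^sup>2))"
    by (simp add: expectation_pair_pmf[OF fin fP] power2_sum algebra_simps)
  also have "\<dots> = measure_pmf.expectation p (\<lambda>y. (g y)\<^sup>2 + measure_pmf.expectation ?P (\<lambda>f. (?S f)\<^sup>2))"
    using fP S by (simp del: Bochner_Integration.integral_sum)
  also have "\<dots> = measure_pmf.expectation p (\<lambda>y. (g y)\<^sup>2) + measure_pmf.expectation ?P (\<lambda>f. (?S f)\<^sup>2)"
    using fin by simp
  finally show ?case using insert by (simp add: algebra_simps)
qed

text \<open>Chebyshev's inequality for the truncated variables \<open>min (f x) L\<close>; only the upper tail is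
  controlled, so that truncation costs nothing in the mean.\<close>

lemma Pi_pmf_upper_tail:
  fixes f :: "'a \<Rightarrow> real" and h L e :: real
  assumes fin: "finite (set_pmf p)" and f: "\<And>x. x \<in> set_pmf p \<Longrightarrow> 0 \<le> f x"
    and h: "measure_pmf.expectation p f \<le> h" and L: "L > 0" and e: "e > 0"
    and I: "finite I" "I \<noteq> {}"
  shows "measure_pmf.prob (Pi_pmf I d (\<lambda>_. p)) {w. (\<Sum>i\<in>I. f (w i)) > card I * (h + e)}
    \<le> card I * measure_pmf.prob p {x. f x > L} + L * h / (card I * e\<^sup>2)"
proof -
  let ?P = "Pi_pmf I d (\<lambda>_. p)"
  define f' where "f' x = min (f x) L" for x
  define \<mu> where "\<mu> = measure_pmf.expectation p f'"
  define g where "g x = f' x - \<mu>" for x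
  have fP: "finite (set_pmf ?P)" using I fin by (intro finite_set_Pi_pmf)
  have n: "real (card I) > 0" using I by (simp add: card_gt_0_iff)
  have \<mu>: "\<mu> \<le> h" unfolding \<mu>_def
    by (rule order_trans[OF expectation_mono[OF fin] h]) (simp add: f'_def)
  have g0: "measure_pmf.expectation p g = 0"
    using fin by (simp add: g_def[abs_def] \<mu>_def)
  have "measure_pmf.expectation p (\<lambda>x. (g x)\<^sup>2) = measure_pmf.expectation p (\<lambda>x. (f' x)\<^sup>2 - 2 * \<mu> * f' x + \<mu>\<^sup>2)"
    by (simp add: g_def power2_diff algebra_simps)
  also have "\<dots> = measure_pmf.expectation p (\<lambda>x. (f' x)\<^sup>2) - \<mu>\<^sup>2"
    using fin by (simp add: \<mu>_def[symmetric] power2_eq_square)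
  also have "\<dots> \<le> measure_pmf.expectation p (\<lambda>x. (f' x)\<^sup>2)" by simp
  \<comment> \<open>A nonnegative variable cut off at \<open>L\<close> has square at most
    \<open>L * f\<close>. With \<open>L\<close> and \<open>h\<close> both of order n, as later, the
    variance is of order n^2, which matches deviations of order n.\<close>
  also have "\<dots> \<le> measure_pmf.expectation p (\<lambda>x. L * f x)"
  proof (rule expectation_mono[OF fin])
    fix x assume "x \<in> set_pmf p"
    with f[OF this] L show "(f' x)\<^sup>2 \<le> L * f x"
      unfolding power2_eq_square f'_def by (intro mult_mono) auto
  qed
  also have "\<dots> \<le> L * h" using h L by simp
  finally have g2: "measure_pmf.expectation p (\<lambda>x. (g x)\<^sup>2) \<le> L * h" .
  \<comment> \<open>Either some coordinate was cut off, or the centred sum of the truncated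
    variables is large.\<close>
  let ?A = "\<Union>i\<in>I. {w. f (w i) > L}" and ?B = "{w. (card I * e)\<^sup>2 \<le> (\<Sum>i\<in>I. g (w i))\<^sup>2}"
  have "{w. (\<Sum>i\<in>I. f (w i)) > card I * (h + e)} \<subseteq> ?A \<union> ?B"
  proof
    fix w assume w: "w \<in> {w. (\<Sum>i\<in>I. f (w i)) > card I * (h + e)}"
    show "w \<in> ?A \<union> ?B"
    proof (cases "w \<in> ?A")
      case False
      then have "(\<Sum>i\<in>I. g (w i)) = (\<Sum>i\<in>I. f (w i)) - card I * \<mu>"
        by (auto simp: g_def f'_def sum_subtractf intro!: sum.cong)
      moreover have "card I * \<mu> \<le> card I * h" using \<mu> by (intro mult_left_mono) auto
      ultimately have "card I * e \<le> (\<Sum>i\<in>I. g (w i))" using w by (simp add: algebra_simps)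
      then have "(card I * e)\<^sup>2 \<le> (\<Sum>i\<in>I. g (w i))\<^sup>2" using e by (intro power_mono) auto
      then show ?thesis by simp
    qed simp
  qed
  then have "measure_pmf.prob ?P {w. (\<Sum>i\<in>I. f (w i)) > card I * (h + e)} \<le> measure_pmf.prob ?P (?A \<union> ?B)"
    by (intro measure_pmf.finite_measure_mono) auto
  also have "\<dots> \<le> measure_pmf.prob ?P ?A + measure_pmf.prob ?P ?B"
    by (intro measure_Un_le) auto
  also have "measure_pmf.prob ?P ?A \<le> (\<Sum>i\<in>I. measure_pmf.prob ?P {w. f (w i) > L})"
    using I by (intro measure_pmf.finite_measure_subadditive_finite) auto
  also have "\<dots> = (\<Sum>i\<in>I. measure_pmf.prob p {x. f x > L})"
  proof (rule sum.cong[OF refl])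
    fix i assume i: "i \<in> I"
    have "measure_pmf.prob p {x. f x > L} = measure_pmf.prob (map_pmf (\<lambda>w. w i) ?P) {x. f x > L}"
      using I i by (simp add: Pi_pmf_component)
    then show "measure_pmf.prob ?P {w. f (w i) > L} = measure_pmf.prob p {x. f x > L}"
      by (simp add: vimage_def)
  qed
  also have "measure_pmf.prob ?P ?B \<le> measure_pmf.expectation ?P (\<lambda>w. (\<Sum>i\<in>I. g (w i))\<^sup>2) / (card I * e)\<^sup>2"
    using n e by (intro prob_markov fP) auto
  also have "\<dots> = measure_pmf.expectation p (\<lambda>x. (g x)\<^sup>2) / (card I * e\<^sup>2)"
    unfolding Pi_pmf_second_moment[OF fin g0 I(1)] using n by (simp add: power_mult_distrib power2_eq_square)
  also have "\<dots> \<le> L * h / (card I * e\<^sup>2)"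
    using g2 n e by (intro divide_right_mono) auto
  finally show ?thesis by simp
qed

section \<open>Random binning\<close>

text \<open>Greedy choice of the bins: a new element joins the bin that adds the least collision
  weight, which is at most the average over all bins. This replaces the expectation over a random
  hash function.\<close>

lemma few_collisions:
  fixes c :: "'y \<Rightarrow> 'y \<Rightarrow> real"
  assumes "finite Y" and c: "\<And>y y'. 0 \<le> c y y'" and B: "B > (0::nat)"
  shows "\<exists>b. (\<forall>y. b y < B) \<and>
    (\<Sum>y\<in>Y. \<Sum>y'\<in>Y. if y \<noteq> y' \<and> b y = b y' then c y y' else 0) \<le> (\<Sum>y\<in>Y. \<Sum>y'\<in>Y. c y y') / B"
  using assms(1)
proof induction
  case empty then show ?case using B by (intro exI[of _ "\<lambda>_. 0"]) auto
next
  case (insert a Y)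
  then obtain b where b: "\<And>y. b y < B"
    "(\<Sum>y\<in>Y. \<Sum>y'\<in>Y. if y \<noteq> y' \<and> b y = b y' then c y y' else 0) \<le> (\<Sum>y\<in>Y. \<Sum>y'\<in>Y. c y y') / B" by blast
  define d where "d y = c a y + c y a" for y
  define t where "t k = (\<Sum>y\<in>Y. if b y = k then d y else 0)" for k
  have "(\<Sum>k<B. t k) = (\<Sum>y\<in>Y. d y)"
    unfolding t_def by (subst sum.swap) (simp add: b)
  moreover have "\<exists>k<B. t k \<le> (\<Sum>y\<in>Y. d y) / B"
  proof (rule ccontr)
    assume "\<not> (\<exists>k<B. t k \<le> (\<Sum>y\<in>Y. d y) / B)"
    then have "(\<Sum>k<B. (\<Sum>y\<in>Y. d y) / B) < (\<Sum>k<B. t k)"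
      using B by (intro sum_strict_mono) auto
    then show False using B \<open>(\<Sum>k<B. t k) = (\<Sum>y\<in>Y. d y)\<close> by simp
  qed
  ultimately obtain k where k: "k < B" "t k \<le> (\<Sum>y\<in>Y. d y) / B" by blast
  let ?b = "b(a := k)"
  have "(\<Sum>y\<in>insert a Y. \<Sum>y'\<in>insert a Y. if y \<noteq> y' \<and> ?b y = ?b y' then c y y' else 0)
    = (\<Sum>y\<in>insert a Y. (if y \<noteq> a \<and> ?b y = k then c y a else 0)
         + (\<Sum>y'\<in>Y. if y \<noteq> y' \<and> ?b y = b y' then c y y' else 0))"
    using insert(1,2) by (intro sum.cong[OF refl]) (auto intro!: sum.cong)
  also have "\<dots> = (\<Sum>y'\<in>Y. if k = b y' then c a y' else 0)
      + (\<Sum>y\<in>Y. (if b y = k then c y a else 0) + (\<Sum>y'\<in>Y. if y \<noteq> y' \<and> b y = b y' then c y y' else 0))"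
    using insert(1,2) by (simp, intro arg_cong2[where f="(+)"] sum.cong[OF refl]) (auto intro!: sum.cong)
  also have "\<dots> = t k + (\<Sum>y\<in>Y. \<Sum>y'\<in>Y. if y \<noteq> y' \<and> b y = b y' then c y y' else 0)"
    unfolding t_def d_def sum.distrib add.assoc[symmetric]
    by (simp add: sum.distrib[symmetric]) (auto intro!: sum.cong)
  also have "\<dots> \<le> (\<Sum>y\<in>Y. d y) / B + (\<Sum>y\<in>Y. \<Sum>y'\<in>Y. c y y') / B"
    using k b by simp
  also have "\<dots> = ((\<Sum>y\<in>insert a Y. \<Sum>y'\<in>insert a Y. c y y') - c a a) / B"
    using insert(1,2) by (simp add: d_def sum.distrib add_divide_distrib[symmetric])
  also have "\<dots> \<le> (\<Sum>y\<in>insert a Y. \<Sum>y'\<in>insert a Y. c y y') / B"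
    using c by (intro divide_right_mono) auto
  finally show ?case using b(1) k(1) by (intro exI[of _ ?b]) auto
qed

text \<open>The list that a decoder with side information \<open>z x\<close> has to consider: the
  conditionally typical values of \<open>y\<close>.\<close>

definition candidates :: "'a pmf \<Rightarrow> ('a \<Rightarrow> 'y) \<Rightarrow> ('a \<Rightarrow> 'z) \<Rightarrow> real \<Rightarrow> 'a \<Rightarrow> 'y set" where
  "candidates p y z g x =
     {y w | w. w \<in> set_pmf p \<and> z w = z x \<and> info p (\<lambda>x. (y x, z x)) w - info p z w \<le> g}"

lemma candidates_subset: "candidates p y z g x \<subseteq> y ` set_pmf p"
  by (auto simp: candidates_def)

text \<open>Each value on the list has conditional probability at least \<open>2 powr (- g)\<close>
  given \<open>z x\<close>, and these probabilities add up to at most 1.\<close>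

lemma card_candidates:
  assumes fin: "finite (set_pmf p)" and x: "x \<in> set_pmf p"
  shows "real (card (candidates p y z g x)) \<le> 2 powr g"
proof -
  let ?C = "candidates p y z g x" and ?yz = "\<lambda>x. (y x, z x)"
  have fC: "finite ?C" using fin by (rule finite_surj[of _ _ y]) (auto simp: candidates_def)
  have low: "2 powr (- g) * pr p z x \<le> measure_pmf.prob p {w. y w = v \<and> z w = z x}" if "v \<in> ?C" for v
  proof -
    from that obtain w where w: "w \<in> set_pmf p" "z w = z x" "y w = v" "info p ?yz w - info p z w \<le> g"
      by (auto simp: candidates_def)
    note pos = pr_pos[OF w(1), of ?yz] pr_pos[OF w(1), of z]
    have "log 2 (2 powr (- g) * pr p z w) \<le> log 2 (pr p ?yz w)"
      using w(4) pos by (simp add: info_def log_mult)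
    then have "2 powr (- g) * pr p z w \<le> pr p ?yz w"
      using pos by (subst (asm) log_le_cancel_iff) auto
    then show ?thesis using w by (simp add: pr_def)
  qed
  have "card ?C * (2 powr (- g) * pr p z x) \<le> (\<Sum>v\<in>?C. measure_pmf.prob p {w. y w = v \<and> z w = z x})"
    using low by (rule sum_bounded_below)
  also have "\<dots> = measure_pmf.prob p (\<Union>v\<in>?C. {w. y w = v \<and> z w = z x})"
    using fC by (subst measure_pmf.finite_measure_finite_Union) (auto simp: disjoint_family_on_def)
  also have "\<dots> \<le> pr p z x"
    unfolding pr_def by (intro measure_pmf.finite_measure_mono) auto
  finally show ?thesis using pr_pos[OF x, of z] by (simp add: powr_minus field_simps)
qed

text \<open>Slepian-Wolf coding of \<open>y\<close> with one hash function for two decoders, whose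
  side information is \<open>z1\<close> and \<open>z2\<close>. Charging the lists of both decoders
  together costs only a factor 2.\<close>

lemma binning:
  fixes y :: "'a \<Rightarrow> 'y" and z1 :: "'a \<Rightarrow> 'z1" and z2 :: "'a \<Rightarrow> 'z2" and B :: nat and g :: real
  assumes fin: "finite (set_pmf p)" and B: "B > 0"
  defines "i1 \<equiv> \<lambda>x. info p (\<lambda>x. (y x, z1 x)) x - info p z1 x"
    and "i2 \<equiv> \<lambda>x. info p (\<lambda>x. (y x, z2 x)) x - info p z2 x"
  shows "\<exists>b E. (\<forall>v. b v < B) \<and>
    measure_pmf.prob p (- E) \<le> measure_pmf.prob p {x. i1 x > g} + measure_pmf.prob p {x. i2 x > g} + 2 * 2 powr g / B \<and>
    (\<forall>x\<in>E. \<forall>x'\<in>E. (z1 x = z1 x' \<or> z2 x = z2 x') \<longrightarrow> b (y x) = b (y x') \<longrightarrow> y x = y x')"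
proof -
  let ?Y = "y ` set_pmf p"
  define N where "N x = candidates p y z1 g x" for x
  define N' where "N' x = candidates p y z2 g x" for x
  \<comment> \<open>A sum of two probabilities: \<open>v\<close> is the true value while
    \<open>v'\<close> stands on the list of the first, or of the second decoder. Only such
    collisions do harm.\<close>
  define c where "c v v' = measure_pmf.prob p {x. y x = v \<and> v' \<in> N x} + measure_pmf.prob p {x. y x = v \<and> v' \<in> N' x}" for v v'
  have tot: "(\<Sum>v\<in>?Y. \<Sum>v'\<in>?Y. measure_pmf.prob p {x. y x = v \<and> v' \<in> C x}) \<le> 2 powr g"
    if C: "\<And>x. x \<in> set_pmf p \<Longrightarrow> C x \<subseteq> ?Y \<and> real (card (C x)) \<le> 2 powr g" for C
  proof -
    have "(\<Sum>v\<in>?Y. \<Sum>v'\<in>?Y. measure_pmf.prob p {x. y x = v \<and> v' \<in> C x})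
        = measure_pmf.expectation p (\<lambda>x. \<Sum>v\<in>?Y. \<Sum>v'\<in>?Y. indicator {x. y x = v \<and> v' \<in> C x} x)"
      by (subst Bochner_Integration.integral_sum[OF integrable_finite_pmf[OF fin]],
        subst Bochner_Integration.integral_sum[OF integrable_finite_pmf[OF fin]]) (simp only: prob_eq_expectation)
    also have "\<dots> \<le> measure_pmf.expectation p (\<lambda>x. 2 powr g)"
    proof (rule expectation_mono[OF fin])
      fix x assume x: "x \<in> set_pmf p"
      have "(\<Sum>v\<in>?Y. \<Sum>v'\<in>?Y. indicator {x. y x = v \<and> v' \<in> C x} x :: real)
          = (\<Sum>v\<in>?Y. if v = y x then real (card (C x)) else 0)"
      proof (rule sum.cong[OF refl])
        fix v
        have "(\<Sum>v'\<in>?Y. indicator {x. y x = v \<and> v' \<in> C x} x :: real) = (\<Sum>v'\<in>?Y. if v' \<in> C x then (if v = y x then 1 else 0) else 0)"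
          by (intro sum.cong) (auto simp: indicator_def)
        also have "\<dots> = (\<Sum>v'\<in>C x. if v = y x then 1 else 0)"
          using C[OF x] fin by (simp add: sum.If_cases Int_absorb1)
        finally show "(\<Sum>v'\<in>?Y. indicator {x. y x = v \<and> v' \<in> C x} x :: real) = (if v = y x then real (card (C x)) else 0)"
          by simp
      qed
      also have "\<dots> = real (card (C x))" using x fin by simp
      finally show "(\<Sum>v\<in>?Y. \<Sum>v'\<in>?Y. indicator {x. y x = v \<and> v' \<in> C x} x :: real) \<le> 2 powr g"
        using C[OF x] by simp
    qed
    finally show ?thesis by simp
  qed
  have c_tot: "(\<Sum>v\<in>?Y. \<Sum>v'\<in>?Y. c v v') \<le> 2 * 2 powr g"
  proof -
    have "(\<Sum>v\<in>?Y. \<Sum>v'\<in>?Y. measure_pmf.prob p {x. y x = v \<and> v' \<in> N x}) \<le> 2 powr g"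
      by (intro tot conjI) (auto simp: N_def card_candidates[OF fin] dest: subsetD[OF candidates_subset])
    moreover have "(\<Sum>v\<in>?Y. \<Sum>v'\<in>?Y. measure_pmf.prob p {x. y x = v \<and> v' \<in> N' x}) \<le> 2 powr g"
      by (intro tot conjI) (auto simp: N'_def card_candidates[OF fin] dest: subsetD[OF candidates_subset])
    ultimately show ?thesis by (simp add: c_def sum.distrib)
  qed
  obtain b where b: "\<And>v. b v < B"
    "(\<Sum>v\<in>?Y. \<Sum>v'\<in>?Y. if v \<noteq> v' \<and> b v = b v' then c v v' else 0) \<le> (\<Sum>v\<in>?Y. \<Sum>v'\<in>?Y. c v v') / B"
    using few_collisions[of ?Y c B] fin B by (auto simp: c_def)
  define bad where "bad = (\<Union>v\<in>?Y. \<Union>v'\<in>{v'\<in>?Y. v \<noteq> v' \<and> b v = b v'}. {x. y x = v \<and> v' \<in> N x} \<union> {x. y x = v \<and> v' \<in> N' x})"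
  define E where "E = set_pmf p - ({x. i1 x > g} \<union> {x. i2 x > g} \<union> bad)"
  have "measure_pmf.prob p bad \<le> (\<Sum>v\<in>?Y. measure_pmf.prob p (\<Union>v'\<in>{v'\<in>?Y. v \<noteq> v' \<and> b v = b v'}. {x. y x = v \<and> v' \<in> N x} \<union> {x. y x = v \<and> v' \<in> N' x}))"
    unfolding bad_def using fin by (intro measure_pmf.finite_measure_subadditive_finite) auto
  also have "\<dots> \<le> (\<Sum>v\<in>?Y. \<Sum>v'\<in>{v'\<in>?Y. v \<noteq> v' \<and> b v = b v'}. c v v')"
  proof (rule sum_mono)
    fix v
    have "measure_pmf.prob p (\<Union>v'\<in>{v'\<in>?Y. v \<noteq> v' \<and> b v = b v'}. {x. y x = v \<and> v' \<in> N x} \<union> {x. y x = v \<and> v' \<in> N' x})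
      \<le> (\<Sum>v'\<in>{v'\<in>?Y. v \<noteq> v' \<and> b v = b v'}. measure_pmf.prob p ({x. y x = v \<and> v' \<in> N x} \<union> {x. y x = v \<and> v' \<in> N' x}))"
      using fin by (intro measure_pmf.finite_measure_subadditive_finite) auto
    also have "\<dots> \<le> (\<Sum>v'\<in>{v'\<in>?Y. v \<noteq> v' \<and> b v = b v'}. c v v')"
      unfolding c_def by (intro sum_mono measure_Un_le) auto
    finally show "measure_pmf.prob p (\<Union>v'\<in>{v'\<in>?Y. v \<noteq> v' \<and> b v = b v'}. {x. y x = v \<and> v' \<in> N x} \<union> {x. y x = v \<and> v' \<in> N' x})
      \<le> (\<Sum>v'\<in>{v'\<in>?Y. v \<noteq> v' \<and> b v = b v'}. c v v')" .
  qed
  also have "\<dots> = (\<Sum>v\<in>?Y. \<Sum>v'\<in>?Y. if v \<noteq> v' \<and> b v = b v' then c v v' else 0)"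
    using fin by (intro sum.cong[OF refl]) (simp add: sum.If_cases Int_def)
  also have "\<dots> \<le> 2 * 2 powr g / B"
    by (rule order_trans[OF b(2)]) (intro divide_right_mono c_tot, simp)
  finally have bad: "measure_pmf.prob p bad \<le> 2 * 2 powr g / B" .
  have "measure_pmf.prob p (- E) \<le> measure_pmf.prob p ({x. i1 x > g} \<union> {x. i2 x > g} \<union> bad)"
    by (intro measure_pmf.finite_measure_mono_AE AE_pmfI impI) (auto simp: E_def)
  also have "\<dots> \<le> measure_pmf.prob p ({x. i1 x > g} \<union> {x. i2 x > g}) + measure_pmf.prob p bad"
    by (intro measure_Un_le) auto
  also have "measure_pmf.prob p ({x. i1 x > g} \<union> {x. i2 x > g}) \<le> measure_pmf.prob p {x. i1 x > g} + measure_pmf.prob p {x. i2 x > g}"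
    by (intro measure_Un_le) auto
  finally have "measure_pmf.prob p (- E) \<le> measure_pmf.prob p {x. i1 x > g} + measure_pmf.prob p {x. i2 x > g} + 2 * 2 powr g / B"
    using bad by simp
  moreover have "y x = y x'" if "x \<in> E" "x' \<in> E" "z1 x = z1 x' \<or> z2 x = z2 x'" "b (y x) = b (y x')" for x x'
  proof (rule ccontr)
    assume "y x \<noteq> y x'"
    \<comment> \<open>As \<open>x'\<close> lies in \<open>E\<close> itself, its density is at most
      \<open>g\<close>, so it witnesses that \<open>y x'\<close> is on one of the lists of
      \<open>x\<close>.\<close>
    moreover have "y x' \<in> N x \<or> y x' \<in> N' x"
      using that unfolding N_def N'_def candidates_def E_def i1_def i2_def by force
    ultimately have "x \<in> bad" using that unfolding bad_def E_def by blast
    then show False using that by (simp add: E_def)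
  qed
  ultimately show ?thesis using b(1) by blast
qed

section \<open>Chains of edge variables\<close>

text \<open>An assignment to the edges of the complete graph on \<open>{1..m}\<close> is a function \<open>s\<close> whose entry
  \<open>s p q\<close> with \<open>p < q\<close> belongs to the edge \<open>{p, q}\<close>. Vertex \<open>p\<close> sees column \<open>p\<close> above the
  diagonal, \<open>lo\<close>, and row \<open>p\<close>, \<open>hi\<close>.\<close>

definition edges :: "nat \<Rightarrow> (nat \<times> nat) set" where
  "edges m = {(p, q). 1 \<le> p \<and> p < q \<and> q \<le> m}"

text \<open>Edges are decoded one after the other: \<open>col p q\<close> is what vertex
  \<open>q\<close> knows when it turns to the edge from \<open>p\<close>, and
  \<open>row p (q - 1)\<close> together with \<open>lo p\<close> is what vertex \<open>p\<close>
  knows when it turns to the edge to \<open>q\<close>.\<close>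

definition col :: "nat \<Rightarrow> nat \<Rightarrow> (nat \<Rightarrow> nat \<Rightarrow> 'v) \<Rightarrow> nat \<Rightarrow> 'v" where
  "col p q s = restrict (\<lambda>j. s j q) {1..<p}"

definition row :: "nat \<Rightarrow> nat \<Rightarrow> (nat \<Rightarrow> nat \<Rightarrow> 'v) \<Rightarrow> nat \<Rightarrow> 'v" where
  "row p q s = restrict (s p) {p<..q}"

abbreviation lo :: "nat \<Rightarrow> (nat \<Rightarrow> nat \<Rightarrow> 'v) \<Rightarrow> nat \<Rightarrow> 'v" where
  "lo p s \<equiv> col p p s"

definition view :: "nat \<Rightarrow> nat \<Rightarrow> (nat \<Rightarrow> nat \<Rightarrow> 'v) \<Rightarrow> nat \<Rightarrow> 'v" where
  "view m p s = restrict (\<lambda>j. if j < p then s j p else s p j) ({1..m} - {p})"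

text \<open>Entries off the edges are fixed, so that a canonical assignment is determined by its
  edge variables.\<close>

definition canon :: "nat \<Rightarrow> (nat \<Rightarrow> nat \<Rightarrow> 'v) \<Rightarrow> nat \<Rightarrow> nat \<Rightarrow> 'v" where
  "canon m s = (\<lambda>p q. if (p, q) \<in> edges m then s p q else undefined)"

lemma finite_edges [simp]: "finite (edges m)"
  by (rule finite_subset[of _ "{1..m} \<times> {1..m}"]) (auto simp: edges_def)

lemma restrict_eq_iff: "restrict f A = restrict g A \<longleftrightarrow> (\<forall>x\<in>A. f x = g x)"
  by (metis restrict_apply' restrict_ext)

lemma view_eq_iff:
  assumes "p \<in> {1..m}"
  shows "view m p s = view m p s' \<longleftrightarrow> lo p s = lo p s' \<and> row p m s = row p m s'"
  unfolding view_def col_def row_def restrict_eq_iff using assms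
  by (auto split: if_splits)

lemma canon_eq_iff: "canon m s = canon m s' \<longleftrightarrow> (\<forall>p\<in>{1..m}. row p m s = row p m s')"
  unfolding canon_def row_def restrict_eq_iff fun_eq_iff edges_def by force

lemma canon_eq_iff_view: "canon m s = canon m s' \<longleftrightarrow> (\<forall>p\<in>{1..m}. view m p s = view m p s')"
  unfolding canon_eq_iff using view_eq_iff[of _ m s s']
  by (auto simp: col_def row_def restrict_eq_iff)

text \<open>The Markov condition in constructive form: row \<open>p\<close> is drawn from what
  vertex \<open>p\<close> has received from its predecessors. \<open>markov_pmf\<close> and
  \<open>markov_chain\<close> give the two directions.\<close>

primrec chain :: "(nat \<Rightarrow> (nat \<Rightarrow> 'v) \<Rightarrow> (nat \<Rightarrow> 'v) pmf) \<Rightarrow> nat \<Rightarrow> (nat \<Rightarrow> nat \<Rightarrow> 'v) pmf" where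
  "chain \<kappa> 0 = return_pmf (\<lambda>_ _. undefined)"
| "chain \<kappa> (Suc n) =
     bind_pmf (chain \<kappa> n) (\<lambda>s. map_pmf (\<lambda>r. s(Suc n := r)) (\<kappa> (Suc n) (lo (Suc n) s)))"

lemma chain_undefined: "s \<in> set_pmf (chain \<kappa> n) \<Longrightarrow> q \<notin> {1..n} \<Longrightarrow> s q = (\<lambda>_. undefined)"
  by (induction n arbitrary: s) auto

lemma chain_kernel:
  "s \<in> set_pmf (chain \<kappa> n) \<Longrightarrow> p \<in> {1..n} \<Longrightarrow> \<exists>z. s p \<in> set_pmf (\<kappa> p z)"
  by (induction n arbitrary: s) (auto simp: le_Suc_eq)

lemma finite_chain: "(\<And>p z. finite (set_pmf (\<kappa> p z))) \<Longrightarrow> finite (set_pmf (chain \<kappa> n))"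
  by (induction n) auto

lemma lo_upd: "p \<le> k \<Longrightarrow> lo p (s(k := r)) = lo p s"
  by (auto simp: col_def)

text \<open>Only one intermediate state leads to \<open>s\<close>, namely \<open>s\<close> with its
  last row erased, because rows not yet drawn are \<open>undefined\<close>.\<close>

lemma pmf_chain:
  assumes "\<And>q. q \<notin> {1..n} \<Longrightarrow> s q = (\<lambda>_. undefined)"
  shows "pmf (chain \<kappa> n) s = (\<Prod>p=1..n. pmf (\<kappa> p (lo p s)) (s p))"
  using assms
proof (induction n arbitrary: s)
  case 0
  then have "s = (\<lambda>_ _. undefined)" by auto
  then show ?case by simp
next
  case (Suc n)
  let ?s = "s(Suc n := (\<lambda>_. undefined))"
  have *: "pmf (map_pmf (\<lambda>r. t(Suc n := r)) (\<kappa> (Suc n) (lo (Suc n) t))) s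
      = (if t = ?s then pmf (\<kappa> (Suc n) (lo (Suc n) s)) (s (Suc n)) else 0)"
    if t: "t \<in> set_pmf (chain \<kappa> n)" for t
  proof -
    have tu: "t (Suc n) = (\<lambda>_. undefined)" using chain_undefined[OF t] by simp
    have inj: "inj (\<lambda>r. t(Suc n := r))" by (rule injI) (metis fun_upd_same)
    show ?thesis
    proof (cases "t = ?s")
      case True
      then have "s = t(Suc n := s (Suc n))" by simp
      then show ?thesis
        using True pmf_map_inj'[OF inj, of "\<kappa> (Suc n) (lo (Suc n) t)" "s (Suc n)"] by (simp add: lo_upd)
    next
      case False
      have "s \<noteq> t(Suc n := r)" for r
      proof
        assume "s = t(Suc n := r)"
        then have "?s = t(Suc n := (\<lambda>_. undefined))" by simp
        also have "\<dots> = t" using tu by (simp add: fun_upd_idem)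
        finally show False using False by simp
      qed
      then show ?thesis using False by (auto simp: pmf_eq_0_set_pmf)
    qed
  qed
  have "pmf (chain \<kappa> (Suc n)) s = measure_pmf.expectation (chain \<kappa> n)
      (\<lambda>t. indicator {?s} t * pmf (\<kappa> (Suc n) (lo (Suc n) s)) (s (Suc n)))"
    unfolding chain.simps pmf_bind by (intro expectation_cong) (simp add: * indicator_def)
  also have "\<dots> = pmf (chain \<kappa> n) ?s * pmf (\<kappa> (Suc n) (lo (Suc n) s)) (s (Suc n))"
    by (simp add: pmf.rep_eq)
  also have "pmf (chain \<kappa> n) ?s = (\<Prod>p=1..n. pmf (\<kappa> p (lo p ?s)) (?s p))"
    using Suc.prems by (intro Suc.IH) auto
  also have "\<dots> = (\<Prod>p=1..n. pmf (\<kappa> p (lo p s)) (s p))"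
    by (intro prod.cong) (auto simp: lo_upd)
  finally show ?case by simp
qed

text \<open>\<open>A\<close> is an event about the rows before \<open>p\<close> that fixes
  \<open>lo p\<close>, so row \<open>p\<close> is drawn from one and the same kernel throughout
  \<open>A\<close>; the rows drawn later affect neither event.\<close>

lemma prob_chain_row:
  assumes p: "p \<in> {1..n}" and A: "\<And>s q r. p \<le> q \<Longrightarrow> A (s(q := r)) = A s" and z: "\<And>s. A s \<Longrightarrow> lo p s = z"
  shows "measure_pmf.prob (chain \<kappa> n) {s. A s \<and> s p = r} = measure_pmf.prob (chain \<kappa> n) {s. A s} * pmf (\<kappa> p z) r"
  using p
proof (induction n)
  case (Suc n)
  have *: "measure_pmf.prob (chain \<kappa> (Suc n)) X = measure_pmf.expectation (chain \<kappa> n)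
      (\<lambda>s. measure_pmf.prob (\<kappa> (Suc n) (lo (Suc n) s)) {r. s(Suc n := r) \<in> X})" for X
    by (simp add: prob_bind_pmf vimage_def)
  have skip: "measure_pmf.prob (chain \<kappa> (Suc n)) {s. C s} = measure_pmf.prob (chain \<kappa> n) {s. C s}"
    if C: "\<And>s r. C (s(Suc n := r)) = C s" for C
    unfolding * prob_eq_expectation[of "chain \<kappa> n"]
    by (intro expectation_cong) (simp add: C indicator_def)
  show ?case
  proof (cases "p = Suc n")
    case False
    then have "p \<le> n" using Suc by simp
    then have "measure_pmf.prob (chain \<kappa> (Suc n)) {s. A s \<and> s p = r} = measure_pmf.prob (chain \<kappa> n) {s. A s \<and> s p = r}"
      "measure_pmf.prob (chain \<kappa> (Suc n)) {s. A s} = measure_pmf.prob (chain \<kappa> n) {s. A s}"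
      using Suc.prems by (intro skip; simp add: A)+
    then show ?thesis using Suc.IH \<open>p \<le> n\<close> Suc.prems by simp
  next
    case True
    have "measure_pmf.prob (chain \<kappa> (Suc n)) {s. A s \<and> s p = r}
        = measure_pmf.expectation (chain \<kappa> n) (\<lambda>s. indicator {s. A s} s * pmf (\<kappa> p z) r)"
      unfolding * using True z by (intro expectation_cong) (auto simp: A indicator_def pmf.rep_eq Collect_conv_if)
    also have "\<dots> = measure_pmf.prob (chain \<kappa> n) {s. A s} * pmf (\<kappa> p z) r" by simp
    also have "measure_pmf.prob (chain \<kappa> n) {s. A s} = measure_pmf.prob (chain \<kappa> (Suc n)) {s. A s}"
      using True by (intro skip[symmetric]) (simp add: A)
    finally show ?thesis .
  qed
qed simp

text \<open>Every edge variable is hashed so that both of its end points can recover it, one edge after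
  the other. The hashed edges are then generated by a new chain; on the event that everything can
  be recovered, its distribution dominates the original one.\<close>

lemma edge_coding:
  fixes P :: "(nat \<Rightarrow> nat \<Rightarrow> 'v) pmf" and B :: "nat \<Rightarrow> nat \<Rightarrow> nat" and g :: "nat \<Rightarrow> nat \<Rightarrow> real"
  assumes fin: "finite (set_pmf P)" and can: "\<And>w. w \<in> set_pmf P \<Longrightarrow> canon m w = w"
    and dom: "\<And>w. w \<in> set_pmf P \<Longrightarrow> pmf P w \<le> (\<Prod>p=1..m. pmf (\<kappa> p (lo p w)) (row p m w))"
    and B: "\<And>p q. B p q > 0"
  defines "i1 \<equiv> \<lambda>p q w. info P (\<lambda>w. (w p q, col p q w)) w - info P (col p q) w"
    and "i2 \<equiv> \<lambda>p q w. info P (\<lambda>w. (w p q, lo p w, row p (q - 1) w)) w - info P (\<lambda>w. (lo p w, row p (q - 1) w)) w"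
  shows "\<exists>\<kappa>' Dec. (\<forall>p z. \<forall>r\<in>set_pmf (\<kappa>' p z). r \<in> PiE {p<..m} (\<lambda>q. {..<B p q})) \<and>
    close (\<Sum>(p, q)\<in>edges m. measure_pmf.prob P {w. i1 p q w > g p q} + measure_pmf.prob P {w. i2 p q w > g p q} + 2 * 2 powr g p q / B p q)
      (map_pmf (\<lambda>w. \<lambda>p\<in>{1..m}. view m p w) P)
      (map_pmf (\<lambda>s. \<lambda>p\<in>{1..m}. Dec p (view m p s)) (chain \<kappa>' m))"
proof -
  define err where "err p q = measure_pmf.prob P {w. i1 p q w > g p q} + measure_pmf.prob P {w. i2 p q w > g p q} + 2 * 2 powr g p q / B p q" for p q
  define good where "good p q b E \<longleftrightarrow> (\<forall>v. b v < B p q) \<and> measure_pmf.prob P (- E) \<le> err p q \<and>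
    (\<forall>w\<in>E. \<forall>w'\<in>E. (col p q w = col p q w' \<or> (lo p w, row p (q - 1) w) = (lo p w', row p (q - 1) w'))
        \<longrightarrow> b (w p q) = b (w' p q) \<longrightarrow> w p q = w' p q)" for p q b E
  have "\<exists>b E. good p q b E" for p q
    unfolding good_def err_def i1_def i2_def by (rule binning[OF fin B])
  then obtain b Eg where "\<And>p q. good p q (b p q) (Eg p q)" by metis
  then have b: "\<And>p q v. b p q v < B p q"
    and Eg: "\<And>p q. measure_pmf.prob P (- Eg p q) \<le> err p q"
    and inj: "\<And>p q w w'. w \<in> Eg p q \<Longrightarrow> w' \<in> Eg p q \<Longrightarrow> 
         col p q w = col p q w' \<or> (lo p w = lo p w' \<and> row p (q - 1) w = row p (q - 1) w') \<Longrightarrow>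
         b p q (w p q) = b p q (w' p q) \<Longrightarrow> w p q = w' p q"
    unfolding good_def prod.inject by blast+
  define E where "E = set_pmf P \<inter> (\<Inter>(p, q)\<in>edges m. Eg p q)"
  define h where "h w = (\<lambda>p q. if (p, q) \<in> edges m then b p q (w p q) else undefined)" for w
  define \<epsilon> where "\<epsilon> = (\<Sum>(p, q)\<in>edges m. err p q)"
  have PE: "measure_pmf.prob P (- E) \<le> \<epsilon>"
  proof -
    have "measure_pmf.prob P (- E) \<le> measure_pmf.prob P (\<Union>e\<in>edges m. - Eg (fst e) (snd e))"
      by (intro measure_pmf.finite_measure_mono_AE AE_pmfI impI) (force simp: E_def, simp)
    also have "\<dots> \<le> (\<Sum>e\<in>edges m. measure_pmf.prob P (- Eg (fst e) (snd e)))"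
      by (intro measure_pmf.finite_measure_subadditive_finite) auto
    also have "\<dots> \<le> \<epsilon>" unfolding \<epsilon>_def case_prod_unfold by (intro sum_mono Eg)
    finally show ?thesis .
  qed
  \<comment> \<open>Decoding down the column: once the entries above row \<open>j\<close> agree,
    \<open>col j p\<close> serves as side information for entry \<open>j\<close>.\<close>
  have dec_lo: "lo p w = lo p w'" if p: "p \<in> {1..m}" and E: "w \<in> E" "w' \<in> E" and eq: "lo p (h w) = lo p (h w')" for p w w'
  proof -
    have "w j p = w' j p" if "j \<in> {1..<p}" for j
      using that
    proof (induction j rule: less_induct)
      case (less j)
      then have e: "(j, p) \<in> edges m" using p by (auto simp: edges_def)
      have "col j p w = col j p w'" using less by (auto simp: col_def restrict_eq_iff)
      moreover have "h w j p = h w' j p"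
        using eq less.prems by (auto simp: col_def restrict_eq_iff)
      then have "b j p (w j p) = b j p (w' j p)" using e by (simp add: h_def)
      ultimately show ?case using e E by (intro inj) (auto simp: E_def)
    qed
    then show ?thesis by (simp add: col_def restrict_eq_iff)
  qed
  have dec: "view m p w = view m p w'" if p: "p \<in> {1..m}" and E: "w \<in> E" "w' \<in> E" and eq: "view m p (h w) = view m p (h w')" for p w w'
  proof -
    from eq have eq: "lo p (h w) = lo p (h w')" "row p m (h w) = row p m (h w')" using p by (auto simp: view_eq_iff)
    have lo: "lo p w = lo p w'" by (rule dec_lo[OF p E eq(1)])
    have "w p q = w' p q" if "q \<in> {p<..m}" for q
      using that
    proof (induction q rule: less_induct)
      case (less q)
      then have e: "(p, q) \<in> edges m" using p by (auto simp: edges_def)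
      have "row p (q - 1) w = row p (q - 1) w'" using less by (auto simp: row_def restrict_eq_iff)
      moreover have "h w p q = h w' p q"
        using eq(2) less.prems by (auto simp: row_def restrict_eq_iff)
      then have "b p q (w p q) = b p q (w' p q)" using e by (simp add: h_def)
      ultimately show ?case using e E lo by (intro inj) (auto simp: E_def)
    qed
    then show ?thesis using p lo by (simp add: view_eq_iff row_def restrict_eq_iff)
  qed
  \<comment> \<open>Decoding picks some element of \<open>E\<close> with the observed hashes; by
    \<open>dec_lo\<close> and \<open>dec\<close> the decoded value does not depend on the pick.
    Hashes that no element of \<open>E\<close> produces are decoded arbitrarily.\<close>
  define Dlo where "Dlo p z = lo p (SOME w. w \<in> E \<and> lo p (h w) = z)" for p z
  define Dec where "Dec p v = view m p (SOME w. w \<in> E \<and> view m p (h w) = v)" for p v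
  have Dlo: "Dlo p (lo p (h w)) = lo p w" if "p \<in> {1..m}" "w \<in> E" for p w
  proof -
    have "(SOME w'. w' \<in> E \<and> lo p (h w') = lo p (h w)) \<in> E \<and> lo p (h (SOME w'. w' \<in> E \<and> lo p (h w') = lo p (h w))) = lo p (h w)"
      by (rule someI[of _ w]) (use that in simp)
    then show ?thesis unfolding Dlo_def using that by (intro dec_lo) auto
  qed
  have Dec: "Dec p (view m p (h w)) = view m p w" if "p \<in> {1..m}" "w \<in> E" for p w
  proof -
    have "(SOME w'. w' \<in> E \<and> view m p (h w') = view m p (h w)) \<in> E \<and> view m p (h (SOME w'. w' \<in> E \<and> view m p (h w') = view m p (h w))) = view m p (h w)"
      by (rule someI[of _ w]) (use that in simp)
    then show ?thesis unfolding Dec_def using that by (intro dec) auto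
  qed
  define \<kappa>' where "\<kappa>' p z = map_pmf (\<lambda>r. \<lambda>q\<in>{p<..m}. b p q (r q)) (\<kappa> p (Dlo p z))" for p z
  let ?Q = "chain \<kappa>' m"
  \<comment> \<open>Decoding is correct on \<open>E\<close>, so every factor of the bound on
    \<open>pmf P w\<close> reappears in the new chain; hashing a row can only merge masses and so
    raise the factor.\<close>
  have mass: "pmf P w \<le> pmf ?Q (h w)" if w: "w \<in> E" for w
  proof -
    have "pmf P w \<le> (\<Prod>p=1..m. pmf (\<kappa> p (lo p w)) (row p m w))"
      using w by (intro dom) (simp add: E_def)
    also have "\<dots> \<le> (\<Prod>p=1..m. pmf (\<kappa>' p (lo p (h w))) (h w p))"
    proof (intro prod_mono conjI pmf_nonneg)
      fix p assume p: "p \<in> {1..m}"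
      have "h w p = (\<lambda>q\<in>{p<..m}. b p q (row p m w q))" using p by (auto simp: h_def row_def edges_def fun_eq_iff)
      then show "pmf (\<kappa> p (lo p w)) (row p m w) \<le> pmf (\<kappa>' p (lo p (h w))) (h w p)"
        unfolding \<kappa>'_def Dlo[OF p w] pmf_map by (auto simp: pmf.rep_eq intro!: measure_pmf.finite_measure_mono)
    qed
    also have "\<dots> = pmf ?Q (h w)"
      by (intro pmf_chain[symmetric]) (auto simp: h_def edges_def fun_eq_iff)
    finally show ?thesis .
  qed
  \<comment> \<open>Distinct assignments in \<open>E\<close> have distinct hashes, so the pointwise
    domination may be summed over events.\<close>
  have inj_h: "inj_on h E"
  proof (rule inj_onI)
    fix w w' assume *: "w \<in> E" "w' \<in> E" "h w = h w'"
    then have "canon m w = canon m w'" unfolding canon_eq_iff_view using dec[of _ w w'] by simp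
    then show "w = w'" using * can by (simp add: E_def)
  qed
  have finE: "finite E" using fin by (simp add: E_def)
  \<comment> \<open>Domination on \<open>E\<close> bounds one side only, which is what
    \<open>close\<close> asks for; the loss is the mass of \<open>- E\<close>.\<close>
  have "close \<epsilon> (map_pmf (\<lambda>w. \<lambda>p\<in>{1..m}. view m p w) P) (map_pmf (\<lambda>s. \<lambda>p\<in>{1..m}. Dec p (view m p s)) ?Q)"
    unfolding close_def
  proof
    fix A
    let ?A = "{w :: nat \<Rightarrow> nat \<Rightarrow> 'v. (\<lambda>p\<in>{1..m}. view m p w) \<in> A}"
    have "measure_pmf.prob P ?A \<le> measure_pmf.prob P (?A \<inter> E) + measure_pmf.prob P (- E)"
      by (intro order_trans[OF measure_pmf.finite_measure_mono measure_Un_le]) auto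
    also have "measure_pmf.prob P (?A \<inter> E) = (\<Sum>w\<in>?A \<inter> E. pmf P w)"
      using finE by (simp add: measure_measure_pmf_finite)
    also have "\<dots> \<le> (\<Sum>w\<in>?A \<inter> E. pmf ?Q (h w))" by (intro sum_mono mass) simp
    also have "\<dots> = (\<Sum>s\<in>h ` (?A \<inter> E). pmf ?Q s)"
      by (subst sum.reindex[OF inj_on_subset[OF inj_h]]) auto
    also have "\<dots> = measure_pmf.prob ?Q (h ` (?A \<inter> E))" using finE by (simp add: measure_measure_pmf_finite)
    also have "\<dots> \<le> measure_pmf.prob ?Q {s. (\<lambda>p\<in>{1..m}. Dec p (view m p s)) \<in> A}"
    proof (intro measure_pmf.finite_measure_mono)
      show "h ` (?A \<inter> E) \<subseteq> {s. (\<lambda>p\<in>{1..m}. Dec p (view m p s)) \<in> A}"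
        using Dec by (auto cong: restrict_cong)
    qed simp
    finally show "measure_pmf.prob (map_pmf (\<lambda>w. \<lambda>p\<in>{1..m}. view m p w) P) A
      \<le> measure_pmf.prob (map_pmf (\<lambda>s. \<lambda>p\<in>{1..m}. Dec p (view m p s)) ?Q) A + \<epsilon>"
      using PE unfolding measure_map_pmf vimage_def by linarith
  qed
  moreover have "\<forall>p z. \<forall>r\<in>set_pmf (\<kappa>' p z). r \<in> PiE {p<..m} (\<lambda>q. {..<B p q})"
    by (auto simp: \<kappa>'_def b)
  ultimately show ?thesis unfolding \<epsilon>_def err_def by blast
qed

section \<open>The Markov condition and block coding\<close>

definition rows :: "nat \<Rightarrow> nat \<Rightarrow> (nat \<Rightarrow> nat \<Rightarrow> 'v) \<Rightarrow> nat \<Rightarrow> nat \<Rightarrow> 'v" where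
  "rows m p s = (\<lambda>k\<in>{1..p}. row k m s)"

text \<open>Equality in submodularity: given \<open>lo p\<close>, the rows of the vertices before
  \<open>p\<close> are independent of what vertex \<open>p\<close> sees. For \<open>p = 1\<close> it
  holds trivially.\<close>

definition markov :: "nat \<Rightarrow> (nat \<Rightarrow> nat \<Rightarrow> 'v) pmf \<Rightarrow> bool" where
  "markov m P \<longleftrightarrow> (\<forall>p\<in>{1..m}.
     ent P (rows m p) + ent P (lo p) = ent P (rows m (p - 1)) + ent P (view m p))"

lemma rows_eq_iff: "rows m p s = rows m p s' \<longleftrightarrow> (\<forall>k\<in>{1..p}. \<forall>q\<in>{k<..m}. s k q = s' k q)"
  by (simp add: rows_def restrict_eq_iff row_def)

lemma col_eq_iff: "col p q s = col p q s' \<longleftrightarrow> (\<forall>j\<in>{1..<p}. s j q = s' j q)"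
  by (simp add: col_def restrict_eq_iff)

lemma row_eq_iff: "row p q s = row p q s' \<longleftrightarrow> (\<forall>j\<in>{p<..q}. s p j = s' p j)"
  by (simp add: row_def restrict_eq_iff)

lemma view_determines_lo: "p \<in> {1..m} \<Longrightarrow> determines P (view m p) (lo p)"
  by (rule determinesI) (simp add: view_eq_iff)

lemma rows_determines_lo: "p \<in> {1..m} \<Longrightarrow> determines P (rows m (p - 1)) (lo p)"
  by (rule determinesI) (auto simp: rows_eq_iff col_eq_iff)

lemma rows_view_determines_rows:
  "p \<in> {1..m} \<Longrightarrow> determines P (\<lambda>s. (rows m (p - 1) s, view m p s)) (rows m p)"
proof (rule determinesI)
  fix s s' assume p: "p \<in> {1..m}" and eq: "(rows m (p - 1) s, view m p s) = (rows m (p - 1) s', view m p s')"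
  show "rows m p s = rows m p s'"
    unfolding rows_eq_iff
  proof (intro ballI)
    fix k q assume "k \<in> {1..p}" "q \<in> {k<..m}"
    then show "s k q = s' k q"
      using eq p by (cases "k = p") (auto simp: rows_eq_iff view_eq_iff row_eq_iff)
  qed
qed

lemma rows_determines_view: "p \<in> {1..m} \<Longrightarrow> determines P (rows m p) (view m p)"
  by (rule determinesI) (auto simp: rows_eq_iff view_eq_iff row_eq_iff col_eq_iff)

lemma rows_determines_pred: "determines P (rows m p) (rows m (p - 1))"
  by (rule determinesI) (auto simp: rows_eq_iff)

lemma markov_info:
  assumes "markov m P" "finite (set_pmf P)" "w \<in> set_pmf P" "p \<in> {1..m}"
  shows "info P (rows m p) w + info P (lo p) w = info P (rows m (p - 1)) w + info P (view m p) w"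
  using assms
  by (intro ent_submod_eq rows_determines_lo view_determines_lo rows_view_determines_rows
      rows_determines_view rows_determines_pred) (auto simp: markov_def)

lemma info_rows_0: "info P (rows m 0) w = 0"
proof -
  have "{y. rows m 0 y = rows m 0 w} = UNIV" by (auto simp: rows_eq_iff)
  then show ?thesis by (simp add: info_def pr_def)
qed

text \<open>The pointwise equality telescopes over the vertices: each new vertex adds the density of
  its view beyond \<open>lo p\<close>.\<close>

lemma markov_info_canon:
  assumes "markov m P" "finite (set_pmf P)" "w \<in> set_pmf P"
  shows "info P (canon m) w = (\<Sum>p=1..m. info P (view m p) w - info P (lo p) w)"
proof -
  have "info P (rows m n) w = (\<Sum>p=1..n. info P (view m p) w - info P (lo p) w)" if "n \<le> m" for n
    using that
  proof (induction n)
    case (Suc n)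
    then show ?case using markov_info[OF assms, of "Suc n"] by simp
  qed (simp add: info_rows_0)
  moreover have "info P (canon m) w = info P (rows m m) w"
    using assms(3) by (intro info_cong determinesI) (auto simp: canon_eq_iff rows_eq_iff row_eq_iff)
  ultimately show ?thesis by simp
qed

lemma markov_ent_canon:
  assumes "markov m P" "finite (set_pmf P)"
  shows "ent P (canon m) = (\<Sum>p=1..m. ent P (view m p) - ent P (lo p))"
proof -
  have "ent P (canon m) = measure_pmf.expectation P (\<lambda>w. \<Sum>p=1..m. info P (view m p) w - info P (lo p) w)"
    unfolding ent_def[of P "canon m"] by (intro expectation_cong markov_info_canon assms)
  then show ?thesis using assms(2) by (simp add: ent_def)
qed

text \<open>The values that matter are those at \<open>z = lo p w\<close> with \<open>w\<close> in
  the support; elsewhere \<open>cond_pmf\<close> conditions on a null event and its value is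
  arbitrary.\<close>

definition row_kernel :: "nat \<Rightarrow> (nat \<Rightarrow> nat \<Rightarrow> 'v) pmf \<Rightarrow> nat \<Rightarrow> (nat \<Rightarrow> 'v) \<Rightarrow> (nat \<Rightarrow> 'v) pmf" where
  "row_kernel m P p z = map_pmf (row p m) (cond_pmf P {w. lo p w = z})"

lemma pmf_row_kernel:
  assumes "w \<in> set_pmf P" "p \<in> {1..m}"
  shows "pmf (row_kernel m P p (lo p w)) (row p m w) = pr P (view m p) w / pr P (lo p) w"
proof -
  have ne: "set_pmf P \<inter> {v. lo p v = lo p w} \<noteq> {}" using assms by auto
  have "measure_pmf.prob (cond_pmf P {v. lo p v = lo p w}) {v. row p m v = row p m w}
      = measure_pmf.prob P ({v. lo p v = lo p w} \<inter> {v. row p m v = row p m w}) / measure_pmf.prob P {v. lo p v = lo p w}"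
    unfolding cond_pmf.rep_eq[OF ne] using ne
    by (subst measure_uniform_measure) (auto simp: measure_pmf.emeasure_eq_measure measure_measure_pmf_not_zero)
  also have "{v. lo p v = lo p w} \<inter> {v. row p m v = row p m w} = {v. view m p v = view m p w}"
    using view_eq_iff[OF assms(2)] by auto
  finally show ?thesis by (simp add: row_kernel_def pmf_map pr_def vimage_def)
qed

lemma markov_pmf:
  assumes "markov m P" "finite (set_pmf P)" "w \<in> set_pmf P" and can: "\<And>w. w \<in> set_pmf P \<Longrightarrow> canon m w = w"
  shows "pmf P w = (\<Prod>p=1..m. pmf (row_kernel m P p (lo p w)) (row p m w))"
proof -
  have info': "info P f w = - log 2 (pr P f w)" "pr P f w > 0" for f :: "(nat \<Rightarrow> nat \<Rightarrow> 'a) \<Rightarrow> nat \<Rightarrow> 'a"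
    using assms(3) by (auto simp: info_def pr_pos)
  have "pmf P w = pr P (canon m) w"
    using can assms(3) by (subst pr_cong[of P _ w "\<lambda>w. w"]) (auto simp: pr_eq_pmf)
  also have "\<dots> = 2 powr (- info P (canon m) w)"
    using assms(3) by (simp add: info_def pr_pos)
  also have "\<dots> = (\<Prod>p=1..m. 2 powr (info P (lo p) w - info P (view m p) w))"
    unfolding markov_info_canon[OF assms(1-3)] by (simp add: powr_sum sum_negf[symmetric])
  also have "\<dots> = (\<Prod>p=1..m. pmf (row_kernel m P p (lo p w)) (row p m w))"
    using assms(3) info' by (intro prod.cong) (auto simp: pmf_row_kernel powr_diff powr_minus)
  finally show ?thesis .
qed

text \<open>By the Markov condition, vertex \<open>p\<close> is no worse than vertex \<open>q\<close> at guessing the variable of the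
  edge \<open>{p, q}\<close>: what \<open>p\<close> sees makes this variable independent of everything that involves the
  vertices before \<open>p\<close>, which includes the side information of \<open>q\<close>.\<close>

lemma markov_ent_edge:
  assumes M: "markov m P" and fin: "finite (set_pmf P)" and e: "(p, q) \<in> edges m"
  shows "ent P (\<lambda>w. (w p q, lo p w, row p (q - 1) w)) - ent P (\<lambda>w. (lo p w, row p (q - 1) w))
    \<le> ent P (\<lambda>w. (w p q, col p q w)) - ent P (col p q)"
proof -
  have p: "p \<in> {1..m}" "p < q" "q \<le> m" "1 \<le> p" using e by (auto simp: edges_def)
  \<comment> \<open>The Markov equality survives if the row of \<open>p\<close> is cut at
    \<open>r\<close>: one inequality is submodularity, the other is submodularity against the uncut
    equality.\<close>
  have part: "ent P (\<lambda>w. (rows m (p - 1) w, row p r w)) + ent P (lo p) = ent P (rows m (p - 1)) + ent P (\<lambda>w. (lo p w, row p r w))"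
    if "r \<le> m" for r
  proof (rule antisym)
    show "ent P (\<lambda>w. (rows m (p - 1) w, row p r w)) + ent P (lo p) \<le> ent P (rows m (p - 1)) + ent P (\<lambda>w. (lo p w, row p r w))"
      by (intro ent_submod fin rows_determines_lo p determinesI) auto
    have "ent P (rows m p) + ent P (\<lambda>w. (lo p w, row p r w)) \<le> ent P (\<lambda>w. (rows m (p - 1) w, row p r w)) + ent P (view m p)"
    proof (intro ent_submod fin)
      show "determines P (\<lambda>w. (rows m (p - 1) w, row p r w)) (\<lambda>w. (lo p w, row p r w))"
        using p by (intro determinesI) (auto simp: rows_eq_iff col_eq_iff)
      show "determines P (view m p) (\<lambda>w. (lo p w, row p r w))"
        using that by (intro determinesI) (auto simp: view_eq_iff[OF p(1)] row_eq_iff)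
      show "determines P (\<lambda>x. ((rows m (p - 1) x, row p r x), view m p x)) (rows m p)"
        by (rule determines_trans[OF _ rows_view_determines_rows[OF p(1)]]) (auto intro: determinesI)
    qed
    moreover have "ent P (rows m p) + ent P (lo p) = ent P (rows m (p - 1)) + ent P (view m p)"
      using M p(1) by (simp add: markov_def)
    ultimately show "ent P (rows m (p - 1)) + ent P (\<lambda>w. (lo p w, row p r w)) \<le> ent P (\<lambda>w. (rows m (p - 1) w, row p r w)) + ent P (lo p)"
      by linarith
  qed
  \<comment> \<open>Conditioning on more does not raise the entropy of \<open>w p q\<close>, and the
    earlier rows determine \<open>col p q\<close>. By \<open>part\<close>, the earlier rows may then
    be replaced by \<open>lo p\<close>.\<close>
  have "ent P (\<lambda>w. (rows m (p - 1) w, row p q w)) + ent P (col p q)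
    \<le> ent P (\<lambda>w. (rows m (p - 1) w, row p (q - 1) w)) + ent P (\<lambda>w. (w p q, col p q w))"
  proof (intro ent_submod fin)
    show "determines P (\<lambda>w. (rows m (p - 1) w, row p (q - 1) w)) (col p q)"
      using p by (intro determinesI) (auto simp: rows_eq_iff col_eq_iff)
    show "determines P (\<lambda>w. (w p q, col p q w)) (col p q)"
      by (intro determinesI) auto
    show "determines P (\<lambda>x. ((rows m (p - 1) x, row p (q - 1) x), x p q, col p q x)) (\<lambda>w. (rows m (p - 1) w, row p q w))"
    proof (intro determinesI)
      fix x y assume eq: "((rows m (p - 1) x, row p (q - 1) x), x p q, col p q x) = ((rows m (p - 1) y, row p (q - 1) y), y p q, col p q y)"
      have "x p j = y p j" if "j \<in> {p<..q}" for j
        using that eq by (cases "j = q") (auto simp: row_eq_iff)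
      then show "(rows m (p - 1) x, row p q x) = (rows m (p - 1) y, row p q y)"
        using eq by (simp add: row_eq_iff)
    qed
  qed
  moreover have "ent P (\<lambda>w. (w p q, lo p w, row p (q - 1) w)) = ent P (\<lambda>w. (lo p w, row p q w))"
  proof (intro ent_cong determinesI)
    fix x y assume eq: "(x p q, lo p x, row p (q - 1) x) = (y p q, lo p y, row p (q - 1) y)"
    have "x p j = y p j" if "j \<in> {p<..q}" for j
      using that eq by (cases "j = q") (auto simp: row_eq_iff)
    then show "(lo p x, row p q x) = (lo p y, row p q y)" using eq by (simp add: row_eq_iff)
  qed (use p in \<open>auto simp: row_eq_iff\<close>)
  moreover have "q - 1 \<le> m" using p by simp
  ultimately show ?thesis using part[OF p(3)] part[of "q - 1"] by linarith
qed

lemma sum_edges: "(\<Sum>(p, q)\<in>edges m. F p q) = (\<Sum>q=1..m. \<Sum>p\<in>{1..<q}. (F p q :: 'b :: comm_monoid_add))"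
proof -
  have "(\<Sum>(p, q)\<in>edges m. F p q) = (\<Sum>(q, p)\<in>Sigma {1..m} (\<lambda>q. {1..<q}). F p q)"
    by (rule sum.reindex_bij_witness[of _ "\<lambda>(q, p). (p, q)" "\<lambda>(p, q). (q, p)"]) (auto simp: edges_def)
  then show ?thesis by (simp add: sum.Sigma)
qed

text \<open>The chain rule down each column. The hash rates of all edges thus add up to the quantity
  that the entropy balance compares with the total correlation.\<close>

lemma sum_ent_edges:
  "(\<Sum>(p, q)\<in>edges m. ent P (\<lambda>w. (w p q, col p q w)) - ent P (col p q)) = (\<Sum>q=1..m. ent P (lo q))"
proof -
  have "(\<Sum>p\<in>{1..<q}. ent P (\<lambda>w. (w p q, col p q w)) - ent P (col p q)) = ent P (lo q)" if "q \<ge> 1" for q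
  proof -
    have "ent P (\<lambda>w. (w p q, col p q w)) = ent P (col (Suc p) q)" if "1 \<le> p" for p
    proof (intro ent_cong determinesI)
      fix x y :: "nat \<Rightarrow> nat \<Rightarrow> 'a" assume "(x p q, col p q x) = (y p q, col p q y)"
      then show "col (Suc p) q x = col (Suc p) q y" by (auto simp: col_eq_iff less_Suc_eq)
    qed (use that in \<open>auto simp: col_eq_iff\<close>)
    then have "(\<Sum>p\<in>{1..<q}. ent P (\<lambda>w. (w p q, col p q w)) - ent P (col p q))
        = (\<Sum>p\<in>{1..<q}. ent P (col (Suc p) q) - ent P (col p q))"
      by (intro sum.cong) auto
    also have "\<dots> = ent P (col q q) - ent P (col 1 q)"
      using that by (rule sum_Suc_diff')
    also have "ent P (col 1 q) = 0" by (intro ent_const determinesI) (simp add: col_eq_iff)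
    finally show ?thesis by simp
  qed
  then show ?thesis by (simp add: sum_edges)
qed

section \<open>Coding of independent copies of a block\<close>

lemma log_prod_pos: "finite I \<Longrightarrow> (\<And>i. i \<in> I \<Longrightarrow> f i > 0) \<Longrightarrow> log 2 (\<Prod>i\<in>I. f i) = (\<Sum>i\<in>I. log 2 (f i :: real))"
  by (induction I rule: finite_induct) (auto simp: log_mult prod_pos less_imp_neq[symmetric])

lemma info_Pi_pmf:
  assumes I: "finite I" and w: "w \<in> set_pmf (Pi_pmf I d (\<lambda>_. P))"
    and F: "\<And>w'. w' \<in> set_pmf (Pi_pmf I d (\<lambda>_. P)) \<Longrightarrow> F w' = F w \<longleftrightarrow> (\<forall>k\<in>I. f (w' k) = f (w k))"
  shows "info (Pi_pmf I d (\<lambda>_. P)) F w = (\<Sum>k\<in>I. info P f (w k))"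
proof -
  have "pr (Pi_pmf I d (\<lambda>_. P)) F w = measure_pmf.prob (Pi_pmf I d (\<lambda>_. P)) (Pi I (\<lambda>k. {x. f x = f (w k)}))"
    unfolding pr_def using F by (intro measure_pmf.finite_measure_eq_AE AE_pmfI) auto
  also have "\<dots> = (\<Prod>k\<in>I. pr P f (w k))"
    using I by (simp add: measure_Pi_pmf_Pi pr_def)
  finally have "pr (Pi_pmf I d (\<lambda>_. P)) F w = (\<Prod>k\<in>I. pr P f (w k))" .
  moreover have "w k \<in> set_pmf P" if "k \<in> I" for k
    using w that I by (auto simp: set_Pi_pmf PiE_dflt_def)
  ultimately show ?thesis
    using I by (simp add: info_def log_prod_pos pr_pos sum_negf)
qed

definition transp :: "nat \<Rightarrow> nat \<Rightarrow> (nat \<Rightarrow> nat \<Rightarrow> nat \<Rightarrow> 'v) \<Rightarrow> nat \<Rightarrow> nat \<Rightarrow> nat \<Rightarrow> 'v" where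
  "transp m N w = (\<lambda>p q. if (p, q) \<in> edges m then \<lambda>k\<in>{..<N}. w k p q else undefined)"

definition block_kernel ::
  "nat \<Rightarrow> nat \<Rightarrow> (nat \<Rightarrow> (nat \<Rightarrow> 'v) \<Rightarrow> (nat \<Rightarrow> 'v) pmf) \<Rightarrow> nat \<Rightarrow> (nat \<Rightarrow> nat \<Rightarrow> 'v) \<Rightarrow> (nat \<Rightarrow> nat \<Rightarrow> 'v) pmf" where
  "block_kernel m N \<kappa> p z = map_pmf (\<lambda>r. \<lambda>q\<in>{p<..m}. \<lambda>k\<in>{..<N}. r k q)
     (Pi_pmf {..<N} undefined (\<lambda>k. \<kappa> p (\<lambda>j\<in>{1..<p}. z j k)))"

lemma pmf_map_ge: "pmf p x \<le> pmf (map_pmf f p) (f x)"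
  by (auto simp: pmf_map pmf.rep_eq intro!: measure_pmf.finite_measure_mono)

text \<open>On canonical assignments \<open>transp\<close> is injective, so the mass of a block is a
  product over copies and vertices. The kernel side is a push-forward, which can only gain mass;
  hence an inequality, in the form that \<open>edge_coding\<close> takes.\<close>

lemma pmf_transp_le:
  assumes dom: "\<And>w. w \<in> set_pmf P \<Longrightarrow> pmf P w \<le> (\<Prod>p=1..m. pmf (\<kappa> p (lo p w)) (row p m w))"
    and can: "\<And>w. w \<in> set_pmf P \<Longrightarrow> canon m w = w"
    and W: "W \<in> set_pmf (map_pmf (transp m N) (Pi_pmf {..<N} undefined (\<lambda>_. P)))"
  shows "pmf (map_pmf (transp m N) (Pi_pmf {..<N} undefined (\<lambda>_. P))) W
    \<le> (\<Prod>p=1..m. pmf (block_kernel m N \<kappa> p (lo p W)) (row p m W))"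
proof -
  let ?P = "Pi_pmf {..<N} undefined (\<lambda>_. P)"
  from W obtain w where w: "w \<in> set_pmf ?P" "W = transp m N w" by auto
  have wk: "w k \<in> set_pmf P" if "k < N" for k using w that by (auto simp: set_Pi_pmf PiE_dflt_def)
  have eq: "w' = w" if w': "w' \<in> set_pmf ?P" "transp m N w' = transp m N w" for w'
  proof
    fix k
    show "w' k = w k"
    proof (cases "k < N")
      case True
      have "w' k p q = w k p q" if "(p, q) \<in> edges m" for p q
        using fun_cong[OF fun_cong[OF fun_cong[OF w'(2)]], of p q k] that True by (simp add: transp_def)
      then have "canon m (w' k) = canon m (w k)" by (auto simp: canon_def fun_eq_iff)
      moreover have "w' k \<in> set_pmf P" using w' True by (auto simp: set_Pi_pmf PiE_dflt_def)
      ultimately show ?thesis using can wk True by metis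
    next
      case False
      then show ?thesis using w w' by (auto simp: set_Pi_pmf PiE_dflt_def)
    qed
  qed
  have "pmf (map_pmf (transp m N) ?P) W = measure_pmf.prob ?P {w}"
    unfolding pmf_map w(2) using eq by (intro measure_pmf.finite_measure_eq_AE AE_pmfI) auto
  also have "\<dots> = (\<Prod>k<N. pmf P (w k))"
  proof -
    have "measure_pmf.prob ?P {w} = pmf ?P w" by (simp add: pmf.rep_eq)
    also have "\<dots> = (\<Prod>k<N. pmf P (w k))" using w(1) by (intro pmf_Pi') (auto simp: set_Pi_pmf PiE_dflt_def)
    finally show ?thesis .
  qed
  also have "\<dots> \<le> (\<Prod>k<N. \<Prod>p=1..m. pmf (\<kappa> p (lo p (w k))) (row p m (w k)))"
    by (intro prod_mono conjI dom wk) auto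
  also have "\<dots> = (\<Prod>p=1..m. \<Prod>k<N. pmf (\<kappa> p (lo p (w k))) (row p m (w k)))"
    by (rule prod.swap)
  also have "\<dots> \<le> (\<Prod>p=1..m. pmf (block_kernel m N \<kappa> p (lo p W)) (row p m W))"
  proof (intro prod_mono conjI prod_nonneg pmf_nonneg ballI)
    fix p assume p: "p \<in> {1..m}"
    define r where "r = (\<lambda>k. if k < N then row p m (w k) else undefined)"
    have lo: "(\<lambda>j\<in>{1..<p}. lo p W j k) = lo p (w k)" if "k < N" for k
      using that p by (auto simp: w(2) col_def transp_def edges_def fun_eq_iff)
    have "(\<Prod>k<N. pmf (\<kappa> p (lo p (w k))) (row p m (w k)))
        = pmf (Pi_pmf {..<N} undefined (\<lambda>k. \<kappa> p (\<lambda>j\<in>{1..<p}. lo p W j k))) r"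
      by (subst pmf_Pi') (auto simp: r_def lo[simplified] intro!: prod.cong)
    also have "\<dots> \<le> pmf (block_kernel m N \<kappa> p (lo p W)) (\<lambda>q\<in>{p<..m}. \<lambda>k\<in>{..<N}. r k q)"
      unfolding block_kernel_def by (rule pmf_map_ge)
    also have "(\<lambda>q\<in>{p<..m}. \<lambda>k\<in>{..<N}. r k q) = row p m W"
      using p by (auto simp: r_def w(2) row_def transp_def edges_def fun_eq_iff)
    finally show "(\<Prod>k<N. pmf (\<kappa> p (lo p (w k))) (row p m (w k))) \<le> pmf (block_kernel m N \<kappa> p (lo p W)) (row p m W)" .
  qed
  finally show ?thesis .
qed

lemma transp_eq_iff:
  "(p, q) \<in> edges m \<Longrightarrow> transp m N w p q = transp m N w' p q \<longleftrightarrow> (\<forall>k\<in>{..<N}. w k p q = w' k p q)"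
  by (simp add: transp_def restrict_eq_iff)

text \<open>The hash rate of the edge {p, q} is its conditional entropy given
  \<open>col p q\<close>, the side information at \<open>q\<close>; by
  \<open>markov_ent_edge\<close> the same rate suffices at \<open>p\<close>.\<close>

lemma block_coding:
  fixes P :: "(nat \<Rightarrow> nat \<Rightarrow> 'v) pmf" and N :: nat and \<epsilon> L H \<eta> :: real
  assumes M: "markov m P" and fin: "finite (set_pmf P)" and can: "\<And>w. w \<in> set_pmf P \<Longrightarrow> canon m w = w"
    and N: "N > 0" and \<epsilon>: "\<epsilon> > 0" and L: "L > 0"
    and H: "\<And>p. p \<in> {1..m} \<Longrightarrow> ent P (view m p) \<le> H"
    and \<eta>: "\<And>p. p \<in> {1..m} \<Longrightarrow> measure_pmf.prob P {w. info P (view m p) w > L} \<le> \<eta>"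
  shows "\<exists>\<kappa>' Dec B. (\<forall>p q. B p q > 0) \<and> (\<forall>p z. \<forall>r\<in>set_pmf (\<kappa>' p z). r \<in> PiE {p<..m} (\<lambda>q. {..<B p q})) \<and>
    (\<Sum>(p, q)\<in>edges m. log 2 (real (B p q))) \<le> N * (\<Sum>q=1..m. ent P (lo q)) + card (edges m) * (2 * N * \<epsilon> + 1) \<and>
    close (card (edges m) * (2 * (N * \<eta> + L * H / (N * \<epsilon>\<^sup>2)) + 2 * 2 powr (- (N * \<epsilon>))))
      (map_pmf (\<lambda>w. \<lambda>p\<in>{1..m}. \<lambda>k\<in>{..<N}. view m p (w k)) (Pi_pmf {..<N} undefined (\<lambda>_. P)))
      (map_pmf (\<lambda>s. \<lambda>p\<in>{1..m}. Dec p (view m p s)) (chain \<kappa>' m))"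
proof -
  let ?Pi = "Pi_pmf {..<N} undefined (\<lambda>_. P)"
  let ?W = "map_pmf (transp m N) ?Pi"
  define h where "h p q = ent P (\<lambda>w. (w p q, col p q w)) - ent P (col p q)" for p q
  \<comment> \<open>The list threshold exceeds the mean density by \<open>\<epsilon>\<close> per
    copy, and the number of bins leaves room for another \<open>\<epsilon>\<close>, so that the
    collision term becomes \<open>2 * 2 powr (- (N * \<epsilon>))\<close>.\<close>
  define g where "g p q = real N * (h p q + \<epsilon>)" for p q
  define B where "B p q = nat \<lceil>2 powr (real N * (h p q + 2 * \<epsilon>))\<rceil>" for p q
  define j1 where "j1 p q w = info P (\<lambda>w. (w p q, col p q w)) w - info P (col p q) w" for p q w
  define j2 where "j2 p q w = info P (\<lambda>w. (w p q, lo p w, row p (q - 1) w)) w - info P (\<lambda>w. (lo p w, row p (q - 1) w)) w" for p q w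
  let ?i1 = "\<lambda>p q w. info ?W (\<lambda>w. (w p q, col p q w)) w - info ?W (col p q) w"
  let ?i2 = "\<lambda>p q w. info ?W (\<lambda>w. (w p q, lo p w, row p (q - 1) w)) w - info ?W (\<lambda>w. (lo p w, row p (q - 1) w)) w"
  have Bge: "2 powr (N * (h p q + 2 * \<epsilon>)) \<le> B p q" for p q
    unfolding B_def by (simp add: real_nat_ceiling_ge)
  have Bpos: "B p q > 0" for p q
    unfolding B_def by (simp add: zero_less_ceiling)
  have h0: "h p q \<ge> 0" for p q
    unfolding h_def diff_ge_0_iff_ge by (intro ent_mono fin determinesI) simp
  \<comment> \<open>Rounding up costs at most one bit, since the power is at least 1.\<close>
  have logB: "log 2 (real (B p q)) \<le> N * h p q + (2 * N * \<epsilon> + 1)" for p q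
  proof -
    have x: "2 powr (N * (h p q + 2 * \<epsilon>)) \<ge> 1" using h0[of p q] \<epsilon> by (intro ge_one_powr_ge_zero) auto
    have "real (B p q) \<le> 2 powr (N * (h p q + 2 * \<epsilon>)) + 1" unfolding B_def by (simp add: of_nat_nat)
    also have "\<dots> \<le> 2 powr (N * (h p q + 2 * \<epsilon>)) * 2 powr 1" using x by simp
    also have "\<dots> = 2 powr (N * (h p q + 2 * \<epsilon>) + 1)" by (simp add: powr_add)
    finally have "log 2 (real (B p q)) \<le> log 2 (2 powr (N * (h p q + 2 * \<epsilon>) + 1))"
      using Bpos[of p q] by (subst log_le_cancel_iff) auto
    then show ?thesis by (simp add: algebra_simps)
  qed
  have fW: "finite (set_pmf ?W)" using fin by (auto intro!: finite_set_Pi_pmf)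
  have canW: "canon m W = W" if "W \<in> set_pmf ?W" for W
    using that by (auto simp: canon_def transp_def fun_eq_iff)
  have domW: "pmf ?W W \<le> (\<Prod>p=1..m. pmf (block_kernel m N (row_kernel m P) p (lo p W)) (row p m W))" if "W \<in> set_pmf ?W" for W
    by (rule pmf_transp_le[OF _ can that]) (simp add: markov_pmf[OF M fin _ can])
  obtain \<kappa>' Dec where \<kappa>': "\<And>p z r. r \<in> set_pmf (\<kappa>' p z) \<Longrightarrow> r \<in> PiE {p<..m} (\<lambda>q. {..<B p q})"
    and cl: "close (\<Sum>(p, q)\<in>edges m. measure_pmf.prob ?W {w. ?i1 p q w > g p q} + measure_pmf.prob ?W {w. ?i2 p q w > g p q} + 2 * 2 powr g p q / real (B p q))
      (map_pmf (\<lambda>w. \<lambda>p\<in>{1..m}. view m p w) ?W)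
      (map_pmf (\<lambda>s. \<lambda>p\<in>{1..m}. Dec p (view m p s)) (chain \<kappa>' m))"
    using edge_coding[where g = g and B = B, OF fW canW domW Bpos] by blast
  \<comment> \<open>For either end point: the density is nonnegative, has mean at most
    \<open>h p q\<close> and lies below the density of that end point's full view, whose tail is
    controlled by \<open>\<eta>\<close>.\<close>
  have tail: "measure_pmf.prob ?Pi {w. (\<Sum>k<N. f (w k)) > g p q} \<le> N * \<eta> + L * H / (N * \<epsilon>\<^sup>2)"
    if e: "(p, q) \<in> edges m" and f0: "\<And>w. w \<in> set_pmf P \<Longrightarrow> 0 \<le> f w" and fh: "measure_pmf.expectation P f \<le> h p q"
      and r: "r \<in> {1..m}" and fv: "\<And>w. w \<in> set_pmf P \<Longrightarrow> f w \<le> info P (view m r) w"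
      for p q r and f :: "(nat \<Rightarrow> nat \<Rightarrow> 'v) \<Rightarrow> real"
  proof -
    have q: "q \<in> {1..m}" using e by (auto simp: edges_def)
    have "h p q \<le> H"
    proof -
      have "h p q \<le> ent P (\<lambda>w. (w p q, col p q w))" using ent_nonneg[of P "col p q"] by (simp add: h_def)
      also have "\<dots> \<le> ent P (view m q)"
        using e by (intro ent_mono fin determinesI) (auto simp: view_eq_iff[OF q] col_eq_iff edges_def)
      finally show ?thesis using H[OF q] by simp
    qed
    then have "L * h p q / (N * \<epsilon>\<^sup>2) \<le> L * H / (N * \<epsilon>\<^sup>2)"
      using L by (intro divide_right_mono mult_left_mono) auto
    moreover have "measure_pmf.prob P {w. f w > L} \<le> measure_pmf.prob P {w. info P (view m r) w > L}"
      using fv by (intro measure_pmf.finite_measure_mono_AE AE_pmfI) force+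
    then have "N * measure_pmf.prob P {w. f w > L} \<le> N * \<eta>"
      using \<eta>[OF r] by (intro mult_left_mono) auto
    moreover have "measure_pmf.prob ?Pi {w. (\<Sum>k<N. f (w k)) > card {..<N} * (h p q + \<epsilon>)}
      \<le> card {..<N} * measure_pmf.prob P {w. f w > L} + L * h p q / (card {..<N} * \<epsilon>\<^sup>2)"
      using N by (intro Pi_pmf_upper_tail fin f0 fh L \<epsilon>) auto
    ultimately show ?thesis unfolding g_def by simp
  qed
  have err: "measure_pmf.prob ?W {w. ?i1 p q w > g p q} + measure_pmf.prob ?W {w. ?i2 p q w > g p q} + 2 * 2 powr g p q / real (B p q)
    \<le> 2 * (N * \<eta> + L * H / (N * \<epsilon>\<^sup>2)) + 2 * 2 powr (- (N * \<epsilon>))" if e: "(p, q) \<in> edges m" for p q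
  proof -
    have p: "p \<in> {1..m}" "q \<in> {1..m}" "p < q" using e by (auto simp: edges_def)
    have ed: "j \<in> {1..<p} \<Longrightarrow> (j, q) \<in> edges m" "j \<in> {1..<p} \<Longrightarrow> (j, p) \<in> edges m" "j \<in> {p<..q - 1} \<Longrightarrow> (p, j) \<in> edges m" for j
      using p by (auto simp: edges_def)
    have "?i1 p q (transp m N w) = (\<Sum>k<N. j1 p q (w k))" if "w \<in> set_pmf ?Pi" for w
      unfolding info_map j1_def sum_subtractf
      by (intro arg_cong2[where f="(-)"] info_Pi_pmf that)
        (auto simp: col_eq_iff transp_eq_iff[OF e] transp_eq_iff[OF ed(1)])
    then have "measure_pmf.prob ?W {w. ?i1 p q w > g p q} = measure_pmf.prob ?Pi {w. (\<Sum>k<N. j1 p q (w k)) > g p q}"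
      unfolding measure_map_pmf by (intro measure_pmf.finite_measure_eq_AE AE_pmfI) auto
    also have "\<dots> \<le> N * \<eta> + L * H / (N * \<epsilon>\<^sup>2)"
    proof (rule tail[OF e _ _ p(2)])
      fix w assume w: "w \<in> set_pmf P"
      show "0 \<le> j1 p q w" unfolding j1_def diff_ge_0_iff_ge by (intro info_mono w determinesI) simp
      have "info P (\<lambda>w. (w p q, col p q w)) w \<le> info P (view m q) w"
        using p by (intro info_mono w determinesI) (auto simp: view_eq_iff[OF p(2)] col_eq_iff)
      then show "j1 p q w \<le> info P (view m q) w" unfolding j1_def using info_nonneg[of P "col p q" w] by linarith
    next
      show "measure_pmf.expectation P (j1 p q) \<le> h p q"
        unfolding j1_def[abs_def] h_def ent_def using fin by simp
    qed
    finally have 1: "measure_pmf.prob ?W {w. ?i1 p q w > g p q} \<le> N * \<eta> + L * H / (N * \<epsilon>\<^sup>2)" .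
    have "?i2 p q (transp m N w) = (\<Sum>k<N. j2 p q (w k))" if "w \<in> set_pmf ?Pi" for w
      unfolding info_map j2_def sum_subtractf
      by (intro arg_cong2[where f="(-)"] info_Pi_pmf that)
        (auto simp: col_eq_iff row_eq_iff transp_eq_iff[OF e] transp_eq_iff[OF ed(2)] transp_eq_iff[OF ed(3)])
    then have "measure_pmf.prob ?W {w. ?i2 p q w > g p q} = measure_pmf.prob ?Pi {w. (\<Sum>k<N. j2 p q (w k)) > g p q}"
      unfolding measure_map_pmf by (intro measure_pmf.finite_measure_eq_AE AE_pmfI) auto
    also have "\<dots> \<le> N * \<eta> + L * H / (N * \<epsilon>\<^sup>2)"
    proof (rule tail[OF e _ _ p(1)])
      fix w assume w: "w \<in> set_pmf P"
      show "0 \<le> j2 p q w" unfolding j2_def diff_ge_0_iff_ge by (intro info_mono w determinesI) simp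
      have "info P (\<lambda>w. (w p q, lo p w, row p (q - 1) w)) w \<le> info P (view m p) w"
        using p by (intro info_mono w determinesI) (auto simp: view_eq_iff[OF p(1)] row_eq_iff)
      then show "j2 p q w \<le> info P (view m p) w" unfolding j2_def using info_nonneg[of P "\<lambda>w. (lo p w, row p (q - 1) w)" w] by linarith
    next
      have "measure_pmf.expectation P (j2 p q) = ent P (\<lambda>w. (w p q, lo p w, row p (q - 1) w)) - ent P (\<lambda>w. (lo p w, row p (q - 1) w))"
        unfolding j2_def[abs_def] ent_def using fin by simp
      then show "measure_pmf.expectation P (j2 p q) \<le> h p q"
        unfolding h_def using markov_ent_edge[OF M fin e] by simp
    qed
    finally have 2: "measure_pmf.prob ?W {w. ?i2 p q w > g p q} \<le> N * \<eta> + L * H / (N * \<epsilon>\<^sup>2)" .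
    have "2 powr g p q / real (B p q) \<le> 2 powr g p q / 2 powr (N * (h p q + 2 * \<epsilon>))"
      using Bge[of p q] Bpos[of p q] by (intro divide_left_mono) auto
    also have "\<dots> = 2 powr (- (N * \<epsilon>))" unfolding g_def powr_diff[symmetric] by (simp add: algebra_simps)
    finally have "2 * 2 powr g p q / real (B p q) \<le> 2 * 2 powr (- (N * \<epsilon>))" by simp
    from add_mono[OF add_mono[OF 1 2] this] show ?thesis by (simp only: mult_2)
  qed
  have "(\<Sum>(p, q)\<in>edges m. measure_pmf.prob ?W {w. ?i1 p q w > g p q} + measure_pmf.prob ?W {w. ?i2 p q w > g p q} + 2 * 2 powr g p q / real (B p q))
      \<le> card (edges m) * (2 * (N * \<eta> + L * H / (N * \<epsilon>\<^sup>2)) + 2 * 2 powr (- (N * \<epsilon>)))"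
    using err by (intro sum_bounded_above) auto
  note cl = close_mono[OF cl this]
  \<comment> \<open>\<open>edge_coding\<close> hands each vertex one word per edge;
    \<open>tr\<close> turns these into one view per copy and cuts off all arguments outside the
    index ranges.\<close>
  define tr where "tr = (\<lambda>V :: nat \<Rightarrow> nat \<Rightarrow> nat \<Rightarrow> 'v. \<lambda>p\<in>{1..m}. \<lambda>k\<in>{..<N}. \<lambda>j\<in>{1..m} - {p}. V p j k)"
  have "tr (\<lambda>p\<in>{1..m}. view m p (transp m N w)) = (\<lambda>p\<in>{1..m}. \<lambda>k\<in>{..<N}. view m p (w k))" for w
    unfolding tr_def by (auto simp: fun_eq_iff view_def transp_def edges_def)
  then have A: "map_pmf tr (map_pmf (\<lambda>w. \<lambda>p\<in>{1..m}. view m p w) ?W) = map_pmf (\<lambda>w. \<lambda>p\<in>{1..m}. \<lambda>k\<in>{..<N}. view m p (w k)) ?Pi"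
    by (simp add: map_pmf_comp)
  have "tr (\<lambda>p\<in>{1..m}. Dec p (view m p s)) = (\<lambda>p\<in>{1..m}. \<lambda>k\<in>{..<N}. \<lambda>j\<in>{1..m} - {p}. Dec p (view m p s) j k)" for s
    unfolding tr_def by (auto simp: fun_eq_iff)
  then have B': "map_pmf tr (map_pmf (\<lambda>s. \<lambda>p\<in>{1..m}. Dec p (view m p s)) (chain \<kappa>' m))
      = map_pmf (\<lambda>s. \<lambda>p\<in>{1..m}. (\<lambda>p v. \<lambda>k\<in>{..<N}. \<lambda>j\<in>{1..m} - {p}. Dec p v j k) p (view m p s)) (chain \<kappa>' m)"
    by (simp add: map_pmf_comp)
  note cl' = close_map[OF cl, of tr, unfolded A B']
  have "(\<Sum>(p, q)\<in>edges m. log 2 (real (B p q))) \<le> (\<Sum>(p, q)\<in>edges m. N * h p q + (2 * N * \<epsilon> + 1))"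
    using logB by (intro sum_mono) auto
  also have "\<dots> = N * (\<Sum>(p, q)\<in>edges m. h p q) + card (edges m) * (2 * N * \<epsilon> + 1)"
    by (simp add: case_prod_unfold sum.distrib sum_distrib_left)
  also have "(\<Sum>(p, q)\<in>edges m. h p q) = (\<Sum>q=1..m. ent P (lo q))"
    unfolding h_def by (rule sum_ent_edges)
  finally have "(\<Sum>(p, q)\<in>edges m. log 2 (real (B p q))) \<le> N * (\<Sum>q=1..m. ent P (lo q)) + card (edges m) * (2 * N * \<epsilon> + 1)" .
  note rate = this
  show ?thesis
    by (intro exI[of _ \<kappa>'] exI[of _ "\<lambda>p v. \<lambda>k\<in>{..<N}. \<lambda>j\<in>{1..m} - {p}. Dec p v j k"] exI[of _ B] conjI allI ballI)
      (fact Bpos, erule \<kappa>', fact rate, fact cl')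
qed

section \<open>Entropy balance of a network\<close>

text \<open>The joint distribution of the edge variables and of the outputs that the vertices produce from
  what they see.\<close>

definition network :: "nat \<Rightarrow> (nat \<Rightarrow> nat \<Rightarrow> 'v) pmf \<Rightarrow> (nat \<Rightarrow> (nat \<Rightarrow> 'v) \<Rightarrow> 'b pmf) \<Rightarrow>
    ((nat \<Rightarrow> nat \<Rightarrow> 'v) \<times> (nat \<Rightarrow> 'b)) pmf" where
  "network m P K = bind_pmf P (\<lambda>w. map_pmf (Pair w) (Pi_pmf {1..m} undefined (\<lambda>i. K i (view m i w))))"

text \<open>The conditional entropy of the view of vertex \<open>i\<close> given its output.\<close>

definition residual :: "nat \<Rightarrow> (nat \<Rightarrow> nat \<Rightarrow> 'v) pmf \<Rightarrow> (nat \<Rightarrow> (nat \<Rightarrow> 'v) \<Rightarrow> 'b pmf) \<Rightarrow> nat \<Rightarrow> real" where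
  "residual m P K i = ent (network m P K) (\<lambda>z. (view m i (fst z), snd z i)) - ent (network m P K) (\<lambda>z. snd z i)"

definition correlation :: "nat \<Rightarrow> (nat \<Rightarrow> 'b) pmf \<Rightarrow> real" where
  "correlation m R = (\<Sum>i=1..m. ent R (\<lambda>x. x i)) - ent R (\<lambda>x. x)"

lemma map_fst_network: "map_pmf fst (network m P K) = P"
  by (simp add: network_def map_bind_pmf map_pmf_comp map_pmf_const bind_return_pmf')

lemma map_snd_network:
  "map_pmf snd (network m P K) = bind_pmf P (\<lambda>w. Pi_pmf {1..m} undefined (\<lambda>i. K i (view m i w)))"
  by (simp add: network_def map_bind_pmf map_pmf_comp)

lemma finite_network:
  assumes "finite (set_pmf P)" "\<And>i v. i \<in> {1..m} \<Longrightarrow> finite (set_pmf (K i v))"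
  shows "finite (set_pmf (network m P K))"
  using assms by (auto simp: network_def intro!: finite_set_Pi_pmf)

lemma ent_fst: "ent (network m P K) (\<lambda>z. f (fst z)) = ent P f"
  using ent_map[of fst "network m P K" f] by (simp add: map_fst_network comp_def)

lemma network_set: "z \<in> set_pmf (network m P K) \<Longrightarrow> fst z \<in> set_pmf P \<and> (\<forall>i. i \<notin> {1..m} \<longrightarrow> snd z i = undefined)"
  by (auto simp: network_def set_Pi_pmf PiE_dflt_def)

lemma pmf_network: "pmf (network m P K) (w, x) = pmf P w * pmf (Pi_pmf {1..m} undefined (\<lambda>i. K i (view m i w))) x"
proof -
  have "pmf (map_pmf (Pair w') (Pi_pmf {1..m} undefined (\<lambda>i. K i (view m i w')))) (w, x)
      = indicator {w} w' * pmf (Pi_pmf {1..m} undefined (\<lambda>i. K i (view m i w))) x" for w'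
  proof (cases "w' = w")
    case True
    then show ?thesis by (simp add: pmf_map_inj' inj_def)
  next
    case False
    then show ?thesis by (auto simp: pmf_eq_0_set_pmf)
  qed
  then have "pmf (network m P K) (w, x) = measure_pmf.expectation P (\<lambda>w'. indicator {w} w' * pmf (Pi_pmf {1..m} undefined (\<lambda>i. K i (view m i w))) x)"
    by (simp add: network_def pmf_bind)
  then show ?thesis by (simp add: pmf.rep_eq)
qed

lemma pr_network_vertex:
  assumes i: "i \<in> {1..m}"
  shows "pr (network m P K) (\<lambda>z. (view m i (fst z), snd z i)) z
    = pr (network m P K) (\<lambda>z. view m i (fst z)) z * pmf (K i (view m i (fst z))) (snd z i)"
proof -
  let ?v = "view m i (fst z)"
  have comp: "measure_pmf.prob (Pi_pmf {1..m} undefined (\<lambda>i. K i (view m i w))) {x. x i = y} = pmf (K i (view m i w)) y" for w y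
  proof -
    have "pmf (K i (view m i w)) y = pmf (map_pmf (\<lambda>x. x i) (Pi_pmf {1..m} undefined (\<lambda>i. K i (view m i w)))) y"
      using i by (simp add: Pi_pmf_component)
    then show ?thesis by (simp add: pmf_map vimage_def)
  qed
  have *: "measure_pmf.prob (network m P K) A
      = measure_pmf.expectation P (\<lambda>w. measure_pmf.prob (Pi_pmf {1..m} undefined (\<lambda>i. K i (view m i w))) {x. (w, x) \<in> A})" for A
    by (simp add: network_def prob_bind_pmf vimage_def)
  have "pr (network m P K) (\<lambda>z. (view m i (fst z), snd z i)) z
      = measure_pmf.expectation P (\<lambda>w. indicator {w. view m i w = ?v} w * pmf (K i ?v) (snd z i))"
    unfolding pr_def * by (intro expectation_cong) (auto simp: indicator_def comp[simplified])
  also have "\<dots> = measure_pmf.prob P {w. view m i w = ?v} * pmf (K i ?v) (snd z i)"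
    by simp
  also have "measure_pmf.prob P {w. view m i w = ?v} = pr (network m P K) (\<lambda>z. view m i (fst z)) z"
    unfolding pr_def * prob_eq_expectation[of P] by (intro expectation_cong) (simp add: indicator_def)
  finally show ?thesis .
qed

text \<open>Given the edges the outputs are independent, and output \<open>i\<close> depends on its
  view only, so the kernel is the conditional law of the output given the view
  (\<open>pr_network_vertex\<close>).\<close>

lemma info_network:
  assumes z: "z \<in> set_pmf (network m P K)"
  shows "info (network m P K) (\<lambda>z. z) z = info (network m P K) fst z +
    (\<Sum>i=1..m. info (network m P K) (\<lambda>z. (view m i (fst z), snd z i)) z - info (network m P K) (\<lambda>z. view m i (fst z)) z)"
proof -
  let ?J = "network m P K"
  have pos: "pmf (K i (view m i (fst z))) (snd z i) > 0" if "i \<in> {1..m}" for i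
    using pr_network_vertex[OF that, of P K z] pr_pos[OF z, of "\<lambda>z. (view m i (fst z), snd z i)"]
      pr_pos[OF z, of "\<lambda>z. view m i (fst z)"] by (simp add: zero_less_mult_iff)
  have f: "pr ?J fst z = pmf P (fst z)" by (simp add: pr_eq_pmf map_fst_network)
  have "pr ?J (\<lambda>z. z) z = pmf P (fst z) * pmf (Pi_pmf {1..m} undefined (\<lambda>i. K i (view m i (fst z)))) (snd z)"
    using pmf_network[of m P K "fst z" "snd z"] by (simp add: pr_eq_pmf)
  also have "\<dots> = pr ?J fst z * (\<Prod>i=1..m. pmf (K i (view m i (fst z))) (snd z i))"
    using network_set[OF z] by (subst pmf_Pi') (auto simp: f)
  finally have "log 2 (pr ?J (\<lambda>z. z) z) = log 2 (pr ?J fst z) + (\<Sum>i=1..m. log 2 (pmf (K i (view m i (fst z))) (snd z i)))"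
    using pr_pos[OF z, of fst] prod_pos[of "{1..m}", OF pos]
    by (simp only: log_mult_pos log_prod_pos[OF finite_atLeastAtMost pos])
  moreover have "(\<Sum>i=1..m. info ?J (\<lambda>z. (view m i (fst z), snd z i)) z - info ?J (\<lambda>z. view m i (fst z)) z)
      = (\<Sum>i=1..m. - log 2 (pmf (K i (view m i (fst z))) (snd z i)))"
  proof (rule sum.cong[OF refl])
    fix i assume i: "i \<in> {1..m}"
    show "info ?J (\<lambda>z. (view m i (fst z), snd z i)) z - info ?J (\<lambda>z. view m i (fst z)) z = - log 2 (pmf (K i (view m i (fst z))) (snd z i))"
      unfolding info_def pr_network_vertex[OF i, of P K z]
      using pos[OF i] pr_pos[OF z, of "\<lambda>z. view m i (fst z)"] by (simp add: log_mult)
  qed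
  ultimately show ?thesis by (simp add: info_def sum_negf)
qed

lemma ent_network:
  assumes "finite (set_pmf (network m P K))"
  shows "ent (network m P K) (\<lambda>z. z) = ent P (\<lambda>w. w) +
    (\<Sum>i=1..m. ent (network m P K) (\<lambda>z. (view m i (fst z), snd z i)) - ent P (view m i))"
proof -
  let ?J = "network m P K"
  have "ent ?J (\<lambda>z. z) = measure_pmf.expectation ?J (\<lambda>z. info ?J fst z +
    (\<Sum>i=1..m. info ?J (\<lambda>z. (view m i (fst z), snd z i)) z - info ?J (\<lambda>z. view m i (fst z)) z))"
    unfolding ent_def[of ?J "\<lambda>z. z"] by (intro expectation_cong info_network)
  also have "\<dots> = ent ?J fst + (\<Sum>i=1..m. ent ?J (\<lambda>z. (view m i (fst z), snd z i)) - ent ?J (\<lambda>z. view m i (fst z)))"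
    using assms by (simp add: ent_def)
  also have "ent ?J fst = ent P (\<lambda>w. w)" using ent_fst[of m P K "\<lambda>w. w"] by simp
  also have "(\<Sum>i=1..m. ent ?J (\<lambda>z. (view m i (fst z), snd z i)) - ent ?J (\<lambda>z. view m i (fst z)))
     = (\<Sum>i=1..m. ent ?J (\<lambda>z. (view m i (fst z), snd z i)) - ent P (view m i))"
    using ent_fst[of m P K "view m i" for i] by (intro sum.cong) auto
  finally show ?thesis .
qed

locale markov_network =
  fixes m :: nat and P :: "(nat \<Rightarrow> nat \<Rightarrow> 'v) pmf" and K :: "nat \<Rightarrow> (nat \<Rightarrow> 'v) \<Rightarrow> 'b pmf"
  assumes markov: "markov m P" and finP: "finite (set_pmf P)" and canP: "\<And>w. w \<in> set_pmf P \<Longrightarrow> canon m w = w"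
    and finK: "\<And>i v. i \<in> {1..m} \<Longrightarrow> finite (set_pmf (K i v))"
begin

abbreviation "J \<equiv> network m P K"

lemma finJ: "finite (set_pmf J)"
  by (intro finite_network finP finK)

lemma canJ: "z \<in> set_pmf J \<Longrightarrow> canon m (fst z) = fst z"
  using network_set[of z m P K] canP by auto

text \<open>By the Markov condition the left-hand side is the sum of all H(view_i) minus H(W), and
  in the network H(W, X) is H(W) plus the sum of all H(X_i | view_i). Eliminating H(W) cancels the
  entropies of the views; the last bracket is H(W | X).\<close>

lemma sum_ent_lo:
  "(\<Sum>q=1..m. ent P (lo q)) = correlation m (map_pmf snd J) + (\<Sum>i=1..m. residual m P K i)
     - (ent J (\<lambda>z. z) - ent J snd)"
proof -
  have "ent P (\<lambda>w. w) = ent P (canon m)"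
    by (rule ent_cong) (auto simp: determines_def canP)
  then have "(\<Sum>q=1..m. ent P (lo q)) = (\<Sum>i=1..m. ent P (view m i)) - ent P (\<lambda>w. w)"
    using markov_ent_canon[OF markov finP] by (simp add: sum_subtractf)
  then show ?thesis
    using ent_network[OF finJ] by (simp add: correlation_def residual_def sum_subtractf ent_map comp_def)
qed

lemma sum_ent_lo_le:
  "(\<Sum>q=1..m. ent P (lo q)) \<le> correlation m (map_pmf snd J) + (\<Sum>i=1..m. residual m P K i)"
  unfolding sum_ent_lo using ent_mono[OF finJ, of "\<lambda>z. z" snd] by (simp add: determinesI)

text \<open>All vertices but one see every edge.\<close>

lemma sum_ent_lo_ge:
  assumes v: "v \<in> {1..m}"
  shows "correlation m (map_pmf snd J) + residual m P K v \<le> (\<Sum>q=1..m. ent P (lo q))"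
proof -
  \<comment> \<open>The views are revealed one by one on top of all outputs: view \<open>i\<close>
    adds at most its entropy given output \<open>i\<close> alone.\<close>
  have *: "ent J (\<lambda>z. (\<lambda>i\<in>S. view m i (fst z), snd z)) \<le> ent J snd + (\<Sum>i\<in>S. residual m P K i)" if "finite S" for S
    using that
  proof (induction S rule: finite_induct)
    case empty
    show ?case by (simp, intro ent_mono finJ determinesI) auto
  next
    case (insert i S)
    have "ent J (\<lambda>z. (\<lambda>i\<in>insert i S. view m i (fst z), snd z)) + ent J (\<lambda>z. snd z i)
      \<le> ent J (\<lambda>z. (\<lambda>i\<in>S. view m i (fst z), snd z)) + ent J (\<lambda>z. (view m i (fst z), snd z i))"
      by (intro ent_submod finJ determinesI) (auto simp: restrict_eq_iff)
    then show ?case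
      using insert residual_def[of m P K i] sum.insert[OF insert(1,2), of "residual m P K"] by linarith
  qed
  let ?S = "{1..m} - {v}"
  have "ent J (\<lambda>z. z) \<le> ent J (\<lambda>z. (\<lambda>i\<in>?S. view m i (fst z), snd z))"
  proof (rule ent_mono[OF finJ])
    show "determines J (\<lambda>z. (\<lambda>i\<in>?S. view m i (fst z), snd z)) (\<lambda>z. z)"
      unfolding determines_def
    proof (intro ballI impI)
      fix x y assume xy: "x \<in> set_pmf J" "y \<in> set_pmf J"
        and eq: "(\<lambda>i\<in>?S. view m i (fst x), snd x) = (\<lambda>i\<in>?S. view m i (fst y), snd y)"
      have V: "view m i (fst x) = view m i (fst y)" if "i \<in> ?S" for i
        using eq that by (auto simp: restrict_eq_iff)
      have "fst x p q = fst y p q" if e: "(p, q) \<in> edges m" for p q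
      proof (cases "p = v")
        case True
        then have "q \<in> ?S" using e by (auto simp: edges_def)
        from V[OF this] show ?thesis using e by (auto simp: view_eq_iff col_eq_iff edges_def)
      next
        case False
        then have "p \<in> ?S" using e by (auto simp: edges_def)
        from V[OF this] show ?thesis using e by (auto simp: view_eq_iff row_eq_iff edges_def)
      qed
      then have "canon m (fst x) = canon m (fst y)" by (auto simp: canon_def fun_eq_iff)
      then show "x = y" using canJ[OF xy(1)] canJ[OF xy(2)] eq by (auto intro: prod_eqI)
    qed
  qed
  also have "\<dots> \<le> ent J snd + (\<Sum>i\<in>?S. residual m P K i)" by (rule *) simp
  also have "(\<Sum>i\<in>?S. residual m P K i) = (\<Sum>i=1..m. residual m P K i) - residual m P K v"
    using v by (simp add: sum_diff1)
  finally show ?thesis using sum_ent_lo by linarith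
qed

lemma sum_ent_lo_le_edges: "(\<Sum>q=1..m. ent P (lo q)) \<le> (\<Sum>(p, q)\<in>edges m. ent P (\<lambda>w. w p q))"
proof -
  have "ent P (\<lambda>w. (w p q, col p q w)) - ent P (col p q) \<le> ent P (\<lambda>w. w p q)" for p q
    using ent_pair_le[OF finP determines_refl, of "\<lambda>w. w p q" "col p q"] by simp
  then show ?thesis unfolding sum_ent_edges[symmetric] by (intro sum_mono) auto
qed

end

text \<open>At most \<open>card A\<close> values have probability below
  \<open>2 powr (- t) / card A\<close>, so together they carry mass at most
  \<open>2 powr (- t)\<close>.\<close>

lemma info_upper_tail:
  assumes fin: "finite (set_pmf p)" and A: "finite A" "f ` set_pmf p \<subseteq> A" 
  shows "measure_pmf.prob p {x. info p f x > log 2 (card A) + t} \<le> 2 powr (- t)"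
proof -
  have ne: "card A > 0" using A set_pmf_not_empty[of p] by (auto simp: card_gt_0_iff)
  have "measure_pmf.prob p {x. info p f x > log 2 (card A) + t}
      = measure_pmf.expectation p (indicator {x. info p f x > log 2 (card A) + t})" by simp
  also have "\<dots> \<le> measure_pmf.expectation p (\<lambda>x. (2 powr (- t) / card A) / pr p f x)"
  proof (rule expectation_mono[OF fin])
    fix x assume x: "x \<in> set_pmf p"
    note pos = pr_pos[OF x, of f]
    show "indicator {x. info p f x > log 2 (card A) + t} x \<le> (2 powr (- t) / card A) / pr p f x"
    proof (cases "info p f x > log 2 (card A) + t")
      case True
      have "log 2 (pr p f x) \<le> log 2 (2 powr (- t) / card A)"
        using True ne by (simp add: info_def log_divide)
      then have "pr p f x \<le> 2 powr (- t) / card A" using pos ne by (subst (asm) log_le_cancel_iff) auto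
      then have "1 \<le> (2 powr (- t) / card A) / pr p f x" using pos by (simp only: le_divide_eq_1_pos)
      moreover have "indicator {x. info p f x > log 2 (card A) + t} x = (1 :: real)" using True by simp
      ultimately show ?thesis by (simp only:)
    qed (use pos in auto)
  qed
  also have "\<dots> = (\<Sum>v\<in>f ` set_pmf p. 2 powr (- t) / card A)"
    by (rule sum_density_image[OF fin])
  also have "\<dots> \<le> (\<Sum>v\<in>A. 2 powr (- t) / card A)" using A by (intro sum_mono2) auto
  also have "\<dots> = 2 powr (- t)" using ne by simp
  finally show ?thesis .
qed

context markov_network
begin

text \<open>The latent alphabets are not bounded in terms of the block length, so the entropy of a
  view is bounded through the output instead.\<close>

lemma ent_view_le:
  assumes A: "finite A" "i \<in> {1..m}" "\<And>v. set_pmf (K i v) \<subseteq> A"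
  shows "ent P (view m i) \<le> log 2 (card A) + residual m P K i"
proof -
  have "set_pmf (map_pmf (\<lambda>z. snd z i) J) \<subseteq> A"
    using A by (fastforce simp: network_def set_Pi_pmf PiE_dflt_def)
  then have "ent J (\<lambda>z. snd z i) \<le> log 2 (card A)"
    unfolding ent_eq_ent_id[of J] by (intro ent_le_log_card A)
  moreover have "ent P (view m i) \<le> ent J (\<lambda>z. (view m i (fst z), snd z i))"
    unfolding ent_fst[of m P K "view m i", symmetric] by (intro ent_mono finJ determinesI) simp
  ultimately show ?thesis by (simp add: residual_def)
qed

text \<open>The density of the view is at most that of the output plus the conditional density of
  the view given the output. The first rarely exceeds the logarithm of the output alphabet by
  \<open>t\<close>; the second is nonnegative with mean \<open>residual m P K i\<close>, so Markov's
  inequality applies.\<close>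

lemma info_view_tail:
  assumes A: "finite A" "i \<in> {1..m}" "\<And>v. set_pmf (K i v) \<subseteq> A" and t: "t > 0"
  shows "measure_pmf.prob P {w. info P (view m i) w > log 2 (card A) + 2 * t}
    \<le> 2 powr (- t) + residual m P K i / t"
proof -
  let ?X = "\<lambda>z :: (nat \<Rightarrow> nat \<Rightarrow> 'v) \<times> (nat \<Rightarrow> 'b). snd z i"
  let ?VX = "\<lambda>z :: (nat \<Rightarrow> nat \<Rightarrow> 'v) \<times> (nat \<Rightarrow> 'b). (view m i (fst z), snd z i)"
  have XA: "?X ` set_pmf J \<subseteq> A"
    using A by (fastforce simp: network_def set_Pi_pmf PiE_dflt_def)
  have "measure_pmf.prob P {w. info P (view m i) w > log 2 (card A) + 2 * t}
    = measure_pmf.prob (map_pmf fst J) {w. info (map_pmf fst J) (view m i) w > log 2 (card A) + 2 * t}"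
    by (simp only: map_fst_network)
  also have "\<dots> = measure_pmf.prob J {z. info J (view m i \<circ> fst) z > log 2 (card A) + 2 * t}"
    by (simp add: vimage_def info_map del: map_fst_network)
  also have "\<dots> \<le> measure_pmf.prob J ({z. info J ?X z > log 2 (card A) + t} \<union> {z. t \<le> info J ?VX z - info J ?X z})"
  proof (intro measure_pmf.finite_measure_mono_AE AE_pmfI impI)
    fix z assume z: "z \<in> set_pmf J" "z \<in> {z. info J (view m i \<circ> fst) z > log 2 (card A) + 2 * t}"
    have "info J (view m i \<circ> fst) z \<le> info J ?VX z" using z by (intro info_mono determinesI) auto
    then show "z \<in> {z. info J ?X z > log 2 (card A) + t} \<union> {z. t \<le> info J ?VX z - info J ?X z}" using z(2) by auto
  qed simp
  also have "\<dots> \<le> measure_pmf.prob J {z. info J ?X z > log 2 (card A) + t} + measure_pmf.prob J {z. t \<le> info J ?VX z - info J ?X z}"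
    by (intro measure_Un_le) auto
  also have "measure_pmf.prob J {z. info J ?X z > log 2 (card A) + t} \<le> 2 powr (- t)"
    by (intro info_upper_tail finJ A XA)
  also have "measure_pmf.prob J {z. t \<le> info J ?VX z - info J ?X z} \<le> measure_pmf.expectation J (\<lambda>z. info J ?VX z - info J ?X z) / t"
  proof (intro prob_markov finJ t)
    fix z assume "z \<in> set_pmf J"
    then show "0 \<le> info J ?VX z - info J ?X z"
      unfolding diff_ge_0_iff_ge by (intro info_mono determinesI) auto
  qed
  also have "measure_pmf.expectation J (\<lambda>z. info J ?VX z - info J ?X z) = residual m P K i"
    using finJ by (simp add: residual_def ent_def)
  finally show ?thesis by simp
qed

end

section \<open>Simulating long blocks\<close>

lemma Pi_pmf_map_restrict:
  assumes "finite I"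
  shows "Pi_pmf I undefined (\<lambda>i. map_pmf (g i) (q i)) = map_pmf (\<lambda>x. \<lambda>i\<in>I. g i (x i)) (Pi_pmf I d q)"
proof -
  have "Pi_pmf I undefined (\<lambda>i. bind_pmf (q i) (\<lambda>y. return_pmf (g i y)))
      = bind_pmf (Pi_pmf I d q) (\<lambda>x. Pi_pmf I undefined (\<lambda>i. return_pmf (g i (x i))))"
    using assms by (rule Pi_pmf_bind)
  then show ?thesis
    using assms by (simp add: map_pmf_def restrict_def)
qed

lemma Pi_pmf_transpose:
  assumes "finite I" "finite A"
  shows "map_pmf (\<lambda>z. \<lambda>i\<in>I. \<lambda>k\<in>A. z k i) (Pi_pmf A undefined (\<lambda>k. Pi_pmf I undefined (\<lambda>i. q k i)))
    = Pi_pmf I undefined (\<lambda>i. Pi_pmf A undefined (\<lambda>k. q k i))" (is "?L = ?R")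
proof (rule pmf_eqI)
  fix y
  show "pmf ?L y = pmf ?R y"
  proof (cases "(\<forall>i. i \<notin> I \<longrightarrow> y i = undefined) \<and> (\<forall>i\<in>I. \<forall>k. k \<notin> A \<longrightarrow> y i k = undefined)")
    case True
    have "(\<lambda>i\<in>I. \<lambda>k\<in>A. z k i) = y \<longleftrightarrow> (\<forall>k\<in>A. \<forall>i\<in>I. z k i = y i k)" for z
      using True by (auto simp: fun_eq_iff restrict_def)
    then have "{z. (\<lambda>i\<in>I. \<lambda>k\<in>A. z k i) = y} = Pi A (\<lambda>k. Pi I (\<lambda>i. {y i k}))"
      by auto
    then have "pmf ?L y = measure_pmf.prob (Pi_pmf A undefined (\<lambda>k. Pi_pmf I undefined (\<lambda>i. q k i))) (Pi A (\<lambda>k. Pi I (\<lambda>i. {y i k})))"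
      by (simp add: pmf_map vimage_def)
    also have "\<dots> = (\<Prod>k\<in>A. \<Prod>i\<in>I. pmf (q k i) (y i k))"
      using assms by (simp add: measure_Pi_pmf_Pi pmf.rep_eq)
    also have "\<dots> = (\<Prod>i\<in>I. \<Prod>k\<in>A. pmf (q k i) (y i k))"
      by (rule prod.swap)
    also have "\<dots> = pmf ?R y"
      using True assms by (subst pmf_Pi') (auto intro!: prod.cong simp: pmf_Pi)
    finally show ?thesis .
  next
    case False
    then have "y \<notin> set_pmf ?L"
      by (auto simp: restrict_def)
    moreover have "y \<notin> set_pmf ?R"
      using False assms by (auto simp: set_Pi_pmf PiE_dflt_def)
    ultimately have "pmf ?L y = 0" "pmf ?R y = 0" unfolding pmf_eq_0_set_pmf by blast+
    then show ?thesis by (simp only:)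
  qed
qed

text \<open>With \<open>L < N * n\<close> the surplus symbols at the end are cut off; in this way
  every length \<open>L\<close> is reached and not only the multiples of \<open>n\<close>.\<close>

lemma Pi_pmf_concat:
  fixes n N L :: nat
  assumes n: "n > 0" and L: "L \<le> N * n"
  shows "map_pmf (\<lambda>z. \<lambda>l\<in>{..<L}. z (l div n) (l mod n)) (Pi_pmf {..<N} undefined (\<lambda>_. Pi_pmf {..<n} undefined (\<lambda>_. p)))
    = Pi_pmf {..<L} undefined (\<lambda>_. p)" (is "?L = ?R")
proof (rule pmf_eqI)
  fix y
  show "pmf ?L y = pmf ?R y"
  proof (cases "\<forall>l. l \<notin> {..<L} \<longrightarrow> y l = undefined")
    case True
    \<comment> \<open>Positions from \<open>L\<close> on are unconstrained and contribute factors
      1.\<close>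
    define S where "S l = (if l < L then {y l} else UNIV)" for l
    have "(\<lambda>l\<in>{..<L}. z (l div n) (l mod n)) = y \<longleftrightarrow> z \<in> Pi {..<N} (\<lambda>j. Pi {..<n} (\<lambda>r. S (j * n + r)))" for z
    proof -
      have "(\<lambda>l\<in>{..<L}. z (l div n) (l mod n)) = y \<longleftrightarrow> (\<forall>l<L. z (l div n) (l mod n) = y l)"
        using True by (auto simp: fun_eq_iff restrict_def)
      also have "\<dots> \<longleftrightarrow> (\<forall>j<N. \<forall>r<n. j * n + r < L \<longrightarrow> z j r = y (j * n + r))"
      proof safe
        fix j r assume "\<forall>l<L. z (l div n) (l mod n) = y l" "r < n" "j * n + r < L"
        then show "z j r = y (j * n + r)" by (auto dest!: spec[of _ "j * n + r"])
      next
        fix l assume *: "\<forall>j<N. \<forall>r<n. j * n + r < L \<longrightarrow> z j r = y (j * n + r)" and "l < L"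
        then have "l div n < N" "l mod n < n" "l div n * n + l mod n = l"
          using n L by (auto simp: less_mult_imp_div_less)
        then show "z (l div n) (l mod n) = y l" using * \<open>l < L\<close> by metis
      qed
      finally show ?thesis by (auto simp: S_def Pi_def)
    qed
    then have "pmf ?L y = measure_pmf.prob (Pi_pmf {..<N} undefined (\<lambda>_. Pi_pmf {..<n} undefined (\<lambda>_. p))) (Pi {..<N} (\<lambda>j. Pi {..<n} (\<lambda>r. S (j * n + r))))"
      by (simp add: pmf_map vimage_def)
    also have "\<dots> = (\<Prod>j<N. \<Prod>r<n. measure_pmf.prob p (S (j * n + r)))"
      by (simp add: measure_Pi_pmf_Pi)
    also have "\<dots> = (\<Prod>j<N. prod (\<lambda>l. measure_pmf.prob p (S l)) {j * n..<j * n + n})"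
    proof (rule prod.cong[OF refl])
      fix j
      show "(\<Prod>r<n. measure_pmf.prob p (S (j * n + r))) = prod (\<lambda>l. measure_pmf.prob p (S l)) {j * n..<j * n + n}"
        using prod.shift_bounds_nat_ivl[of "\<lambda>l. measure_pmf.prob p (S l)" 0 "j * n" n]
        by (simp add: add.commute lessThan_atLeast0)
    qed
    also have "\<dots> = (\<Prod>l<N * n. measure_pmf.prob p (S l))"
      by (rule prod.nat_group)
    also have "\<dots> = (\<Prod>l<L. measure_pmf.prob p (S l))"
      using L by (intro prod.mono_neutral_right) (auto simp: S_def)
    also have "\<dots> = pmf ?R y"
      using True by (subst pmf_Pi') (auto simp: S_def measure_pmf_single intro!: prod.cong)
    finally show ?thesis .
  next
    case False
    then have "y \<notin> set_pmf ?L" by (auto simp: restrict_def)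
    moreover have "y \<notin> set_pmf ?R"
      using False by (auto simp: set_Pi_pmf PiE_dflt_def)
    ultimately have "pmf ?L y = 0" "pmf ?R y = 0" unfolding pmf_eq_0_set_pmf by blast+
    then show ?thesis by (simp only:)
  qed
qed

definition iid_blocks :: "nat \<Rightarrow> nat \<Rightarrow> (nat \<Rightarrow> 'x) pmf \<Rightarrow> (nat \<Rightarrow> nat \<Rightarrow> 'x) pmf" where
  "iid_blocks m L p = map_pmf (\<lambda>x. \<lambda>i\<in>{1..m}. \<lambda>k\<in>{..<L}. x k i) (Pi_pmf {..<L} undefined (\<lambda>_. p))"

definition join_blocks :: "nat \<Rightarrow> nat \<Rightarrow> (nat \<Rightarrow> nat \<Rightarrow> 'x) \<Rightarrow> nat \<Rightarrow> 'x" where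
  "join_blocks n L y = (\<lambda>l\<in>{..<L}. y (l div n) (l mod n))"

lemma join_iid_blocks:
  assumes n: "n > 0" and L: "L \<le> N * n"
  shows "map_pmf (\<lambda>z. \<lambda>i\<in>{1..m}. join_blocks n L (\<lambda>k\<in>{..<N}. z k i)) (Pi_pmf {..<N} undefined (\<lambda>_. iid_blocks m n p)) = iid_blocks m L p"
proof -
  have bd: "l div n < N" "l mod n < n" if "l < L" for l
    using that n L by (auto simp: less_mult_imp_div_less)
  have "Pi_pmf {..<N} undefined (\<lambda>_. iid_blocks m n p)
    = map_pmf (\<lambda>x. \<lambda>j\<in>{..<N}. \<lambda>i\<in>{1..m}. \<lambda>k\<in>{..<n}. x j k i) (Pi_pmf {..<N} undefined (\<lambda>_. Pi_pmf {..<n} undefined (\<lambda>_. p)))"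
    unfolding iid_blocks_def by (rule Pi_pmf_map_restrict) simp
  then have "map_pmf (\<lambda>z. \<lambda>i\<in>{1..m}. join_blocks n L (\<lambda>k\<in>{..<N}. z k i)) (Pi_pmf {..<N} undefined (\<lambda>_. iid_blocks m n p))
    = map_pmf (\<lambda>x. \<lambda>i\<in>{1..m}. join_blocks n L (\<lambda>k\<in>{..<N}. (\<lambda>j\<in>{..<N}. \<lambda>i\<in>{1..m}. \<lambda>k\<in>{..<n}. x j k i) k i)) (Pi_pmf {..<N} undefined (\<lambda>_. Pi_pmf {..<n} undefined (\<lambda>_. p)))"
    by (simp only: map_pmf_comp)
  also have "\<dots> = map_pmf (\<lambda>x. \<lambda>i\<in>{1..m}. \<lambda>l\<in>{..<L}. (\<lambda>l\<in>{..<L}. x (l div n) (l mod n)) l i) (Pi_pmf {..<N} undefined (\<lambda>_. Pi_pmf {..<n} undefined (\<lambda>_. p)))"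
    using bd by (intro map_pmf_cong refl) (auto simp: join_blocks_def fun_eq_iff)
  also have "\<dots> = map_pmf (\<lambda>x. \<lambda>i\<in>{1..m}. \<lambda>k\<in>{..<L}. x k i) (map_pmf (\<lambda>z. \<lambda>l\<in>{..<L}. z (l div n) (l mod n)) (Pi_pmf {..<N} undefined (\<lambda>_. Pi_pmf {..<n} undefined (\<lambda>_. p))))"
    by (simp only: map_pmf_comp)
  also have "\<dots> = iid_blocks m L p" unfolding Pi_pmf_concat[OF n L] iid_blocks_def ..
  finally show ?thesis .
qed

lemma finite_iid_blocks: "finite (set_pmf p) \<Longrightarrow> finite (set_pmf (iid_blocks m L p))"
  by (auto simp: iid_blocks_def intro!: finite_set_Pi_pmf)

text \<open>The vertices decode N views and apply the original channel to each. Decoded and true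
  views have close laws by \<open>block_coding\<close>; with true views the outputs are N
  independent outputs of the network, each close to an i.i.d. block.\<close>

lemma simulation:
  fixes P :: "(nat \<Rightarrow> nat \<Rightarrow> 'v) pmf" and K :: "nat \<Rightarrow> (nat \<Rightarrow> 'v) \<Rightarrow> (nat \<Rightarrow> 'x) pmf"
    and n N L :: nat and e \<epsilon> T H \<eta> :: real
  assumes "markov_network m P K"
    and n: "n > 0" and N: "N > 0" and L: "L \<le> N * n" and \<epsilon>: "\<epsilon> > 0" and T: "T > 0"
    and H: "\<And>p. p \<in> {1..m} \<Longrightarrow> ent P (view m p) \<le> H"
    and \<eta>: "\<And>p. p \<in> {1..m} \<Longrightarrow> measure_pmf.prob P {w. info P (view m p) w > T} \<le> \<eta>"
    and e: "close e (map_pmf snd (network m P K)) (iid_blocks m n p)" and finp: "finite (set_pmf p)"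
    and K: "\<And>i v. i \<in> {1..m} \<Longrightarrow> set_pmf (K i v) \<subseteq> PiE {..<n} (\<lambda>_. \<X> i)"
  shows "\<exists>\<kappa> Kh B. (\<forall>p q. B p q > 0) \<and> (\<forall>p z. \<forall>r\<in>set_pmf (\<kappa> p z). r \<in> PiE {p<..m} (\<lambda>q. {..<B p q})) \<and>
    (\<Sum>(p, q)\<in>edges m. log 2 (real (B p q))) \<le> N * (\<Sum>q=1..m. ent P (lo q)) + card (edges m) * (2 * N * \<epsilon> + 1) \<and>
    (\<forall>i\<in>{1..m}. \<forall>v. set_pmf (Kh i v) \<subseteq> PiE {..<L} (\<lambda>_. \<X> i)) \<and>
    close (card (edges m) * (2 * (N * \<eta> + T * H / (N * \<epsilon>\<^sup>2)) + 2 * 2 powr (- (N * \<epsilon>))) + N * e)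
      (bind_pmf (chain \<kappa> m) (\<lambda>s. Pi_pmf {1..m} undefined (\<lambda>i. Kh i (view m i s)))) (iid_blocks m L p)"
proof -
  interpret markov_network m P K by fact
  let ?\<delta> = "card (edges m) * (2 * (N * \<eta> + T * H / (N * \<epsilon>\<^sup>2)) + 2 * 2 powr (- (N * \<epsilon>)))"
  let ?PiP = "Pi_pmf {..<N} undefined (\<lambda>_. P)"
  have "\<exists>\<kappa>' Dec B. (\<forall>p q. B p q > 0) \<and> (\<forall>p z. \<forall>r\<in>set_pmf (\<kappa>' p z). r \<in> PiE {p<..m} (\<lambda>q. {..<B p q})) \<and>
    (\<Sum>(p, q)\<in>edges m. log 2 (real (B p q))) \<le> N * (\<Sum>q=1..m. ent P (lo q)) + card (edges m) * (2 * N * \<epsilon> + 1) \<and>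
    close ?\<delta> (map_pmf (\<lambda>w. \<lambda>p\<in>{1..m}. \<lambda>k\<in>{..<N}. view m p (w k)) ?PiP)
      (map_pmf (\<lambda>s. \<lambda>p\<in>{1..m}. Dec p (view m p s)) (chain \<kappa>' m))"
    by (rule block_coding[OF markov finP canP N \<epsilon> T H \<eta>])
  then obtain \<kappa> Dec B where B: "\<forall>p q. B p q > 0" and range: "\<forall>p z. \<forall>r\<in>set_pmf (\<kappa> p z). r \<in> PiE {p<..m} (\<lambda>q. {..<B p q})"
    and rate: "(\<Sum>(p, q)\<in>edges m. log 2 (real (B p q))) \<le> N * (\<Sum>q=1..m. ent P (lo q)) + card (edges m) * (2 * N * \<epsilon> + 1)"
    and cl: "close ?\<delta> (map_pmf (\<lambda>w. \<lambda>p\<in>{1..m}. \<lambda>k\<in>{..<N}. view m p (w k)) ?PiP)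
      (map_pmf (\<lambda>s. \<lambda>p\<in>{1..m}. Dec p (view m p s)) (chain \<kappa> m))"
    by (elim exE conjE) (rule that)
  define Kh where "Kh i v = map_pmf (join_blocks n L) (Pi_pmf {..<N} undefined (\<lambda>k. K i (Dec i v k)))" for i v
  \<comment> \<open>The channel from tuples of views to long outputs. It is applied to the true and
    to the decoded views alike, so their closeness passes through it.\<close>
  define F where "F V = map_pmf (\<lambda>x. \<lambda>i\<in>{1..m}. join_blocks n L (x i)) (Pi_pmf {1..m} undefined (\<lambda>i. Pi_pmf {..<N} undefined (\<lambda>k. K i (V i k))))" for V
  have fchain: "finite (set_pmf (chain \<kappa> m))"
  proof (rule finite_chain)
    fix p z
    have "set_pmf (\<kappa> p z) \<subseteq> PiE {p<..m} (\<lambda>q. {..<B p q})" using range by blast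
    then show "finite (set_pmf (\<kappa> p z))" by (rule finite_subset) (auto intro: finite_PiE)
  qed
  have fPi: "finite (set_pmf ?PiP)" by (intro finite_set_Pi_pmf finP) simp
  have "close ?\<delta> (bind_pmf (map_pmf (\<lambda>w. \<lambda>p\<in>{1..m}. \<lambda>k\<in>{..<N}. view m p (w k)) ?PiP) F)
      (bind_pmf (map_pmf (\<lambda>s. \<lambda>p\<in>{1..m}. Dec p (view m p s)) (chain \<kappa> m)) F)"
    using fchain fPi by (intro close_bind_left cl) auto
  also have "bind_pmf (map_pmf (\<lambda>s. \<lambda>p\<in>{1..m}. Dec p (view m p s)) (chain \<kappa> m)) F
      = bind_pmf (chain \<kappa> m) (\<lambda>s. Pi_pmf {1..m} undefined (\<lambda>i. Kh i (view m i s)))"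
    unfolding bind_map_pmf
  proof (intro bind_pmf_cong refl)
    fix s
    have "Pi_pmf {1..m} undefined (\<lambda>i. Pi_pmf {..<N} undefined (\<lambda>k. K i ((\<lambda>p\<in>{1..m}. Dec p (view m p s)) i k)))
      = Pi_pmf {1..m} undefined (\<lambda>i. Pi_pmf {..<N} undefined (\<lambda>k. K i (Dec i (view m i s) k)))"
      by (intro Pi_pmf_cong) auto
    then show "F (\<lambda>p\<in>{1..m}. Dec p (view m p s)) = Pi_pmf {1..m} undefined (\<lambda>i. Kh i (view m i s))"
      unfolding F_def Kh_def by (subst Pi_pmf_map_restrict[where d = undefined]) auto
  qed
  also have "bind_pmf (map_pmf (\<lambda>w. \<lambda>p\<in>{1..m}. \<lambda>k\<in>{..<N}. view m p (w k)) ?PiP) F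
      = map_pmf (\<lambda>z. \<lambda>i\<in>{1..m}. join_blocks n L (\<lambda>k\<in>{..<N}. z k i)) (Pi_pmf {..<N} undefined (\<lambda>_. map_pmf snd (network m P K)))"
    (is "?lhs = ?rhs")
  proof -
    let ?G = "\<lambda>x. \<lambda>i\<in>{1..m}. join_blocks n L (x i)"
    let ?T = "\<lambda>z. \<lambda>i\<in>{1..m}. \<lambda>k\<in>{..<N}. z k i"
    have "F (\<lambda>p\<in>{1..m}. \<lambda>k\<in>{..<N}. view m p (w k))
      = map_pmf ?G (map_pmf ?T (Pi_pmf {..<N} undefined (\<lambda>k. Pi_pmf {1..m} undefined (\<lambda>i. K i (view m i (w k))))))" for w
    proof -
      have "Pi_pmf {1..m} undefined (\<lambda>i. Pi_pmf {..<N} undefined (\<lambda>k. K i ((\<lambda>p\<in>{1..m}. \<lambda>k\<in>{..<N}. view m p (w k)) i k)))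
        = Pi_pmf {1..m} undefined (\<lambda>i. Pi_pmf {..<N} undefined (\<lambda>k. K i (view m i (w k))))"
        by (intro Pi_pmf_cong refl) auto
      then show ?thesis
        unfolding F_def by (simp only: Pi_pmf_transpose[OF finite_atLeastAtMost finite_lessThan])
    qed
    then have "?lhs = map_pmf ?G (map_pmf ?T (bind_pmf ?PiP (\<lambda>w. Pi_pmf {..<N} undefined (\<lambda>k. Pi_pmf {1..m} undefined (\<lambda>i. K i (view m i (w k)))))))"
      by (simp add: bind_map_pmf map_bind_pmf)
    also have "bind_pmf ?PiP (\<lambda>w. Pi_pmf {..<N} undefined (\<lambda>k. Pi_pmf {1..m} undefined (\<lambda>i. K i (view m i (w k)))))
        = Pi_pmf {..<N} undefined (\<lambda>_. map_pmf snd (network m P K))"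
      unfolding map_snd_network by (rule Pi_pmf_bind[symmetric]) simp
    also have "map_pmf ?G (map_pmf ?T (Pi_pmf {..<N} undefined (\<lambda>_. map_pmf snd (network m P K)))) = ?rhs"
      unfolding map_pmf_comp by (intro map_pmf_cong refl) (auto simp: fun_eq_iff)
    finally show ?thesis .
  qed
  finally have 1: "close ?\<delta> ?rhs (bind_pmf (chain \<kappa> m) (\<lambda>s. Pi_pmf {1..m} undefined (\<lambda>i. Kh i (view m i s))))" .
  have "close (card {..<N} * e) (Pi_pmf {..<N} undefined (\<lambda>_. map_pmf snd (network m P K))) (Pi_pmf {..<N} undefined (\<lambda>_. iid_blocks m n p))"
    by (intro close_Pi_pmf e) (auto simp: finJ finite_iid_blocks finp)
  from close_map[OF this, of "\<lambda>z. \<lambda>i\<in>{1..m}. join_blocks n L (\<lambda>k\<in>{..<N}. z k i)", unfolded join_iid_blocks[OF n L]]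
  have 2: "close (N * e) ?rhs (iid_blocks m L p)" by simp
  have "set_pmf (Kh i v) \<subseteq> PiE {..<L} (\<lambda>_. \<X> i)" if i: "i \<in> {1..m}" for i v
  proof
    fix y assume "y \<in> set_pmf (Kh i v)"
    then obtain z where z: "\<And>k. k < N \<Longrightarrow> z k \<in> set_pmf (K i (Dec i v k))" "y = join_blocks n L z"
      by (auto simp: Kh_def set_Pi_pmf PiE_dflt_def)
    have "z (l div n) (l mod n) \<in> \<X> i" if "l < L" for l
    proof -
      have "l div n < N" "l mod n < n" using that n L by (auto simp: less_mult_imp_div_less)
      then show ?thesis using z(1)[of "l div n"] K[OF i] by fastforce
    qed
    then show "y \<in> PiE {..<L} (\<lambda>_. \<X> i)" by (simp add: z(2) join_blocks_def)
  qed
  moreover have "close (?\<delta> + N * e) (bind_pmf (chain \<kappa> m) (\<lambda>s. Pi_pmf {1..m} undefined (\<lambda>i. Kh i (view m i s)))) (iid_blocks m L p)"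
    by (rule close_trans[OF close_sym[OF 1] 2])
  ultimately show ?thesis using B range rate by blast
qed

section \<open>Finitely valued random variables\<close>

text \<open>For a simple function on a probability space this is its distribution: the range is
  finite, so values of probability 0 are avoided almost surely
  (\<open>measure_pmf_law\<close>).\<close>

definition law :: "'a measure \<Rightarrow> ('a \<Rightarrow> 'b) \<Rightarrow> 'b pmf" where
  "law M Z = Abs_pmf (distr M (count_space UNIV) Z)"

context
  fixes M :: "'a measure" and Z :: "'a \<Rightarrow> 'z"
  assumes M: "prob_space M" and Z: "simple_function M Z"
begin

interpretation prob_space M by fact

lemma measure_pmf_law: "measure_pmf (law M Z) = distr M (count_space UNIV) Z"
proof -
  have rv: "Z \<in> measurable M (count_space UNIV)" using Z by (rule measurable_simple_function)
  have "AE a in M. \<forall>v\<in>Z ` space M. measure M (Z -` {v} \<inter> space M) = 0 \<longrightarrow> Z a \<noteq> v"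
  proof (rule AE_finite_allI)
    show "finite (Z ` space M)" using Z by (rule simple_functionD)
    fix v
    have *: "Z -` {v} \<inter> space M \<in> sets M" using rv by (rule measurable_sets) simp
    show "AE a in M. measure M (Z -` {v} \<inter> space M) = 0 \<longrightarrow> Z a \<noteq> v"
    proof (cases "measure M (Z -` {v} \<inter> space M) = 0")
      case True
      then have "AE a in M. a \<notin> Z -` {v} \<inter> space M"
        using * by (subst prob_eq_0[symmetric]) auto
      then show ?thesis by (rule AE_mp) auto
    qed simp
  qed
  then have "AE a in M. measure M (Z -` {Z a} \<inter> space M) \<noteq> 0"
    by (rule AE_mp) auto
  then have "AE v in distr M (count_space UNIV) Z. measure (distr M (count_space UNIV) Z) {v} \<noteq> 0"
    using rv by (subst AE_distr_iff) (auto simp: measure_distr)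
  then show ?thesis
    unfolding law_def using rv by (intro Abs_pmf_inverse) (auto intro: prob_space_distr)
qed

lemma prob_law: "measure_pmf.prob (law M Z) A = measure M (Z -` A \<inter> space M)"
  unfolding measure_pmf_law using measurable_simple_function[OF Z] by (simp add: measure_distr)

lemma pmf_law: "pmf (law M Z) v = measure M (Z -` {v} \<inter> space M)"
  using prob_law[of "{v}"] by (simp add: measure_pmf_single)

lemma set_law: "set_pmf (law M Z) \<subseteq> Z ` space M"
proof
  fix v assume "v \<in> set_pmf (law M Z)"
  then have "measure M (Z -` {v} \<inter> space M) \<noteq> 0" by (simp add: set_pmf_iff pmf_law)
  then have "Z -` {v} \<inter> space M \<noteq> {}" by (metis measure_empty)
  then show "v \<in> Z ` space M" by auto
qed

lemma finite_law: "finite (set_pmf (law M Z))"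
  using set_law simple_functionD(1)[OF Z] finite_subset by blast

end

lemma law_comp:
  assumes M: "prob_space M" and Z: "simple_function M Z"
  shows "law M (\<lambda>a. f (Z a)) = map_pmf f (law M Z)"
proof (rule pmf_eqI)
  fix v
  have fZ: "simple_function M (\<lambda>a. f (Z a))" using simple_function_compose[OF Z, of f] by (simp add: comp_def)
  show "pmf (law M (\<lambda>a. f (Z a))) v = pmf (map_pmf f (law M Z)) v"
    unfolding pmf_law[OF M fZ] pmf_map prob_law[OF M Z] by (simp add: vimage_def)
qed

lemma simple_distributed_law:
  assumes "prob_space M" "simple_function M Z"
  shows "simple_distributed M Z (pmf (law M Z))"
  using assms by (intro prob_space.simple_distributedI) (auto simp: pmf_law)

lemma sum_law:
  assumes M: "prob_space M" and Z: "simple_function M Z"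
  shows "(\<Sum>v\<in>(\<lambda>a. h (Z a)) ` space M. pmf (law M (\<lambda>a. h (Z a))) v * F v) = measure_pmf.expectation (law M Z) (\<lambda>z. F (h z) :: real)"
proof -
  have hZ: "simple_function M (\<lambda>a. h (Z a))" using simple_function_compose[OF Z, of h] by (simp add: comp_def)
  have "measure_pmf.expectation (law M Z) (\<lambda>z. F (h z)) = measure_pmf.expectation (law M (\<lambda>a. h (Z a))) F"
    unfolding law_comp[OF M Z] by simp
  also have "\<dots> = (\<Sum>v\<in>(\<lambda>a. h (Z a)) ` space M. pmf (law M (\<lambda>a. h (Z a))) v * F v)"
    using simple_functionD(1)[OF hZ] set_law[OF M hZ]
    by (subst integral_measure_pmf_real) (auto simp: mult.commute)
  finally show ?thesis by simp
qed

section \<open>Information measures of simple functions expressed by \<open>ent\<close>\<close>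

context
  fixes M :: "'a measure" and Z :: "'a \<Rightarrow> 'z"
  assumes M: "prob_space M" and Z: "simple_function M Z"
begin

interpretation information_space M 2
  using M by (auto simp: information_space_def information_space_axioms_def)

lemma simple_function_comp: "simple_function M (\<lambda>a. h (Z a))"
  using simple_function_compose[OF Z, of h] by (simp add: comp_def)

lemma pmf_law_comp: "pmf (law M (\<lambda>a. h (Z a))) (h z) = pr (law M Z) h z"
  unfolding law_comp[OF M Z] by (simp add: pr_eq_pmf)

lemma shannon_entropy_law: "shannon_entropy M (\<lambda>a. f (Z a)) = ent (law M Z) f"
  unfolding shannon_entropy_def entropy_simple_distributed[OF simple_distributed_law[OF M simple_function_comp]]
  using sum_law[OF M Z, of f "\<lambda>v. log 2 (pmf (law M (\<lambda>a. f (Z a))) v)"] pmf_law_comp[of f]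
  by (simp add: ent_def info_def[abs_def])

lemma cond_entropy_law:
  "cond_entropy M (\<lambda>a. f (Z a)) (\<lambda>a. g (Z a)) = ent (law M Z) (\<lambda>z. (f z, g z)) - ent (law M Z) g"
proof -
  let ?p = "law M Z"
  note sd = simple_distributed_law[OF M simple_function_comp]
  have "cond_entropy M (\<lambda>a. f (Z a)) (\<lambda>a. g (Z a))
    = - measure_pmf.expectation ?p (\<lambda>z. log 2 (pr ?p (\<lambda>z. (f z, g z)) z / pr ?p g z))"
    unfolding cond_entropy_def conditional_entropy_eq[OF sd[of g] sd[of "\<lambda>z. (f z, g z)"]]
    using sum_law[OF M Z, of "\<lambda>z. (f z, g z)" "\<lambda>(x, y). log 2 (pmf (law M (\<lambda>a. (f (Z a), g (Z a)))) (x, y) / pmf (law M (\<lambda>a. g (Z a))) y)"]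
      pmf_law_comp[of "\<lambda>z. (f z, g z)"] pmf_law_comp[of g]
    by (simp add: case_prod_unfold)
  also have "\<dots> = measure_pmf.expectation ?p (\<lambda>z. info ?p (\<lambda>z. (f z, g z)) z - info ?p g z)"
    unfolding integral_minus[symmetric]
  proof (rule expectation_cong)
    fix z assume "z \<in> set_pmf ?p"
    note pos = pr_pos[OF this, of g] pr_pos[OF this, of "\<lambda>z. (f z, g z)"]
    show "- log 2 (pr ?p (\<lambda>z. (f z, g z)) z / pr ?p g z) = info ?p (\<lambda>z. (f z, g z)) z - info ?p g z"
      using pos by (simp add: info_def log_divide)
  qed
  finally show ?thesis using finite_law[OF M Z] by (simp add: ent_def)
qed

lemma cond_mutual_info_law:
  "cond_mutual_info M (\<lambda>a. f (Z a)) (\<lambda>a. g (Z a)) (\<lambda>a. h (Z a))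
    = ent (law M Z) (\<lambda>z. (f z, h z)) + ent (law M Z) (\<lambda>z. (g z, h z)) - ent (law M Z) (\<lambda>z. (f z, g z, h z)) - ent (law M Z) h"
proof -
  let ?p = "law M Z"
  let ?F = "\<lambda>(x, y, z). log 2 (pmf (law M (\<lambda>a. (f (Z a), g (Z a), h (Z a)))) (x, y, z)
     / (pmf (law M (\<lambda>a. (f (Z a), h (Z a)))) (x, z) * (pmf (law M (\<lambda>a. (g (Z a), h (Z a)))) (y, z) / pmf (law M (\<lambda>a. h (Z a))) z)))"
  note sd = simple_distributed_law[OF M simple_function_comp]
  have "cond_mutual_info M (\<lambda>a. f (Z a)) (\<lambda>a. g (Z a)) (\<lambda>a. h (Z a))
    = (\<Sum>v\<in>(\<lambda>a. (f (Z a), g (Z a), h (Z a))) ` space M. pmf (law M (\<lambda>a. (f (Z a), g (Z a), h (Z a)))) v * ?F v)"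
    unfolding cond_mutual_info_def
      conditional_mutual_information_eq[OF sd[of h] sd[of "\<lambda>z. (g z, h z)"] sd[of "\<lambda>z. (f z, h z)"] sd[of "\<lambda>z. (f z, g z, h z)"]]
    by (simp add: case_prod_unfold)
  also have "\<dots> = measure_pmf.expectation ?p (\<lambda>z. ?F (f z, g z, h z))"
    by (rule sum_law[OF M Z])
  also have "\<dots> = measure_pmf.expectation ?p (\<lambda>z. info ?p (\<lambda>z. (f z, h z)) z + info ?p (\<lambda>z. (g z, h z)) z
      - info ?p (\<lambda>z. (f z, g z, h z)) z - info ?p h z)"
  proof (rule expectation_cong)
    fix z assume "z \<in> set_pmf ?p"
    note pos = pr_pos[OF this, of h] pr_pos[OF this, of "\<lambda>z. (f z, h z)"] pr_pos[OF this, of "\<lambda>z. (g z, h z)"]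
       pr_pos[OF this, of "\<lambda>z. (f z, g z, h z)"]
    then show "?F (f z, g z, h z) = info ?p (\<lambda>z. (f z, h z)) z + info ?p (\<lambda>z. (g z, h z)) z
      - info ?p (\<lambda>z. (f z, g z, h z)) z - info ?p h z"
      using pmf_law_comp[of h z] pmf_law_comp[of "\<lambda>z. (f z, h z)" z] pmf_law_comp[of "\<lambda>z. (g z, h z)" z]
        pmf_law_comp[of "\<lambda>z. (f z, g z, h z)" z]
      by (simp add: info_def log_divide log_mult)
  qed
  finally show ?thesis using finite_law[OF M Z] by (simp add: ent_def)
qed

end

text \<open>Local variables live on arbitrary spaces, so independence comes from a vanishing
  Kullback-Leibler divergence; finiteness of \<open>mutual_info\<close> supplies the absolute
  continuity and integrability that this requires.\<close>

lemma mutual_info_eq_0_iff_distr: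
  assumes M: "prob_space M" and X: "X \<in> measurable M S" and Y: "Y \<in> measurable M T"
  shows "mutual_info M S T X Y = 0 \<longleftrightarrow> distr M (S \<Otimes>\<^sub>M T) (\<lambda>a. (X a, Y a)) = distr M S X \<Otimes>\<^sub>M distr M T Y"
proof -
  interpret prob_space M by fact
  let ?P = "distr M S X \<Otimes>\<^sub>M distr M T Y" and ?Q = "distr M (S \<Otimes>\<^sub>M T) (\<lambda>a. (X a, Y a))"
  interpret X: prob_space "distr M S X" using X by (rule prob_space_distr)
  interpret Y: prob_space "distr M T Y" using Y by (rule prob_space_distr)
  interpret XY: pair_prob_space "distr M S X" "distr M T Y" by standard
  interpret P: information_space ?P 2 by standard simp
  interpret Q: prob_space ?Q using X Y by (intro prob_space_distr) simp
  have sf: "sigma_finite_measure ?P" by unfold_locales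
  have KL: "prob_space.mutual_information M 2 S T X Y = KL_divergence 2 ?P ?Q"
    by (simp add: mutual_information_def)
  show ?thesis
  proof
    assume eq: "?Q = ?P"
    \<comment> \<open>The finite branch of \<open>mutual_info\<close> has to be entered: the density
      of a measure with respect to itself is 1, so its logarithm is 0 almost everywhere and
      integrable.\<close>
    have "AE z in ?P. 1 = RN_deriv ?P ?P z"
      by (rule sigma_finite_measure.RN_deriv_unique[OF sf]) (auto intro!: measure_eqI simp: emeasure_density)
    then have "AE z in ?P. entropy_density 2 ?P ?P z = 0"
      by (rule AE_mp) (auto simp: entropy_density_def)
    then have "integrable ?P (entropy_density 2 ?P ?P) \<longleftrightarrow> integrable ?P (\<lambda>_. 0 :: real)"
      by (intro integrable_cong_AE) auto
    moreover have "KL_divergence 2 ?P ?P = 0" by (rule sigma_finite_measure.KL_same_eq_0[OF sf])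
    ultimately show "mutual_info M S T X Y = 0"
      unfolding mutual_info_def Let_def KL unfolding eq by (simp add: absolutely_continuous_def zero_ereal_def)
  next
    assume "mutual_info M S T X Y = 0"
    then have "absolutely_continuous ?P ?Q" "integrable ?Q (entropy_density 2 ?P ?Q)" "KL_divergence 2 ?P ?Q = 0"
      unfolding mutual_info_def Let_def KL by (auto simp: zero_ereal_def split: if_splits)
    then show "?Q = ?P"
      by (intro P.KL_eq_0_iff_eq_ac[THEN iffD1] Q.prob_space_axioms) (auto simp: sets_pair_measure)
  qed
qed

lemma mutual_info_eq_0_iff:
  assumes M: "prob_space M" and X: "X \<in> measurable M S" and Y: "Y \<in> measurable M T"
  shows "mutual_info M S T X Y = 0 \<longleftrightarrow> (\<forall>A\<in>sets S. \<forall>B\<in>sets T.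
    measure M {a\<in>space M. X a \<in> A \<and> Y a \<in> B} = measure M {a\<in>space M. X a \<in> A} * measure M {a\<in>space M. Y a \<in> B})"
proof -
  interpret prob_space M by fact
  interpret X: prob_space "distr M S X" using X by (rule prob_space_distr)
  interpret Y: prob_space "distr M T Y" using Y by (rule prob_space_distr)
  let ?Q = "distr M (S \<Otimes>\<^sub>M T) (\<lambda>a. (X a, Y a))"
  have Q: "measure ?Q (A \<times> B) = measure M {a\<in>space M. X a \<in> A \<and> Y a \<in> B}"
    and e: "emeasure ?Q (A \<times> B) = ennreal (measure M {a\<in>space M. X a \<in> A \<and> Y a \<in> B})"
    if "A \<in> sets S" "B \<in> sets T" for A B
  proof -
    have "(\<lambda>a. (X a, Y a)) -` (A \<times> B) \<inter> space M = {a\<in>space M. X a \<in> A \<and> Y a \<in> B}" by auto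
    then show "measure ?Q (A \<times> B) = measure M {a\<in>space M. X a \<in> A \<and> Y a \<in> B}"
      "emeasure ?Q (A \<times> B) = ennreal (measure M {a\<in>space M. X a \<in> A \<and> Y a \<in> B})"
      using that X Y by (auto simp: measure_distr emeasure_distr emeasure_eq_measure)
  qed
  have XA: "emeasure (distr M S X) A = ennreal (measure M {a\<in>space M. X a \<in> A})" if "A \<in> sets S" for A
    using that X by (simp add: emeasure_distr emeasure_eq_measure vimage_def Int_def conj_commute)
  have YB: "emeasure (distr M T Y) B = ennreal (measure M {a\<in>space M. Y a \<in> B})" if "B \<in> sets T" for B
    using that Y by (simp add: emeasure_distr emeasure_eq_measure vimage_def Int_def conj_commute)
  show ?thesis
    unfolding mutual_info_eq_0_iff_distr[OF M X Y]
  proof (intro iffI ballI)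
    fix A B assume eq: "?Q = distr M S X \<Otimes>\<^sub>M distr M T Y" and AB: "A \<in> sets S" "B \<in> sets T"
    have "emeasure ?Q (A \<times> B) = emeasure (distr M S X) A * emeasure (distr M T Y) B"
      unfolding eq using AB by (intro Y.emeasure_pair_measure_Times) auto
    then show "measure M {a\<in>space M. X a \<in> A \<and> Y a \<in> B} = measure M {a\<in>space M. X a \<in> A} * measure M {a\<in>space M. Y a \<in> B}"
      unfolding e[OF AB] XA[OF AB(1)] YB[OF AB(2)] by (simp add: ennreal_mult[symmetric])
  next
    assume *: "\<forall>A\<in>sets S. \<forall>B\<in>sets T.
      measure M {a\<in>space M. X a \<in> A \<and> Y a \<in> B} = measure M {a\<in>space M. X a \<in> A} * measure M {a\<in>space M. Y a \<in> B}"
    have "distr M S X \<Otimes>\<^sub>M distr M T Y = ?Q"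
    proof (rule pair_measure_eqI)
      fix A B assume "A \<in> sets (distr M S X)" "B \<in> sets (distr M T Y)"
      then have AB: "A \<in> sets S" "B \<in> sets T" by simp_all
      show "emeasure (distr M S X) A * emeasure (distr M T Y) B = emeasure ?Q (A \<times> B)"
        unfolding e[OF AB] XA[OF AB(1)] YB[OF AB(2)] using * AB by (simp add: ennreal_mult[symmetric])
    qed (auto simp: X.sigma_finite_measure_axioms Y.sigma_finite_measure_axioms sets_pair_measure)
    then show "?Q = distr M S X \<Otimes>\<^sub>M distr M T Y" by simp
  qed
qed

section \<open>Total variation distance: \<open>tv_dist\<close> against \<open>close\<close>\<close>

lemma tv_dist_bounds:
  assumes P: "prob_space P" and Q: "prob_space Q"
  shows "bdd_above ((\<lambda>A. \<bar>measure P A - measure Q A\<bar>) ` sets P)" "0 \<le> tv_dist P Q" "tv_dist P Q \<le> 1"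
proof -
  have *: "\<bar>measure P A - measure Q A\<bar> \<le> 1" for A
    using prob_space.prob_le_1[OF P, of A] prob_space.prob_le_1[OF Q, of A] measure_nonneg[of P A] measure_nonneg[of Q A]
    by linarith
  then show bdd: "bdd_above ((\<lambda>A. \<bar>measure P A - measure Q A\<bar>) ` sets P)" by (intro bdd_aboveI[of _ 1]) auto
  show "0 \<le> tv_dist P Q"
    unfolding tv_dist_def by (rule cSUP_upper2[OF bdd, of "{}"]) auto
  show "tv_dist P Q \<le> 1"
    unfolding tv_dist_def using * by (intro cSUP_least) auto
qed

lemma close_tv_dist:
  assumes "prob_space P" "prob_space Q" and S: "sets P = Pow S"
    and p: "\<And>A. A \<subseteq> S \<Longrightarrow> measure P A = measure_pmf.prob p A" "set_pmf p \<subseteq> S"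
    and q: "\<And>A. A \<subseteq> S \<Longrightarrow> measure Q A = measure_pmf.prob q A" "set_pmf q \<subseteq> S"
  shows "close (tv_dist P Q) p q"
  unfolding close_def
proof
  fix A
  have "measure_pmf.prob p A = measure_pmf.prob p (A \<inter> S)" "measure_pmf.prob q A = measure_pmf.prob q (A \<inter> S)"
    using p(2) q(2) by (auto intro!: measure_pmf.finite_measure_eq_AE AE_pmfI)
  moreover have "\<bar>measure P (A \<inter> S) - measure Q (A \<inter> S)\<bar> \<le> tv_dist P Q"
    unfolding tv_dist_def using S by (intro cSUP_upper tv_dist_bounds(1) assms) auto
  ultimately show "measure_pmf.prob p A \<le> measure_pmf.prob q A + tv_dist P Q"
    using p(1)[of "A \<inter> S"] q(1)[of "A \<inter> S"] by (simp add: abs_le_iff)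
qed

lemma tv_dist_le:
  assumes S: "sets P = Pow S"
    and p: "\<And>A. A \<subseteq> S \<Longrightarrow> measure P A = measure_pmf.prob p A"
    and q: "\<And>A. A \<subseteq> S \<Longrightarrow> measure Q A = measure_pmf.prob q A"
    and c: "close e p q"
  shows "tv_dist P Q \<le> e"
  unfolding tv_dist_def S
proof (rule cSUP_least)
  fix A assume "A \<in> Pow S"
  then show "\<bar>measure P A - measure Q A\<bar> \<le> e"
    using p q c close_sym[OF c] by (auto simp: close_def abs_le_iff algebra_simps)
qed auto

section \<open>Causal models with a fixed order of the parties\<close>

lemma simple_function_of_finite:
  assumes "f \<in> measurable M (count_space A)" "finite A"
  shows "simple_function M f"
  unfolding simple_function_def
proof
  have A: "f ` space M \<subseteq> A" using measurable_space[OF assms(1)] by auto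
  then show "finite (f ` space M)" using assms(2) finite_subset by blast
  show "\<forall>x\<in>f ` space M. f -` {x} \<inter> space M \<in> sets M"
    using A by (auto intro!: measurable_sets[OF assms(1)])
qed

lemma finite_pairs: "finite (pairs m)"
  by (rule finite_subset[of _ "Pow {1..m}"]) (auto simp: pairs_def)

text \<open>Causal models are indexed by parties, assignments by positions in the order
  \<open>\<iota>\<close>: party \<open>\<iota> p\<close> stands at position \<open>p\<close>. The
  locale translates between the two.\<close>

locale ordered_model =
  fixes m n :: nat and \<X> :: "nat \<Rightarrow> 'x set" and G :: "'x causal_model" and \<iota> :: "nat \<Rightarrow> nat"
  assumes model: "is_causal_model m n \<X> G" and perm: "\<iota> permutes {1..m}"
    and fin\<X>: "\<And>i. i \<in> {1..m} \<Longrightarrow> finite (\<X> i)"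
begin

abbreviation "S \<equiv> sample G"
abbreviation "pos \<equiv> inv \<iota>"
abbreviation "pedge p q \<equiv> {\<iota> p, \<iota> q}"

lemma prob_S: "prob_space S" and prob_theta: "prob_space (theta_space G)"
  using model by (auto simp: is_causal_model_def)

lemma iota_pos [simp]: "\<iota> (pos i) = i" and pos_iota [simp]: "pos (\<iota> p) = p"
  using permutes_inverses[OF perm] by auto

lemma iota_in [simp]: "\<iota> p \<in> {1..m} \<longleftrightarrow> p \<in> {1..m}" and pos_in [simp]: "pos i \<in> {1..m} \<longleftrightarrow> i \<in> {1..m}"
  using permutes_in_image[OF perm] permutes_in_image[OF permutes_inv[OF perm]] by auto

lemma iota_eq [simp]: "\<iota> p = \<iota> q \<longleftrightarrow> p = q" and pos_eq [simp]: "pos i = pos j \<longleftrightarrow> i = j"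
  by (metis pos_iota) (metis iota_pos)

lemma pos_eq_iff: "pos j = p \<longleftrightarrow> j = \<iota> p"
  by auto

lemma iota_in' [simp]: "Suc 0 \<le> \<iota> p \<and> \<iota> p \<le> m \<longleftrightarrow> Suc 0 \<le> p \<and> p \<le> m"
  and pos_in' [simp]: "Suc 0 \<le> pos i \<and> pos i \<le> m \<longleftrightarrow> Suc 0 \<le> i \<and> i \<le> m"
  using iota_in pos_in by auto

lemma pedge_in: "p \<in> {1..m} \<Longrightarrow> q \<in> {1..m} \<Longrightarrow> p \<noteq> q \<Longrightarrow> pedge p q \<in> pairs m"
  unfolding pairs_def by (intro CollectI exI[of _ "\<iota> p"] exI[of _ "\<iota> q"]) simp

lemma edge_pedge: "(p, q) \<in> edges m \<Longrightarrow> pedge p q \<in> pairs m"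
  by (rule pedge_in) (auto simp: edges_def)

lemma pairs_eq: "pairs m = (\<lambda>(p, q). pedge p q) ` edges m"
proof (intro equalityI subsetI)
  fix e assume "e \<in> pairs m"
  then obtain i j where "i \<in> {1..m}" "j \<in> {1..m}" "i \<noteq> j" "e = {i, j}" by (auto simp: pairs_def)
  then obtain p q where e: "p \<in> {1..m}" "q \<in> {1..m}" "p \<noteq> q" "e = pedge p q"
    by (metis iota_pos pos_in)
  then consider "p < q" | "q < p" by linarith
  then show "e \<in> (\<lambda>(p, q). pedge p q) ` edges m"
  proof cases
    case 1
    with e have "(p, q) \<in> edges m" by (simp add: edges_def)
    with e show ?thesis by force
  next
    case 2
    with e have "(q, p) \<in> edges m" by (simp add: edges_def)
    with e show ?thesis by (force simp: insert_commute)
  qed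
qed (auto intro: edge_pedge)

lemma inj_pedge: "inj_on (\<lambda>(p, q). pedge p q) (edges m)"
  by (auto simp: inj_on_def edges_def doubleton_eq_iff)

lemma sum_pairs: "(\<Sum>e\<in>pairs m. f e) = (\<Sum>(p, q)\<in>edges m. f (pedge p q) :: real)"
  unfolding pairs_eq by (subst sum.reindex[OF inj_pedge]) (auto simp: case_prod_unfold)

definition Lat :: "real \<Rightarrow> nat set \<Rightarrow> nat" where
  "Lat a = (\<lambda>e\<in>pairs m. latent G e a)"

definition arr :: "(nat set \<Rightarrow> nat) \<Rightarrow> nat \<Rightarrow> nat \<Rightarrow> nat" where
  "arr F = canon m (\<lambda>p q. F (pedge p q))"

definition W :: "real \<Rightarrow> nat \<Rightarrow> nat \<Rightarrow> nat" where
  "W a = arr (Lat a)"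

text \<open>What position \<open>p\<close> sees, re-indexed by parties as the structural equations
  expect it.\<close>

definition lab :: "nat \<Rightarrow> (nat \<Rightarrow> nat) \<Rightarrow> nat \<Rightarrow> nat" where
  "lab p v = (\<lambda>j\<in>{1..m} - {\<iota> p}. v (pos j))"

definition P :: "(nat \<Rightarrow> nat \<Rightarrow> nat) pmf" where
  "P = law S W"

lemma finite_alph: "e \<in> pairs m \<Longrightarrow> finite (latent_alph G e)"
  and latent_measurable: "e \<in> pairs m \<Longrightarrow> latent G e \<in> measurable S (count_space (latent_alph G e))"
  using model by (auto simp: is_causal_model_def)

lemma Lat_measurable: "Lat \<in> measurable S (PiM (pairs m) (\<lambda>e. count_space (latent_alph G e)))"
  unfolding Lat_def by (intro measurable_restrict latent_measurable)

lemma PiM_alph: "PiM (pairs m) (\<lambda>e. count_space (latent_alph G e)) = count_space (PiE (pairs m) (latent_alph G))"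
  by (rule count_space_PiM_finite) (auto simp: finite_pairs finite_alph countable_finite)

lemma finite_PiE_alph: "finite (PiE (pairs m) (latent_alph G))"
  by (intro finite_PiE finite_pairs finite_alph)

lemma simple_Lat: "simple_function S Lat"
  using Lat_measurable unfolding PiM_alph by (rule simple_function_of_finite[OF _ finite_PiE_alph])

lemma simple_W: "simple_function S W"
  unfolding W_def[abs_def] using simple_function_compose[OF simple_Lat, of arr] by (simp add: comp_def)

lemma Lat_in: "a \<in> space S \<Longrightarrow> Lat a \<in> PiE (pairs m) (latent_alph G)"
  using measurable_space[OF Lat_measurable] unfolding PiM_alph by auto

lemma W_entry: "(p, q) \<in> edges m \<Longrightarrow> W a p q = latent G (pedge p q) a"
  by (simp add: W_def arr_def canon_def Lat_def edge_pedge)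

lemma canon_W: "canon m (W a) = W a"
  by (simp add: W_def arr_def canon_def fun_eq_iff)

lemma view_W: "p \<in> {1..m} \<Longrightarrow> q \<in> {1..m} \<Longrightarrow> q \<noteq> p \<Longrightarrow> view m p (W a) q = latent G (pedge p q) a"
  using W_entry[of p q a] W_entry[of q p a] by (auto simp: view_def edges_def insert_commute)

lemma neighbours_eq: "p \<in> {1..m} \<Longrightarrow> neighbours m G (\<iota> p) a = lab p (view m p (W a))"
proof
  fix j assume p: "p \<in> {1..m}"
  show "neighbours m G (\<iota> p) a j = lab p (view m p (W a)) j"
    using view_W[OF p, of "pos j" a] by (auto simp: neighbours_def lab_def pos_eq_iff)
qed

lemma lab_inj:
  assumes p: "p \<in> {1..m}"
  shows "lab p (view m p s) = lab p (view m p s') \<longleftrightarrow> view m p s = view m p s'"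
proof
  assume eq: "lab p (view m p s) = lab p (view m p s')"
  have "view m p s q = view m p s' q" if q: "q \<in> {1..m} - {p}" for q
  proof -
    have "\<iota> q \<in> {1..m} - {\<iota> p}" using q iota_in[of q] by auto
    then show ?thesis using fun_cong[OF eq, of "\<iota> q"] by (simp add: lab_def)
  qed
  note * = this
  show "view m p s = view m p s'"
  proof
    fix q
    show "view m p s q = view m p s' q"
    proof (cases "q \<in> {1..m} - {p}")
      case False
      then show ?thesis unfolding view_def by (simp only: restrict_def if_False)
    qed (rule *)
  qed
qed simp

lemma finite_P: "finite (set_pmf P)"
  unfolding P_def by (rule finite_law[OF prob_S simple_W])

lemma set_P: "w \<in> set_pmf P \<Longrightarrow> \<exists>a\<in>space S. w = W a"
  unfolding P_def using set_law[OF prob_S simple_W] by auto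

lemma canon_P: "w \<in> set_pmf P \<Longrightarrow> canon m w = w"
  using set_P canon_W by metis

text \<open>The condition for \<open>i\<close> is \<open>markov\<close> at vertex
  \<open>i + 1\<close>: the neighbourhoods of the first \<open>i\<close> parties carry the same
  information as \<open>rows m i\<close>, and these rows determine
  \<open>lo (i + 1)\<close>.\<close>

lemma latents_ordered_iff_markov: "latents_ordered m \<iota> G \<longleftrightarrow> markov m P"
proof -
  have "cond_mutual_info S (\<lambda>a. \<lambda>k\<in>{1..i}. neighbours m G (\<iota> k) a) (\<lambda>a. \<lambda>k\<in>{i+2..m}. latent G {\<iota> (i+1), \<iota> k} a)
        (\<lambda>a. \<lambda>k\<in>{1..i}. latent G {\<iota> k, \<iota> (i+1)} a)
     = ent P (rows m i) + ent P (view m (i + 1)) - ent P (rows m (i + 1)) - ent P (lo (i + 1))"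
    if i: "i \<in> {1..<m}" for i
  proof -
    let ?f = "\<lambda>w. \<lambda>k\<in>{1..i}. lab k (view m k w)"
    have i': "i + 1 \<in> {1..m}" using i by simp
    have f: "(\<lambda>k\<in>{1..i}. neighbours m G (\<iota> k) a) = ?f (W a)" for a
      using i by (auto simp: neighbours_eq cong: restrict_cong)
    have g: "(\<lambda>k\<in>{i+2..m}. latent G {\<iota> (i+1), \<iota> k} a) = row (i + 1) m (W a)" for a
      using i by (auto simp: row_def W_entry edges_def fun_eq_iff)
    have h: "(\<lambda>k\<in>{1..i}. latent G {\<iota> k, \<iota> (i+1)} a) = lo (i + 1) (W a)" for a
      using i by (auto simp: col_def W_entry edges_def fun_eq_iff)
    have f_iff: "?f w = ?f w' \<longleftrightarrow> rows m i w = rows m i w'" for w w'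
    proof -
      have "?f w = ?f w' \<longleftrightarrow> (\<forall>k\<in>{1..i}. view m k w = view m k w')"
        using i lab_inj by (auto simp: restrict_eq_iff)
      also have "\<dots> \<longleftrightarrow> rows m i w = rows m i w'"
        using i by (auto simp: view_eq_iff rows_eq_iff col_eq_iff row_eq_iff)
      finally show ?thesis .
    qed
    have lo: "rows m i w = rows m i w' \<Longrightarrow> lo (i + 1) w = lo (i + 1) w'" for w w'
      using i by (auto simp: rows_eq_iff col_eq_iff)
    have rows: "rows m (i + 1) w = rows m (i + 1) w' \<longleftrightarrow> rows m i w = rows m i w' \<and> row (i + 1) m w = row (i + 1) m w'" for w w'
      using i by (auto simp: rows_eq_iff row_eq_iff le_Suc_eq)
    have "cond_mutual_info S (\<lambda>a. ?f (W a)) (\<lambda>a. row (i + 1) m (W a)) (\<lambda>a. lo (i + 1) (W a))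
      = ent P (\<lambda>w. (?f w, lo (i + 1) w)) + ent P (\<lambda>w. (row (i + 1) m w, lo (i + 1) w))
        - ent P (\<lambda>w. (?f w, row (i + 1) m w, lo (i + 1) w)) - ent P (lo (i + 1))"
      unfolding P_def by (rule cond_mutual_info_law[OF prob_S simple_W])
    also have "ent P (\<lambda>w. (?f w, lo (i + 1) w)) = ent P (rows m i)"
      by (intro ent_cong determinesI) (use f_iff lo in auto)
    also have "ent P (\<lambda>w. (row (i + 1) m w, lo (i + 1) w)) = ent P (view m (i + 1))"
      by (intro ent_cong determinesI) (use i in \<open>auto simp: view_eq_iff\<close>)
    also have "ent P (\<lambda>w. (?f w, row (i + 1) m w, lo (i + 1) w)) = ent P (rows m (i + 1))"
      by (intro ent_cong determinesI; simp only: prod.inject f_iff rows; use lo in blast)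
    finally show ?thesis unfolding f g h .
  qed
  then have "latents_ordered m \<iota> G \<longleftrightarrow> (\<forall>i\<in>{1..<m}. ent P (rows m (i + 1)) + ent P (lo (i + 1)) = ent P (rows m i) + ent P (view m (i + 1)))"
    by (auto simp: latents_ordered_def)
  also have "\<dots> \<longleftrightarrow> markov m P"
  proof
    assume *: "\<forall>i\<in>{1..<m}. ent P (rows m (i + 1)) + ent P (lo (i + 1)) = ent P (rows m i) + ent P (view m (i + 1))"
    show "markov m P"
      unfolding markov_def
    proof
      fix p assume p: "p \<in> {1..m}"
      show "ent P (rows m p) + ent P (lo p) = ent P (rows m (p - 1)) + ent P (view m p)"
      \<comment> \<open>The first vertex has no counterpart among the conditions; there
        \<open>lo p\<close> and \<open>rows m (p - 1)\<close> are constant.\<close>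
      proof (cases "p = 1")
        case True
        have "ent P (lo p) = 0" "ent P (rows m (p - 1)) = 0"
          using True by (auto intro!: ent_const determinesI simp: col_eq_iff rows_eq_iff)
        moreover have "ent P (rows m p) = ent P (view m p)"
          by (intro ent_cong determinesI) (use True p in \<open>auto simp: view_eq_iff rows_eq_iff row_eq_iff col_eq_iff\<close>)
        ultimately show ?thesis by simp
      next
        case False
        then obtain i where "p = i + 1" "i \<in> {1..<m}" using p that[of "p - 1"] by force
        then show ?thesis using * by simp
      qed
    qed
  next
    assume *: "markov m P"
    show "\<forall>i\<in>{1..<m}. ent P (rows m (i + 1)) + ent P (lo (i + 1)) = ent P (rows m i) + ent P (view m (i + 1))"
    proof
      fix i assume "i \<in> {1..<m}"
      then show "ent P (rows m (i + 1)) + ent P (lo (i + 1)) = ent P (rows m i) + ent P (view m (i + 1))"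
        using *[unfolded markov_def, rule_format, of "i + 1"] by simp
    qed
  qed
  finally show ?thesis .
qed

lemma sum_ent_edges_le: "(\<Sum>(p, q)\<in>edges m. ent P (\<lambda>w. w p q)) \<le> (\<Sum>e\<in>pairs m. log 2 (card (latent_alph G e)))"
  unfolding sum_pairs
proof (intro sum_mono, clarify)
  fix p q assume e: "(p, q) \<in> edges m"
  have "set_pmf (map_pmf (\<lambda>w. w p q) P) \<subseteq> latent_alph G (pedge p q)"
    using set_P W_entry[OF e] measurable_space[OF latent_measurable[OF edge_pedge[OF e]]] by fastforce
  then show "ent P (\<lambda>w. w p q) \<le> log 2 (card (latent_alph G (pedge p q)))"
    unfolding ent_eq_ent_id[of P] by (intro ent_le_log_card finite_alph edge_pedge e)
qed

end

subsection \<open>The joint distribution for fixed structural equations\<close>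

lemma count_space_PiM:
  assumes "finite I" "\<And>i. i \<in> I \<Longrightarrow> countable (A i)"
  shows "PiM I (\<lambda>i. count_space (A i)) = count_space (PiE I A)"
proof -
  let ?A = "\<lambda>i. if i \<in> I then A i else {}"
  have "PiM I (\<lambda>i. count_space (A i)) = PiM I (\<lambda>i. count_space (?A i))" by (intro PiM_cong) auto
  also have "\<dots> = count_space (PiE I ?A)" using assms by (intro count_space_PiM_finite) auto
  also have "PiE I ?A = PiE I A" by (intro PiE_cong) auto
  finally show ?thesis .
qed

text \<open>The index sets no longer depend on \<open>p\<close>, so entropy becomes a measurable
  function of the point masses and hence of the choice of structural equations.\<close>

lemma ent_finite_superset:
  assumes "finite A" "set_pmf p \<subseteq> A"
  shows "ent p f = (\<Sum>x\<in>A. - pmf p x * log 2 (\<Sum>y\<in>{y\<in>A. f y = f x}. pmf p y))"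
proof -
  have "pr p f x = (\<Sum>y\<in>{y\<in>A. f y = f x}. pmf p y)" for x
  proof -
    have "pr p f x = measure_pmf.prob p {y\<in>A. f y = f x}"
      unfolding pr_def using assms(2) by (intro measure_pmf.finite_measure_eq_AE AE_pmfI) auto
    then show ?thesis using assms(1) by (simp add: measure_measure_pmf_finite)
  qed
  then show ?thesis
    unfolding ent_def info_def using assms by (subst integral_measure_pmf_real[of A]) (auto simp: mult.commute)
qed

locale causal_network = ordered_model +
  assumes m: "m \<ge> 1" and indep: "sources_independent m G"
begin

definition views :: "nat \<Rightarrow> (nat \<Rightarrow> nat) set" where
  "views p = PiE ({1..m} - {p}) (\<lambda>q. latent_alph G (pedge p q))"

definition blk :: "nat \<Rightarrow> (nat \<Rightarrow> 'a) set" where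
  "blk p = block_alph n \<X> (\<iota> p)"

text \<open>The output that position \<open>p\<close> would produce from the view \<open>v\<close>:
  for fixed \<open>t\<close> and \<open>v\<close> a function of the local variable alone.\<close>

definition out :: "real \<Rightarrow> nat \<Rightarrow> (nat \<Rightarrow> nat) \<Rightarrow> real \<Rightarrow> nat \<Rightarrow> 'a" where
  "out t p v a = struct_eq G t (\<iota> p) (lab p v) (loc G (\<iota> p) a)"

text \<open>The choice of a valid view is needed only for arguments that never occur.\<close>

definition valid :: "nat \<Rightarrow> (nat \<Rightarrow> nat) \<Rightarrow> nat \<Rightarrow> nat" where
  "valid p v = (if v \<in> views p then v else SOME v. v \<in> views p)"

definition K :: "real \<Rightarrow> nat \<Rightarrow> (nat \<Rightarrow> nat) \<Rightarrow> (nat \<Rightarrow> 'a) pmf" where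
  "K t p v = law S (out t p (valid p v))"

definition X :: "real \<Rightarrow> real \<Rightarrow> nat \<Rightarrow> nat \<Rightarrow> 'a" where
  "X t a = (\<lambda>p\<in>{1..m}. observed m G t (\<iota> p) a)"

definition Lc :: "real \<Rightarrow> nat \<Rightarrow> real" where
  "Lc a = (\<lambda>i\<in>{1..m}. loc G i a)"

lemma view_in: "a \<in> space S \<Longrightarrow> p \<in> {1..m} \<Longrightarrow> view m p (W a) \<in> views p"
  unfolding views_def
proof (rule PiE_I)
  fix q assume a: "a \<in> space S" and p: "p \<in> {1..m}" and q: "q \<in> {1..m} - {p}"
  then have "pedge p q \<in> pairs m" by (intro pedge_in) auto
  from measurable_space[OF latent_measurable[OF this] a]
  show "view m p (W a) q \<in> latent_alph G (pedge p q)" using p q by (simp add: view_W)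
qed (simp only: view_def restrict_def if_False)

lemma valid_in: "p \<in> {1..m} \<Longrightarrow> valid p v \<in> views p"
proof -
  assume p: "p \<in> {1..m}"
  obtain a where "a \<in> space S" using prob_space.not_empty[OF prob_S] by auto
  then have "view m p (W a) \<in> views p" by (rule view_in[OF _ p])
  then have "(SOME v. v \<in> views p) \<in> views p" by (rule someI[of "\<lambda>v. v \<in> views p"])
  then show ?thesis by (simp add: valid_def)
qed

lemma lab_in:
  assumes "v \<in> views p" "p \<in> {1..m}"
  shows "lab p v \<in> PiE ({1..m} - {\<iota> p}) (\<lambda>j. latent_alph G {\<iota> p, j})"
proof (rule PiE_I)
  fix j assume j: "j \<in> {1..m} - {\<iota> p}"
  then have "pos j \<in> {1..m} - {p}" by (auto simp: pos_eq_iff)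
  then have "v (pos j) \<in> latent_alph G (pedge p (pos j))" by (rule PiE_mem[OF assms(1)[unfolded views_def]])
  then show "lab p v j \<in> latent_alph G {\<iota> p, j}" using j by (simp add: lab_def)
qed (simp only: lab_def restrict_def if_False)

lemma finite_blk: "p \<in> {1..m} \<Longrightarrow> finite (blk p)"
  unfolding blk_def block_alph_def by (intro finite_PiE fin\<X>) auto

lemma finite_views: "p \<in> {1..m} \<Longrightarrow> finite (views p)"
  unfolding views_def by (intro finite_PiE finite_alph pedge_in) auto

lemma struct_measurable:
  "p \<in> {1..m} \<Longrightarrow> v \<in> views p \<Longrightarrow>
    (\<lambda>(t, u). struct_eq G t (\<iota> p) (lab p v) u) \<in> measurable (theta_space G \<Otimes>\<^sub>M loc_space G (\<iota> p)) (count_space (blk p))"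
proof -
  assume p: "p \<in> {1..m}" and v: "v \<in> views p"
  have "\<forall>i\<in>{1..m}. \<forall>w\<in>PiE ({1..m} - {i}) (\<lambda>j. latent_alph G {i, j}). (\<lambda>(t, v). struct_eq G t i w v)
      \<in> measurable (theta_space G \<Otimes>\<^sub>M loc_space G i) (count_space (block_alph n \<X> i))"
    using model unfolding is_causal_model_def by (elim conjE)
  then show ?thesis unfolding blk_def using p lab_in[OF v p] iota_in[of p] by (elim ballE[of _ _ "\<iota> p"] ballE[of _ _ "lab p v"]; simp)
qed

lemma indep_loc: "prob_space.indep_vars S (loc_space G) (loc G) {1..m}"
  using model by (simp add: is_causal_model_def)

lemma loc_measurable: "i \<in> {1..m} \<Longrightarrow> loc G i \<in> measurable S (loc_space G i)"
  using indep_loc unfolding prob_space.indep_vars_def[OF prob_S] by auto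

lemma Lc_measurable: "Lc \<in> measurable S (PiM {1..m} (loc_space G))"
  unfolding Lc_def by (intro measurable_restrict loc_measurable)

lemma prob_Lat_Lc:
  assumes "A \<in> sets (PiM (pairs m) (\<lambda>e. count_space (latent_alph G e)))" "B \<in> sets (PiM {1..m} (loc_space G))"
  shows "measure S {a\<in>space S. Lat a \<in> A \<and> Lc a \<in> B} = measure S {a\<in>space S. Lat a \<in> A} * measure S {a\<in>space S. Lc a \<in> B}"
  using indep mutual_info_eq_0_iff[OF prob_S Lat_measurable Lc_measurable] assms
  unfolding sources_independent_def Lat_def[abs_def] Lc_def[abs_def] by blast

context
  fixes t assumes t: "t \<in> space (theta_space G)"
begin

lemma out_measurable: "p \<in> {1..m} \<Longrightarrow> v \<in> views p \<Longrightarrow> out t p v \<in> measurable S (count_space (blk p))"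
proof -
  assume p: "p \<in> {1..m}" and v: "v \<in> views p"
  have "loc G (\<iota> p) \<in> measurable S (loc_space G (\<iota> p))" using p by (intro loc_measurable) simp
  then have "(\<lambda>a. (t, loc G (\<iota> p) a)) \<in> measurable S (theta_space G \<Otimes>\<^sub>M loc_space G (\<iota> p))"
    by (intro measurable_Pair measurable_const t)
  from measurable_compose[OF this struct_measurable[OF p v]] show ?thesis by (simp add: out_def[abs_def])
qed

lemma simple_out: "p \<in> {1..m} \<Longrightarrow> v \<in> views p \<Longrightarrow> simple_function S (out t p v)"
  by (rule simple_function_of_finite[OF out_measurable finite_blk])

lemma set_K: "p \<in> {1..m} \<Longrightarrow> set_pmf (K t p v) \<subseteq> blk p"
  using set_law[OF prob_S simple_out[OF _ valid_in]] measurable_space[OF out_measurable[OF _ valid_in]]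
  unfolding K_def by fastforce

lemma observed_eq: "p \<in> {1..m} \<Longrightarrow> observed m G t (\<iota> p) a = out t p (view m p (W a)) a"
  by (simp add: observed_def neighbours_eq out_def)

text \<open>Structural equations are measurable for each fixed view; as the view takes finitely many
  values, the pieces combine.\<close>

lemma observed_measurable:
  assumes p: "p \<in> {1..m}"
  shows "(\<lambda>a. observed m G t (\<iota> p) a) \<in> measurable S (count_space (blk p))"
  unfolding observed_eq[OF p]
proof (rule measurable_compose_countable'[where I = "views p" and f = "out t p" and g = "\<lambda>a. view m p (W a)"])
  have "simple_function S (\<lambda>a. view m p (W a))"
    using simple_function_compose[OF simple_W, of "view m p"] by (simp add: comp_def)
  then have "(\<lambda>a. view m p (W a)) \<in> measurable S (count_space UNIV)"
    by (rule measurable_simple_function)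
  then have "(\<lambda>a. view m p (W a)) -` {v} \<inter> space S \<in> sets S" for v
    by (rule measurable_sets) simp
  then show "(\<lambda>a. view m p (W a)) \<in> measurable S (count_space (views p))"
    unfolding measurable_count_space_eq2[OF finite_views[OF p]] using view_in[OF _ p] by blast
  show "countable (views p)" using finite_views[OF p] by (rule countable_finite)
  show "out t p v \<in> measurable S (count_space (blk p))" if "v \<in> views p" for v
    by (rule out_measurable[OF p that])
qed

lemma simple_X: "simple_function S (X t)"
proof (rule simple_function_of_finite)
  have "X t \<in> measurable S (PiM {1..m} (\<lambda>p. count_space (blk p)))"
    unfolding X_def by (intro measurable_restrict observed_measurable)
  also have "PiM {1..m} (\<lambda>p. count_space (blk p)) = count_space (PiE {1..m} blk)"
    by (intro count_space_PiM countable_finite finite_blk finite_atLeastAtMost)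
  finally show "X t \<in> measurable S (count_space (PiE {1..m} blk))" .
qed (auto intro!: finite_PiE finite_blk)

lemma simple_WX: "simple_function S (\<lambda>a. (W a, X t a))"
  by (intro simple_function_Pair simple_W simple_X)

lemma pmf_K: "p \<in> {1..m} \<Longrightarrow> v \<in> views p \<Longrightarrow> pmf (K t p v) y = measure S (out t p v -` {y} \<inter> space S)"
  unfolding K_def using pmf_law[OF prob_S simple_out] by (simp add: valid_def)

text \<open>For fixed structural equations and a given assignment of the edges, prescribing all
  outputs is a condition on each local variable separately. Latent and local variables are
  independent, and so are the local variables among each other, which gives the product of the
  channels.\<close>

lemma law_WX: "law S (\<lambda>a. (W a, X t a)) = network m P (K t)"
proof (rule pmf_eqI)
  fix z :: "(nat \<Rightarrow> nat \<Rightarrow> nat) \<times> (nat \<Rightarrow> nat \<Rightarrow> 'a)"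
  obtain w x where z: "z = (w, x)" by fastforce
  interpret prob_space S by (rule prob_S)
  have L: "pmf (law S (\<lambda>a. (W a, X t a))) (w, x) = prob {a\<in>space S. W a = w \<and> X t a = x}"
    unfolding pmf_law[OF prob_S simple_WX] by (intro arg_cong[where f = prob]) auto
  have mW: "{a\<in>space S. W a = w} = W -` {w} \<inter> space S" by auto
  have setsW: "{a\<in>space S. W a = w} \<in> events"
    unfolding mW using measurable_simple_function[OF simple_W] by (rule measurable_sets) simp
  have Pw: "pmf P w = prob {a\<in>space S. W a = w}" unfolding P_def pmf_law[OF prob_S simple_W] mW ..
  show "pmf (law S (\<lambda>a. (W a, X t a))) z = pmf (network m P (K t)) z"
    unfolding z L pmf_network
  \<comment> \<open>Outside the support a view of \<open>w\<close> may be impossible and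
    \<open>K\<close> a placeholder there, so the cases in which both sides vanish are settled
    first.\<close>
  proof (cases "w \<in> set_pmf P \<and> (\<forall>i. i \<notin> {1..m} \<longrightarrow> x i = undefined)")
    case False
    then consider "pmf P w = 0" | "\<exists>i. i \<notin> {1..m} \<and> x i \<noteq> undefined" by (auto simp: set_pmf_iff)
    then show "prob {a\<in>space S. W a = w \<and> X t a = x} = pmf P w * pmf (Pi_pmf {1..m} undefined (\<lambda>i. K t i (view m i w))) x"
    proof cases
      case 1
      then have "prob {a\<in>space S. W a = w \<and> X t a = x} \<le> 0"
        unfolding Pw using finite_measure_mono[OF _ setsW, of "{a\<in>space S. W a = w \<and> X t a = x}"] by force
      then show ?thesis using 1 by (simp add: measure_le_0_iff)
    next
      case 2
      then have "{a\<in>space S. W a = w \<and> X t a = x} = {}" by (auto simp: X_def)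
      then show ?thesis using 2 by (simp only: measure_empty pmf_Pi_outside finite_atLeastAtMost mult_zero_right)
    qed
  next
    case True
    then obtain a0 where a0: "a0 \<in> space S" "w = W a0" using set_P by blast
    have v: "view m p w \<in> views p" if "p \<in> {1..m}" for p using view_in[OF a0(1) that] a0(2) by simp
    \<comment> \<open>The event becomes a rectangle: latent values in \<open>A\<close>, and the
      local variable of each party \<open>i\<close> in \<open>C i\<close>.\<close>
    define A where "A = {F \<in> PiE (pairs m) (latent_alph G). arr F = w}"
    define C where "C i = {u\<in>space (loc_space G i). struct_eq G t i (lab (pos i) (view m (pos i) w)) u = x (pos i)}" for i
    have A: "A \<in> sets (PiM (pairs m) (\<lambda>e. count_space (latent_alph G e)))"
      unfolding PiM_alph by (auto simp: A_def)
    have C: "C i \<in> sets (loc_space G i)" if i: "i \<in> {1..m}" for i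
    proof -
      have p: "pos i \<in> {1..m}" using i by simp
      have "(\<lambda>u. struct_eq G t i (lab (pos i) (view m (pos i) w)) u) \<in> measurable (loc_space G i) (count_space (blk (pos i)))"
        using measurable_compose[OF measurable_Pair[OF measurable_const[OF t] measurable_ident] struct_measurable[OF p v[OF p]]]
        by (simp add: measurable_ident_sets comp_def)
      from measurable_sets[OF this, of "{x (pos i)} \<inter> blk (pos i)"] measurable_space[OF this]
      show ?thesis unfolding C_def by (auto elim!: back_subst[where P = "\<lambda>Z. Z \<in> sets (loc_space G i)"])
    qed
    have B: "PiE {1..m} C \<in> sets (PiM {1..m} (loc_space G))"
      by (rule sets_PiM_I_finite) (auto intro: C)
    have "{a\<in>space S. W a = w \<and> X t a = x} = {a\<in>space S. Lat a \<in> A \<and> Lc a \<in> PiE {1..m} C}"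
    proof (intro set_eqI)
      fix a
      have "X t a = x \<longleftrightarrow> (\<forall>p\<in>{1..m}. out t p (view m p (W a)) a = x p)"
        using True by (auto simp: X_def fun_eq_iff observed_eq)
      moreover have "(\<forall>p\<in>{1..m}. out t p (view m p w) a = x p) \<longleftrightarrow> Lc a \<in> PiE {1..m} C" if "a \<in> space S"
      proof -
        have "Lc a \<in> PiE {1..m} C \<longleftrightarrow> (\<forall>i\<in>{1..m}. struct_eq G t i (lab (pos i) (view m (pos i) w)) (loc G i a) = x (pos i))"
          using measurable_space[OF loc_measurable that] by (auto simp: Lc_def C_def PiE_iff)
        also have "\<dots> \<longleftrightarrow> (\<forall>p\<in>{1..m}. out t p (view m p w) a = x p)"
          unfolding out_def by (metis iota_pos iota_in pos_iota)
        finally show ?thesis by simp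
      qed
      ultimately show "a \<in> {a\<in>space S. W a = w \<and> X t a = x} \<longleftrightarrow> a \<in> {a\<in>space S. Lat a \<in> A \<and> Lc a \<in> PiE {1..m} C}"
        using Lat_in[of a] by (auto simp: A_def W_def)
    qed
    then have "prob {a\<in>space S. W a = w \<and> X t a = x} = prob {a\<in>space S. Lat a \<in> A} * prob {a\<in>space S. Lc a \<in> PiE {1..m} C}"
      using prob_Lat_Lc[OF A B] by simp
    also have "{a\<in>space S. Lat a \<in> A} = {a\<in>space S. W a = w}"
      using Lat_in by (auto simp: A_def W_def)
    also have "{a\<in>space S. Lc a \<in> PiE {1..m} C} = (\<Inter>i\<in>{1..m}. loc G i -` C i \<inter> space S)"
      using m by (auto simp: Lc_def PiE_iff)
    also have "prob \<dots> = (\<Prod>i\<in>{1..m}. prob (loc G i -` C i \<inter> space S))"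
      using m by (intro indep_varsD_finite[OF indep_loc] C) auto
    also have "\<dots> = (\<Prod>p\<in>{1..m}. prob (loc G (\<iota> p) -` C (\<iota> p) \<inter> space S))"
      by (subst prod.permute[OF perm]) (simp add: comp_def)
    also have "\<dots> = (\<Prod>p\<in>{1..m}. pmf (K t p (view m p w)) (x p))"
    proof (rule prod.cong[OF refl])
      fix p assume p: "p \<in> {1..m}"
      have "loc G (\<iota> p) -` C (\<iota> p) \<inter> space S = out t p (view m p w) -` {x p} \<inter> space S"
        using measurable_space[OF loc_measurable, of "\<iota> p"] iota_in[of p] p by (auto simp: C_def out_def)
      then show "prob (loc G (\<iota> p) -` C (\<iota> p) \<inter> space S) = pmf (K t p (view m p w)) (x p)"
        using pmf_K[OF p v[OF p]] by simp
    qed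
    also have "\<dots> = pmf (Pi_pmf {1..m} undefined (\<lambda>i. K t i (view m i w))) x"
      using True by (subst pmf_Pi') auto
    finally show "prob {a\<in>space S. W a = w \<and> X t a = x} = pmf P w * pmf (Pi_pmf {1..m} undefined (\<lambda>i. K t i (view m i w))) x"
      unfolding Pw .
  qed
qed

lemma cond_entropy_eq_residual:
  assumes p: "p \<in> {1..m}"
  shows "cond_entropy S (neighbours m G (\<iota> p)) (observed m G t (\<iota> p)) = residual m P (K t) p"
proof -
  let ?J = "network m P (K t)"
  have "neighbours m G (\<iota> p) = (\<lambda>a. lab p (view m p (fst (W a, X t a))))"
    "observed m G t (\<iota> p) = (\<lambda>a. snd (W a, X t a) p)"
    using p by (auto simp: neighbours_eq X_def)
  then have "cond_entropy S (neighbours m G (\<iota> p)) (observed m G t (\<iota> p))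
      = ent ?J (\<lambda>z. (lab p (view m p (fst z)), snd z p)) - ent ?J (\<lambda>z. snd z p)"
    using cond_entropy_law[OF prob_S simple_WX, of "\<lambda>z. lab p (view m p (fst z))" "\<lambda>z. snd z p"]
    unfolding law_WX by simp
  also have "ent ?J (\<lambda>z. (lab p (view m p (fst z)), snd z p)) = ent ?J (\<lambda>z. (view m p (fst z), snd z p))"
    by (intro ent_cong determinesI) (auto simp: lab_inj[OF p])
  finally show ?thesis by (simp add: residual_def)
qed

end

end

subsection \<open>The source\<close>

lemma ent_Pi_pmf:
  assumes I: "finite I" and fin: "finite (set_pmf P)"
    and F: "\<And>w w'. w \<in> set_pmf (Pi_pmf I d (\<lambda>_. P)) \<Longrightarrow> w' \<in> set_pmf (Pi_pmf I d (\<lambda>_. P)) \<Longrightarrow> F w' = F w \<longleftrightarrow> (\<forall>k\<in>I. f (w' k) = f (w k))"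
  shows "ent (Pi_pmf I d (\<lambda>_. P)) F = card I * ent P f"
proof -
  have fP: "finite (set_pmf (Pi_pmf I d (\<lambda>_. P)))" by (intro finite_set_Pi_pmf I fin)
  have "ent (Pi_pmf I d (\<lambda>_. P)) F = measure_pmf.expectation (Pi_pmf I d (\<lambda>_. P)) (\<lambda>w. \<Sum>k\<in>I. info P f (w k))"
    unfolding ent_def by (intro expectation_cong info_Pi_pmf I F)
  also have "\<dots> = (\<Sum>k\<in>I. measure_pmf.expectation (Pi_pmf I d (\<lambda>_. P)) (\<lambda>w. info P f (w k)))"
    using fP by simp
  also have "\<dots> = (\<Sum>k\<in>I. ent P f)"
    unfolding ent_def by (intro sum.cong refl) (rule expectation_Pi_pmf_component[OF I])
  finally show ?thesis by simp
qed

text \<open>Each of the m marginals and the joint law costs an additive 2. The logarithm of the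
  joint alphabet is the sum of those of the marginal alphabets, hence the factor 2 in the last
  term.\<close>

lemma correlation_continuous:
  fixes p q :: "(nat \<Rightarrow> 'b) pmf"
  assumes A: "\<And>i. i \<in> {1..m} \<Longrightarrow> finite (A i) \<and> A i \<noteq> {}" "set_pmf p \<subseteq> PiE {1..m} A" "set_pmf q \<subseteq> PiE {1..m} A"
    and c: "close e p q" "e \<le> 1"
  shows "correlation m p \<le> correlation m q + 2 * (m + 1) + 2 * e * (\<Sum>i=1..m. log 2 (card (A i)))"
proof -
  have i: "ent p (\<lambda>x. x i) \<le> ent q (\<lambda>x. x i) + (2 + e * log 2 (card (A i)))" if "i \<in> {1..m}" for i
    using ent_continuous[of "A i" "map_pmf (\<lambda>x. x i) p" "map_pmf (\<lambda>x. x i) q" e] A that c close_map[OF c(1)]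
    by (fastforce simp: ent_map comp_def)
  have "(\<Sum>i=1..m. ent p (\<lambda>x. x i)) \<le> (\<Sum>i=1..m. ent q (\<lambda>x. x i) + (2 + e * log 2 (card (A i))))"
    by (intro sum_mono i)
  also have "\<dots> = (\<Sum>i=1..m. ent q (\<lambda>x. x i)) + 2 * m + e * (\<Sum>i=1..m. log 2 (card (A i)))"
    by (simp add: sum.distrib sum_distrib_left)
  finally have 1: "(\<Sum>i=1..m. ent p (\<lambda>x. x i)) \<le> (\<Sum>i=1..m. ent q (\<lambda>x. x i)) + 2 * m + e * (\<Sum>i=1..m. log 2 (card (A i)))" .
  have "ent q (\<lambda>x. x) \<le> ent p (\<lambda>x. x) + 2 + e * log 2 (card (PiE {1..m} A))"
    using A by (intro ent_continuous close_sym[OF c(1)] c(2) finite_PiE) auto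
  also have "log 2 (card (PiE {1..m} A)) = (\<Sum>i=1..m. log 2 (card (A i)))"
  proof -
    have "0 < real (card (A i))" if "i \<in> {1..m}" for i using A(1)[OF that] by (simp add: card_gt_0_iff)
    from log_prod_pos[OF finite_atLeastAtMost this] show ?thesis by (simp add: card_PiE)
  qed
  finally show ?thesis using 1 by (simp add: correlation_def algebra_simps)
qed

locale source =
  fixes m :: nat and M :: "'a measure" and X :: "nat \<Rightarrow> 'a \<Rightarrow> 'x" and \<X> :: "nat \<Rightarrow> 'x set"
  assumes m: "m \<ge> 1" and prob_M: "prob_space M" and fin\<X>: "\<And>i. i \<in> {1..m} \<Longrightarrow> finite (\<X> i)"
    and X: "\<And>i. i \<in> {1..m} \<Longrightarrow> X i \<in> measurable M (count_space (\<X> i))"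
begin

definition tuple :: "'a \<Rightarrow> nat \<Rightarrow> 'x" where
  "tuple a = (\<lambda>i\<in>{1..m}. X i a)"

definition pX :: "(nat \<Rightarrow> 'x) pmf" where
  "pX = law M tuple"

abbreviation "PX \<equiv> joint_law m \<X> M X"

abbreviation "C \<equiv> total_correlation m M X"

definition lsize :: real where
  "lsize = (\<Sum>i=1..m. log 2 (card (\<X> i)))"

lemma PiM_\<X>: "PiM {1..m} (\<lambda>i. count_space (\<X> i)) = count_space (PiE {1..m} \<X>)"
  by (intro count_space_PiM countable_finite fin\<X> finite_atLeastAtMost)

lemma tuple_measurable: "tuple \<in> measurable M (count_space (PiE {1..m} \<X>))"
  unfolding tuple_def[abs_def] PiM_\<X>[symmetric] by (intro measurable_restrict X)

lemma finite_tuples: "finite (PiE {1..m} \<X>)"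
  by (intro finite_PiE fin\<X>) auto

lemma simple_tuple: "simple_function M tuple"
  by (rule simple_function_of_finite[OF tuple_measurable finite_tuples])

lemma set_pX: "set_pmf pX \<subseteq> PiE {1..m} \<X>"
proof
  fix x assume "x \<in> set_pmf pX"
  then obtain a where "a \<in> space M" "x = tuple a" using set_law[OF prob_M simple_tuple] unfolding pX_def by blast
  then show "x \<in> PiE {1..m} \<X>" using measurable_space[OF tuple_measurable] by simp
qed

lemma finite_pX: "finite (set_pmf pX)"
  using set_pX finite_tuples finite_subset by blast

lemma \<X>_ne: "i \<in> {1..m} \<Longrightarrow> \<X> i \<noteq> {}"
proof -
  assume i: "i \<in> {1..m}"
  obtain x where "x \<in> set_pmf pX" using set_pmf_not_empty[of pX] by blast
  from subsetD[OF set_pX this] have "x i \<in> \<X> i" by (rule PiE_mem[OF _ i])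
  then show ?thesis by blast
qed

lemma lsize_nonneg: "lsize \<ge> 0"
  unfolding lsize_def
proof (rule sum_nonneg)
  fix i assume "i \<in> {1..m}"
  then have "card (\<X> i) \<ge> 1" using fin\<X> \<X>_ne by (simp add: Suc_leI card_gt_0_iff)
  then show "0 \<le> log 2 (card (\<X> i))" by simp
qed

lemma total_correlation_eq: "C = correlation m pX"
proof -
  have "shannon_entropy M (X i) = ent pX (\<lambda>x. x i)" if i: "i \<in> {1..m}" for i
  proof -
    have "X i = (\<lambda>a. tuple a i)" unfolding tuple_def using i by (simp only: restrict_apply')
    then show ?thesis using shannon_entropy_law[OF prob_M simple_tuple, of "\<lambda>x. x i"] by (simp add: pX_def)
  qed
  moreover have "shannon_entropy M (\<lambda>a. \<lambda>i\<in>{1..m}. X i a) = ent pX (\<lambda>x. x)"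
    using shannon_entropy_law[OF prob_M simple_tuple, of "\<lambda>x. x"] by (simp add: pX_def tuple_def[abs_def])
  ultimately show ?thesis unfolding total_correlation_def correlation_def by simp
qed

lemma prob_PX: "prob_space PX"
  unfolding joint_law_def PiM_\<X> using tuple_measurable unfolding tuple_def[abs_def]
  by (rule prob_space.prob_space_distr[OF prob_M])

lemma sets_PX: "sets PX = Pow (PiE {1..m} \<X>)"
  unfolding joint_law_def PiM_\<X> by simp

lemma emeasure_PX: "A \<subseteq> PiE {1..m} \<X> \<Longrightarrow> emeasure PX A = ennreal (measure_pmf.prob pX A)"
proof -
  interpret prob_space M by (rule prob_M)
  assume A: "A \<subseteq> PiE {1..m} \<X>"
  have "emeasure PX A = emeasure M (tuple -` A \<inter> space M)"
    unfolding joint_law_def PiM_\<X> using tuple_measurable A by (subst emeasure_distr) (auto simp: tuple_def[abs_def])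
  then show ?thesis unfolding pX_def prob_law[OF prob_M simple_tuple] by (simp add: emeasure_eq_measure)
qed

abbreviation "blocks n \<equiv> PiE {1..m} (block_alph n \<X>)"

text \<open>Everything is finite, so it is enough to compare singletons, which are boxes.\<close>

lemma measure_PX_power:
  fixes n :: nat
  assumes B: "B \<subseteq> PiE {..<n} (\<lambda>_. PiE {1..m} \<X>)"
  shows "measure (PiM {..<n} (\<lambda>_. PX)) B = measure_pmf.prob (Pi_pmf {..<n} undefined (\<lambda>_. pX)) B"
proof -
  interpret PX: prob_space PX by (rule prob_PX)
  interpret product_prob_space "\<lambda>_. PX" "{..<n}" by standard
  have finB: "finite B" using B by (rule finite_subset) (rule finite_PiE[OF finite_lessThan finite_tuples])
  have single: "{y} \<in> sets (PiM {..<n} (\<lambda>_. PX)) \<and> measure (PiM {..<n} (\<lambda>_. PX)) {y} = pmf (Pi_pmf {..<n} undefined (\<lambda>_. pX)) y" if "y \<in> B" for y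
  proof -
    have y: "y \<in> PiE {..<n} (\<lambda>_. PiE {1..m} \<X>)" using that B by blast
    then have eq: "{y} = PiE {..<n} (\<lambda>k. {y k})" by (simp add: PiE_singleton PiE_iff)
    have sets: "{y k} \<in> sets PX" if "k \<in> {..<n}" for k
      using y that unfolding sets_PX by auto
    have "emeasure (PiM {..<n} (\<lambda>_. PX)) {y} = (\<Prod>k<n. emeasure PX {y k})"
      unfolding eq by (rule emeasure_PiM[OF finite_lessThan sets])
    also have "\<dots> = (\<Prod>k<n. ennreal (pmf pX (y k)))"
      using y by (intro prod.cong refl) (subst emeasure_PX; auto simp: measure_pmf_single)
    also have "\<dots> = ennreal (pmf (Pi_pmf {..<n} undefined (\<lambda>_. pX)) y)"
      using y by (subst pmf_Pi') (auto simp: prod_ennreal PiE_iff extensional_def)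
    finally have "measure (PiM {..<n} (\<lambda>_. PX)) {y} = pmf (Pi_pmf {..<n} undefined (\<lambda>_. pX)) y"
      by (simp add: measure_def)
    moreover have "{y} \<in> sets (PiM {..<n} (\<lambda>_. PX))"
      unfolding eq by (intro sets_PiM_I_finite sets) auto
    ultimately show ?thesis by simp
  qed
  have "measure (PiM {..<n} (\<lambda>_. PX)) B = (\<Sum>y\<in>B. measure (PiM {..<n} (\<lambda>_. PX)) {y})"
    using finB single by (intro finite_measure_eq_sum_singleton) auto
  also have "\<dots> = measure_pmf.prob (Pi_pmf {..<n} undefined (\<lambda>_. pX)) B"
    using single finB by (simp add: measure_measure_pmf_finite)
  finally show ?thesis .
qed

lemma sets_PX_power:
  fixes n :: nat
  shows "sets (PiM {..<n} (\<lambda>_. PX)) = Pow (PiE {..<n} (\<lambda>_. PiE {1..m} \<X>))"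
proof -
  have "sets (PiM {..<n} (\<lambda>_. PX)) = sets (PiM {..<n} (\<lambda>_. count_space (PiE {1..m} \<X>)))"
    by (intro sets_PiM_cong) (auto simp: sets_PX)
  also have "\<dots> = Pow (PiE {..<n} (\<lambda>_. PiE {1..m} \<X>))"
    by (subst count_space_PiM[OF finite_lessThan countable_finite[OF finite_tuples]]) simp
  finally show ?thesis .
qed

lemma regroup_measurable:
  "(\<lambda>x. \<lambda>i\<in>{1..m}. \<lambda>k\<in>{..<n}. x k i) \<in> measurable (PiM {..<n} (\<lambda>_. PX)) (count_space (blocks n))"
  unfolding measurable_def
proof (intro CollectI conjI ballI)
  have sp: "space (PiM {..<n} (\<lambda>_. PX)) = PiE {..<n} (\<lambda>_. PiE {1..m} \<X>)"
    using sets_PX_power[of n] by (metis sets.top sets.sets_into_space Pow_iff Pow_top subset_antisym)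
  show "(\<lambda>x. \<lambda>i\<in>{1..m}. \<lambda>k\<in>{..<n}. x k i) \<in> space (PiM {..<n} (\<lambda>_. PX)) \<rightarrow> space (count_space (blocks n))"
    unfolding sp by (auto simp: block_alph_def PiE_iff)
  fix A
  show "(\<lambda>x. \<lambda>i\<in>{1..m}. \<lambda>k\<in>{..<n}. x k i) -` A \<inter> space (PiM {..<n} (\<lambda>_. PX)) \<in> sets (PiM {..<n} (\<lambda>_. PX))"
    unfolding sets_PX_power sp by blast
qed

lemma measure_iid_law:
  "A \<subseteq> blocks n \<Longrightarrow> measure (iid_law m n \<X> PX) A = measure_pmf.prob (iid_blocks m n pX) A"
proof -
  let ?f = "\<lambda>x :: nat \<Rightarrow> nat \<Rightarrow> 'x. \<lambda>i\<in>{1..m}. \<lambda>k\<in>{..<n}. x k i"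
  let ?N = "PiM {..<n} (\<lambda>_. PX)"
  assume A: "A \<subseteq> blocks n"
  have sp: "space ?N = PiE {..<n} (\<lambda>_. PiE {1..m} \<X>)"
    using sets_PX_power[of n] by (metis sets.top sets.sets_into_space Pow_iff Pow_top subset_antisym)
  have "measure (iid_law m n \<X> PX) A = measure ?N (?f -` A \<inter> space ?N)"
    unfolding iid_law_def using A by (intro measure_distr regroup_measurable) simp
  also have "\<dots> = measure_pmf.prob (Pi_pmf {..<n} undefined (\<lambda>_. pX)) (?f -` A \<inter> space ?N)"
    by (rule measure_PX_power) (simp add: sp)
  also have "\<dots> = measure_pmf.prob (Pi_pmf {..<n} undefined (\<lambda>_. pX)) (?f -` A)"
  proof (intro measure_pmf.finite_measure_eq_AE AE_pmfI)
    fix x assume "x \<in> set_pmf (Pi_pmf {..<n} undefined (\<lambda>_. pX))"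
    then have "x \<in> space ?N"
      unfolding sp using set_pX by (auto simp: set_Pi_pmf PiE_dflt_def PiE_iff extensional_def)
    then show "x \<in> ?f -` A \<inter> space ?N \<longleftrightarrow> x \<in> ?f -` A" by simp
  qed auto
  finally show ?thesis by (simp add: iid_blocks_def)
qed

lemma prob_iid_law: "prob_space (iid_law m n \<X> PX)"
proof -
  interpret PX: prob_space PX by (rule prob_PX)
  interpret product_prob_space "\<lambda>_. PX" "{..<n}" by standard
  show ?thesis unfolding iid_law_def by (rule prob_space_distr[OF regroup_measurable])
qed

lemma set_iid_blocks: "set_pmf (iid_blocks m n pX) \<subseteq> blocks n"
proof
  fix y assume "y \<in> set_pmf (iid_blocks m n pX)"
  then obtain x where x: "y = (\<lambda>i\<in>{1..m}. \<lambda>k\<in>{..<n}. x k i)" "\<And>k. k < n \<Longrightarrow> x k \<in> set_pmf pX"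
    by (auto simp: iid_blocks_def set_Pi_pmf PiE_dflt_def)
  have "x k i \<in> \<X> i" if "k < n" "i \<in> {1..m}" for k i
    using set_pX x(2)[OF that(1)] that(2) by (meson PiE_mem subsetD)
  then show "y \<in> blocks n" by (auto simp: x(1) block_alph_def)
qed

lemma correlation_iid_blocks: "correlation m (iid_blocks m n pX) = n * C"
proof -
  let ?Pi = "Pi_pmf {..<n} undefined (\<lambda>_. pX)"
  have i: "ent (iid_blocks m n pX) (\<lambda>y. y i) = n * ent pX (\<lambda>x. x i)" if i: "i \<in> {1..m}" for i
    unfolding iid_blocks_def ent_map using ent_Pi_pmf[of "{..<n}" pX undefined "(\<lambda>y. y i) \<circ> (\<lambda>x. \<lambda>i\<in>{1..m}. \<lambda>k\<in>{..<n}. x k i)" "\<lambda>x. x i"] i finite_pX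
    by (auto simp: restrict_eq_iff)
  have all: "(\<lambda>i\<in>{1..m}. \<lambda>k\<in>{..<n}. w' k i) = (\<lambda>i\<in>{1..m}. \<lambda>k\<in>{..<n}. w k i) \<longleftrightarrow> (\<forall>k\<in>{..<n}. w' k = w k)"
    if w: "w \<in> set_pmf ?Pi" "w' \<in> set_pmf ?Pi" for w w'
  proof -
    have "w' k = w k \<longleftrightarrow> (\<forall>i\<in>{1..m}. w' k i = w k i)" if "k < n" for k
    proof -
      have "w k \<in> PiE {1..m} \<X>" "w' k \<in> PiE {1..m} \<X>"
        using w that set_pX by (auto simp: set_Pi_pmf PiE_dflt_def)
      then show ?thesis by (metis PiE_ext)
    qed
    then show ?thesis by (auto simp: restrict_eq_iff)
  qed
  have "ent (iid_blocks m n pX) (\<lambda>y. y) = n * ent pX (\<lambda>x. x)"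
    unfolding iid_blocks_def ent_map
    using ent_Pi_pmf[of "{..<n}" pX undefined "(\<lambda>y. y) \<circ> (\<lambda>x. \<lambda>i\<in>{1..m}. \<lambda>k\<in>{..<n}. x k i)" "\<lambda>x. x"] all finite_pX by simp
  then show ?thesis using i by (simp add: correlation_def total_correlation_eq sum_distrib_left right_diff_distrib)
qed

lemma correlation_near:
  assumes p: "set_pmf p \<subseteq> blocks n" and c: "close e p (iid_blocks m n pX)" "e \<le> 1"
  shows "correlation m p \<le> n * C + 2 * (m + 1) + 2 * e * (n * lsize)"
    and "n * C \<le> correlation m p + 2 * (m + 1) + 2 * e * (n * lsize)"
proof -
  have "(\<Sum>i=1..m. log 2 (card (block_alph n \<X> i))) = n * lsize"
    unfolding lsize_def sum_distrib_left
  proof (rule sum.cong[OF refl])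
    fix i assume "i \<in> {1..m}"
    then have "card (\<X> i) > 0" using fin\<X> \<X>_ne by (simp add: card_gt_0_iff)
    then show "log 2 (card (block_alph n \<X> i)) = n * log 2 (card (\<X> i))"
      by (simp add: block_alph_def card_PiE log_nat_power)
  qed
  moreover have A: "finite (block_alph n \<X> i) \<and> block_alph n \<X> i \<noteq> {}" if "i \<in> {1..m}" for i
    using that fin\<X> \<X>_ne by (auto simp: block_alph_def PiE_eq_empty_iff intro!: finite_PiE)
  ultimately show "correlation m p \<le> n * C + 2 * (m + 1) + 2 * e * (n * lsize)"
    "n * C \<le> correlation m p + 2 * (m + 1) + 2 * e * (n * lsize)"
    using correlation_continuous[OF A p set_iid_blocks c] correlation_continuous[OF A set_iid_blocks p close_sym[OF c(1)] c(2)]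
    by (auto simp: correlation_iid_blocks)
qed

end

subsection \<open>Dependence on the structural equations\<close>

context causal_network
begin

text \<open>A point mass of the channel is the measure of a section of a measurable set in the
  product of \<open>theta_space G\<close> and the law of the local variable.\<close>

lemma pmf_K_measurable:
  assumes p: "p \<in> {1..m}"
  shows "(\<lambda>t. pmf (K t p v) y) \<in> borel_measurable (theta_space G)"
proof -
  let ?i = "\<iota> p" and ?v = "valid p v"
  let ?N = "distr S (loc_space G ?i) (loc G ?i)"
  have v: "?v \<in> views p" by (rule valid_in[OF p])
  have loc: "loc G ?i \<in> measurable S (loc_space G ?i)" using p by (intro loc_measurable) simp
  interpret N: prob_space ?N by (rule prob_space.prob_space_distr[OF prob_S loc])
  let ?f = "\<lambda>(t, u). struct_eq G t ?i (lab p ?v) u"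
  have f: "?f \<in> measurable (theta_space G \<Otimes>\<^sub>M ?N) (count_space (blk p))"
    using struct_measurable[OF p v] by (simp cong: measurable_cong_sets sets_pair_measure_cong)
  let ?Q = "?f -` ({y} \<inter> blk p) \<inter> space (theta_space G \<Otimes>\<^sub>M ?N)"
  have Q: "?Q \<in> sets (theta_space G \<Otimes>\<^sub>M ?N)" by (rule measurable_sets[OF f]) simp
  have "(\<lambda>t. enn2real (emeasure ?N (Pair t -` ?Q))) \<in> borel_measurable (theta_space G)"
    using N.measurable_emeasure_Pair[OF Q] by simp
  also have "?this \<longleftrightarrow> ?thesis"
  proof (rule measurable_cong)
    fix t assume t: "t \<in> space (theta_space G)"
    have "Pair t -` ?Q \<in> sets ?N" by (rule sets_Pair1[OF Q])
    then have "measure ?N (Pair t -` ?Q) = measure S (loc G ?i -` (Pair t -` ?Q) \<inter> space S)"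
      by (intro measure_distr loc) simp
    also have "loc G ?i -` (Pair t -` ?Q) \<inter> space S = out t p ?v -` {y} \<inter> space S"
      using measurable_space[OF loc] measurable_space[OF out_measurable[OF t p v]] t
      by (auto simp: space_pair_measure out_def)
    also have "measure S \<dots> = pmf (K t p v) y"
      unfolding K_def using pmf_law[OF prob_S simple_out[OF t p v]] by simp
    finally show "enn2real (emeasure ?N (Pair t -` ?Q)) = pmf (K t p v) y" by (simp add: measure_def)
  qed
  finally show ?thesis .
qed

lemma pmf_network_measurable: "(\<lambda>t. pmf (network m P (K t)) z) \<in> borel_measurable (theta_space G)"
proof -
  obtain w x where z: "z = (w, x)" by fastforce
  show ?thesis
    unfolding z pmf_network
  proof (cases "\<forall>i. i \<notin> {1..m} \<longrightarrow> x i = undefined")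
    case True
    then have "pmf (Pi_pmf {1..m} undefined (\<lambda>i. K t i (view m i w))) x = (\<Prod>i=1..m. pmf (K t i (view m i w)) (x i))" for t
      by (intro pmf_Pi') auto
    then show "(\<lambda>t. pmf P w * pmf (Pi_pmf {1..m} undefined (\<lambda>i. K t i (view m i w))) x) \<in> borel_measurable (theta_space G)"
      by (simp only:) (intro borel_measurable_times borel_measurable_const borel_measurable_prod pmf_K_measurable)
  next
    case False
    then have "pmf (Pi_pmf {1..m} undefined (\<lambda>i. K t i (view m i w))) x = 0" for t
      by (intro pmf_Pi_outside) auto
    then show "(\<lambda>t. pmf P w * pmf (Pi_pmf {1..m} undefined (\<lambda>i. K t i (view m i w))) x) \<in> borel_measurable (theta_space G)"
      by (simp only: mult_zero_right borel_measurable_const)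
  qed
qed

text \<open>A finite set that contains the support of the network for every choice of structural
  equations, so that sums over it can be integrated over that choice.\<close>

definition support :: "((nat \<Rightarrow> nat \<Rightarrow> nat) \<times> (nat \<Rightarrow> nat \<Rightarrow> 'a)) set" where
  "support = set_pmf P \<times> PiE {1..m} blk"

lemma finite_support: "finite support"
  unfolding support_def by (intro finite_cartesian_product finite_P finite_PiE finite_blk) auto

lemma set_network: 
  assumes "t \<in> space (theta_space G)"
  shows "set_pmf (network m P (K t)) \<subseteq> support"
proof
  fix z assume "z \<in> set_pmf (network m P (K t))"
  then obtain w x where z: "z = (w, x)" "w \<in> set_pmf P" "x \<in> PiE_dflt {1..m} undefined (\<lambda>i. set_pmf (K t i (view m i w)))"
    by (auto simp: network_def set_Pi_pmf comp_def)
  then have "x \<in> PiE {1..m} blk"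
    using set_K[OF assms] unfolding PiE_dflt_def PiE_iff extensional_def by blast
  then show "z \<in> support" using z by (simp add: support_def)
qed

lemma set_outputs:
  assumes "t \<in> space (theta_space G)"
  shows "set_pmf (map_pmf snd (network m P (K t))) \<subseteq> PiE {1..m} blk"
proof
  fix y assume "y \<in> set_pmf (map_pmf snd (network m P (K t)))"
  then obtain z where z: "z \<in> set_pmf (network m P (K t))" "y = snd z" by auto
  have "z \<in> support" by (rule subsetD[OF set_network[OF assms] z(1)])
  then show "y \<in> PiE {1..m} blk" by (simp add: support_def mem_Times_iff z(2))
qed

lemma ent_measurable: "(\<lambda>t. ent (network m P (K t)) f) \<in> borel_measurable (theta_space G)"
proof -
  have "(\<lambda>t. \<Sum>x\<in>support. - pmf (network m P (K t)) x * log 2 (\<Sum>y\<in>{y\<in>support. f y = f x}. pmf (network m P (K t)) y))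
      \<in> borel_measurable (theta_space G)"
    by (intro borel_measurable_sum borel_measurable_times borel_measurable_uminus borel_measurable_log borel_measurable_const pmf_network_measurable)
  then show ?thesis
    by (subst measurable_cong[OF ent_finite_superset[OF finite_support set_network]])
qed

lemma residual_bounds:
  assumes t: "t \<in> space (theta_space G)"
  shows "0 \<le> residual m P (K t) p" "residual m P (K t) p \<le> log 2 (card support)"
proof -
  let ?J = "network m P (K t)"
  have fin: "finite (set_pmf ?J)" by (rule finite_subset[OF set_network[OF t] finite_support])
  show "0 \<le> residual m P (K t) p"
    unfolding residual_def diff_ge_0_iff_ge by (intro ent_mono fin determinesI) simp
  have "ent ?J (\<lambda>z. (view m p (fst z), snd z p)) \<le> ent ?J (\<lambda>z. z)" by (intro ent_mono fin determinesI) simp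
  also have "\<dots> \<le> log 2 (card support)" by (rule ent_le_log_card[OF finite_support set_network[OF t]])
  finally show "residual m P (K t) p \<le> log 2 (card support)"
    unfolding residual_def using ent_nonneg[of ?J "\<lambda>z. snd z p"] by linarith
qed

lemma residual_integrable: "integrable (theta_space G) (\<lambda>t. residual m P (K t) p)"
proof -
  interpret prob_space "theta_space G" by (rule prob_theta)
  show ?thesis
  proof (rule integrable_const_bound[where B = "log 2 (card support)"])
    show "AE t in theta_space G. norm (residual m P (K t) p) \<le> log 2 (card support)"
      using residual_bounds by (intro AE_I2) auto
    show "(\<lambda>t. residual m P (K t) p) \<in> borel_measurable (theta_space G)"
      unfolding residual_def by (intro borel_measurable_diff ent_measurable)
  qed
qed

definition relab :: "(nat \<Rightarrow> nat \<Rightarrow> 'a) \<Rightarrow> nat \<Rightarrow> nat \<Rightarrow> 'a" where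
  "relab y = (\<lambda>i\<in>{1..m}. y (pos i))"

abbreviation "lblocks \<equiv> PiE {1..m} (block_alph n \<X>)"

definition R :: "real \<Rightarrow> (nat \<Rightarrow> nat \<Rightarrow> 'a) pmf" where
  "R t = map_pmf relab (map_pmf snd (network m P (K t)))"

lemma finite_lblocks: "finite lblocks"
proof (intro finite_PiE finite_atLeastAtMost)
  fix i assume "i \<in> {1..m}"
  then show "finite (block_alph n \<X> i)" using finite_blk[of "pos i"] by (simp add: blk_def)
qed

lemma set_R: "t \<in> space (theta_space G) \<Longrightarrow> set_pmf (R t) \<subseteq> lblocks"
proof
  fix y assume t: "t \<in> space (theta_space G)" and "y \<in> set_pmf (R t)"
  then obtain x where x: "x \<in> set_pmf (map_pmf snd (network m P (K t)))" "y = relab x" by (auto simp: R_def)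
  have "x (pos i) \<in> block_alph n \<X> i" if "i \<in> {1..m}" for i
    using PiE_mem[OF subsetD[OF set_outputs[OF t] x(1)], of "pos i"] that by (simp add: blk_def)
  then show "y \<in> lblocks" by (simp add: x(2) relab_def)
qed

lemma observed_law_R:
  assumes t: "t \<in> space (theta_space G)"
  shows "prob_space (observed_law m n \<X> G t)" "sets (observed_law m n \<X> G t) = Pow lblocks"
    "A \<subseteq> lblocks \<Longrightarrow> measure (observed_law m n \<X> G t) A = measure_pmf.prob (R t) A"
proof -
  let ?f = "\<lambda>a. \<lambda>i\<in>{1..m}. observed m G t i a"
  have obs: "(\<lambda>a. observed m G t i a) \<in> measurable S (count_space (block_alph n \<X> i))" if "i \<in> {1..m}" for i
    using observed_measurable[OF t, of "pos i"] that by (simp add: blk_def)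
  have "?f \<in> measurable S (PiM {1..m} (\<lambda>i. count_space (block_alph n \<X> i)))"
    by (intro measurable_restrict obs)
  also have "PiM {1..m} (\<lambda>i. count_space (block_alph n \<X> i)) = count_space lblocks"
  proof (intro count_space_PiM countable_finite finite_atLeastAtMost)
    fix i assume "i \<in> {1..m}"
    then show "finite (block_alph n \<X> i)" using finite_blk[of "pos i"] by (simp add: blk_def)
  qed
  finally have f: "?f \<in> measurable S (count_space lblocks)" .
  show "prob_space (observed_law m n \<X> G t)" unfolding observed_law_def by (rule prob_space.prob_space_distr[OF prob_S f])
  show "sets (observed_law m n \<X> G t) = Pow lblocks" by (simp add: observed_law_def)
  assume A: "A \<subseteq> lblocks"
  have eq: "?f a = relab (snd (W a, X t a))" for a
    by (auto simp: relab_def X_def fun_eq_iff)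
  have "measure (observed_law m n \<X> G t) A = measure S (?f -` A \<inter> space S)"
    unfolding observed_law_def using A by (intro measure_distr f) simp
  also have "\<dots> = measure_pmf.prob (law S ?f) A"
    using prob_law[OF prob_S simple_function_of_finite[OF f finite_lblocks]] by simp
  also have "law S ?f = R t"
    unfolding eq law_comp[OF prob_S simple_WX[OF t], of "\<lambda>z. relab (snd z)"] law_WX[OF t] R_def by (simp add: map_pmf_comp)
  finally show "measure (observed_law m n \<X> G t) A = measure_pmf.prob (R t) A" .
qed

text \<open>The supremum runs over finitely many events, each contributing a finite sum of
  measurable point masses, and the distance is bounded by 1.\<close>

lemma tv_integrable:
  assumes Q: "prob_space Q"
  shows "integrable (theta_space G) (\<lambda>t. tv_dist (observed_law m n \<X> G t) Q)"
proof -
  interpret prob_space "theta_space G" by (rule prob_theta)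
  have "(\<lambda>t. SUP A\<in>Pow lblocks. \<bar>(\<Sum>z\<in>{z\<in>support. relab (snd z) \<in> A}. pmf (network m P (K t)) z) - measure Q A\<bar>) \<in> borel_measurable (theta_space G)"
    using finite_lblocks
    by (intro borel_measurable_cSUP borel_measurable_abs borel_measurable_diff borel_measurable_sum pmf_network_measurable
        borel_measurable_const) (auto intro!: countable_finite bdd_above_finite)
  also have "?this \<longleftrightarrow> (\<lambda>t. tv_dist (observed_law m n \<X> G t) Q) \<in> borel_measurable (theta_space G)"
  proof (rule measurable_cong)
    fix t assume t: "t \<in> space (theta_space G)"
    have "(\<Sum>z\<in>{z\<in>support. relab (snd z) \<in> A}. pmf (network m P (K t)) z) = measure (observed_law m n \<X> G t) A" if "A \<in> Pow lblocks" for A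
    proof -
      have "measure (observed_law m n \<X> G t) A = measure_pmf.prob (network m P (K t)) {z. relab (snd z) \<in> A}"
        using observed_law_R(3)[OF t, of A] that by (simp add: R_def vimage_def)
      also have "\<dots> = measure_pmf.prob (network m P (K t)) {z\<in>support. relab (snd z) \<in> A}"
        using set_network[OF t] by (intro measure_pmf.finite_measure_eq_AE AE_pmfI) auto
      finally show ?thesis using finite_support by (simp add: measure_measure_pmf_finite)
    qed
    then show "(SUP A\<in>Pow lblocks. \<bar>(\<Sum>z\<in>{z\<in>support. relab (snd z) \<in> A}. pmf (network m P (K t)) z) - measure Q A\<bar>)
      = tv_dist (observed_law m n \<X> G t) Q"
      unfolding tv_dist_def observed_law_R(2)[OF t] by (intro SUP_cong refl) simp
  qed
  finally have meas: "(\<lambda>t. tv_dist (observed_law m n \<X> G t) Q) \<in> borel_measurable (theta_space G)" .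
  show ?thesis
  proof (rule integrable_const_bound[where B = 1])
    show "AE t in theta_space G. norm (tv_dist (observed_law m n \<X> G t) Q) \<le> 1"
      using tv_dist_bounds(2,3)[OF observed_law_R(1) Q] by (intro AE_I2) auto
  qed (rule meas)
qed

lemma correlation_R:
  assumes t: "t \<in> space (theta_space G)"
  shows "correlation m (R t) = correlation m (map_pmf snd (network m P (K t)))"
proof -
  let ?Q = "map_pmf snd (network m P (K t))"
  have inj: "y = y'" if "y \<in> set_pmf ?Q" "y' \<in> set_pmf ?Q" "relab y = relab y'" for y y'
  proof (rule PiE_ext)
    show "y \<in> PiE {1..m} blk" "y' \<in> PiE {1..m} blk" using that subsetD[OF set_outputs[OF t]] by blast+
    fix p assume "p \<in> {1..m}"
    then show "y p = y' p" using fun_cong[OF that(3), of "\<iota> p"] by (simp add: relab_def)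
  qed
  have "(\<Sum>i=1..m. ent (R t) (\<lambda>x. x i)) = (\<Sum>i=1..m. ent ?Q (\<lambda>x. x (pos i)))"
    unfolding R_def ent_map[of relab] by (intro sum.cong) (auto simp: relab_def comp_def)
  also have "\<dots> = (\<Sum>p=1..m. ent ?Q (\<lambda>x. x p))"
    by (subst (2) sum.permute[OF permutes_inv[OF perm]]) (simp add: comp_def)
  finally have "(\<Sum>i=1..m. ent (R t) (\<lambda>x. x i)) = (\<Sum>p=1..m. ent ?Q (\<lambda>x. x p))" .
  moreover have "ent (R t) (\<lambda>x. x) = ent ?Q (\<lambda>x. x)"
    unfolding R_def ent_map[of relab]
  proof (rule ent_cong)
    show "determines ?Q ((\<lambda>x. x) \<circ> relab) (\<lambda>x. x)"
      unfolding determines_def comp_def using inj by blast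
  qed (rule determinesI, simp)
  ultimately show ?thesis by (simp add: correlation_def)
qed

lemma markov_network:
  assumes "latents_ordered m \<iota> G" "t \<in> space (theta_space G)"
  shows "markov_network m P (K t)"
proof
  show "markov m P" using assms(1) by (simp add: latents_ordered_iff_markov)
  fix i v assume "i \<in> {1..m}"
  then show "finite (set_pmf (K t i v))" using set_K[OF assms(2)] finite_blk finite_subset by metis
qed (auto simp: finite_P canon_P)

end

section \<open>Causal models from chains\<close>

text \<open>Adding row \<open>p\<close> to the earlier rows and adding it to \<open>lo p\<close>
  multiplies the probability by one and the same kernel value, so the densities in
  \<open>markov\<close> balance at every point of the support.\<close>

lemma markov_chain:
  fixes \<kappa> :: "nat \<Rightarrow> (nat \<Rightarrow> 'v) \<Rightarrow> (nat \<Rightarrow> 'v) pmf"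
  assumes fin: "\<And>p z. finite (set_pmf (\<kappa> p z))" and ext: "\<And>p z r. r \<in> set_pmf (\<kappa> p z) \<Longrightarrow> r \<in> extensional {p<..m}"
  shows "markov m (chain \<kappa> m)"
  unfolding markov_def
proof
  fix p assume p: "p \<in> {1..m}"
  let ?Q = "chain \<kappa> m"
  have fQ: "finite (set_pmf ?Q)" by (rule finite_chain[OF fin])
  have row: "row p m s = s p" if "s \<in> set_pmf ?Q" for s
    using chain_kernel[OF that p] ext unfolding row_def by (metis extensional_restrict)
  have pt: "info ?Q (rows m p) s + info ?Q (lo p) s = info ?Q (rows m (p - 1)) s + info ?Q (view m p) s"
    if s: "s \<in> set_pmf ?Q" for s
  proof -
    let ?k = "pmf (\<kappa> p (lo p s)) (s p)"
    have lo: "rows m (p - 1) s' = rows m (p - 1) s \<Longrightarrow> lo p s' = lo p s" for s'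
      using p by (auto simp: rows_eq_iff col_eq_iff)
    have rows: "rows m p s' = rows m p s \<longleftrightarrow> rows m (p - 1) s' = rows m (p - 1) s \<and> row p m s' = row p m s" for s'
    proof -
      have *: "{1..p} = insert p {1..p - 1}" using p by auto
      show ?thesis unfolding rows_eq_iff row_eq_iff * by blast
    qed
    have "pr ?Q (rows m p) s = measure_pmf.prob ?Q {s'. rows m (p - 1) s' = rows m (p - 1) s \<and> s' p = s p}"
      unfolding pr_def by (intro measure_pmf.finite_measure_eq_AE AE_pmfI) (simp_all add: rows row s)
    also have "\<dots> = pr ?Q (rows m (p - 1)) s * ?k"
      unfolding pr_def
    proof (rule prob_chain_row[where A = "\<lambda>s'. rows m (p - 1) s' = rows m (p - 1) s", OF p _ lo])
      fix s' :: "nat \<Rightarrow> nat \<Rightarrow> 'v" and q r assume "p \<le> q"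
      then have "rows m (p - 1) (s'(q := r)) = rows m (p - 1) s'" using p unfolding rows_eq_iff by auto
      then show "(rows m (p - 1) (s'(q := r)) = rows m (p - 1) s) = (rows m (p - 1) s' = rows m (p - 1) s)" by simp
    qed
    finally have 1: "pr ?Q (rows m p) s = pr ?Q (rows m (p - 1)) s * ?k" .
    have "pr ?Q (view m p) s = measure_pmf.prob ?Q {s'. lo p s' = lo p s \<and> s' p = s p}"
      unfolding pr_def by (intro measure_pmf.finite_measure_eq_AE AE_pmfI) (simp_all add: view_eq_iff[OF p] row s)
    also have "\<dots> = pr ?Q (lo p) s * ?k"
      unfolding pr_def
      by (rule prob_chain_row[where A = "\<lambda>s'. lo p s' = lo p s", OF p]) (simp_all add: lo_upd)
    finally have 2: "pr ?Q (view m p) s = pr ?Q (lo p) s * ?k" .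
    have "0 < ?k" using 2 pr_pos[OF s, of "view m p"] pr_pos[OF s, of "lo p"] by (simp add: zero_less_mult_iff)
    then show ?thesis
      using pr_pos[OF s, of "rows m (p - 1)"] pr_pos[OF s, of "lo p"] by (simp add: info_def 1 2 log_mult)
  qed
  have "measure_pmf.expectation ?Q (\<lambda>s. info ?Q (rows m p) s + info ?Q (lo p) s)
      = measure_pmf.expectation ?Q (\<lambda>s. info ?Q (rows m (p - 1)) s + info ?Q (view m p) s)"
    by (intro expectation_cong pt)
  then show "ent ?Q (rows m p) + ent ?Q (lo p) = ent ?Q (rows m (p - 1)) + ent ?Q (view m p)"
    using fQ by (simp add: ent_def)
qed

text \<open>Distributions are transported to the real numbers by numbering their support.\<close>

definition enc :: "'b pmf \<Rightarrow> 'b \<Rightarrow> real" where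
  "enc D x = real (to_nat_on (set_pmf D) x)"

definition dec :: "'b pmf \<Rightarrow> real \<Rightarrow> 'b" where
  "dec D r = from_nat_into (set_pmf D) (nat \<lfloor>r\<rfloor>)"

text \<open>This holds for every real number, so that latent values stay in their alphabets at all
  sample points and not just almost surely.\<close>

lemma dec_in: "dec D r \<in> set_pmf D"
  unfolding dec_def by (rule from_nat_into[OF set_pmf_not_empty])

lemma dec_enc: "x \<in> set_pmf D \<Longrightarrow> dec D (enc D x) = x"
  by (simp add: dec_def enc_def)

lemma prob_dec: "measure_pmf.prob (map_pmf (enc D) D) {a. Q (dec D a)} = measure_pmf.prob D {x. Q x}"
  unfolding measure_map_pmf by (intro measure_pmf.finite_measure_eq_AE AE_pmfI) (auto simp: dec_enc)

lemma prob_pair: "measure_pmf.prob (pair_pmf p q) {z. Q (fst z) \<and> Q' (snd z)}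
  = measure_pmf.prob p {x. Q x} * measure_pmf.prob q {y. Q' y}"
proof -
  have "measure_pmf.prob (pair_pmf p q) {z. Q (fst z) \<and> Q' (snd z)}
     = measure_pmf.expectation p (\<lambda>x. measure_pmf.prob (map_pmf (Pair x) q) {z. Q (fst z) \<and> Q' (snd z)})"
    by (simp add: pair_pmf_def map_pmf_def[symmetric] prob_bind_pmf del: measure_map_pmf)
  also have "\<dots> = measure_pmf.expectation p (\<lambda>x. indicator {x. Q x} x * measure_pmf.prob q {y. Q' y})"
    by (intro expectation_cong) (auto simp: indicator_def vimage_def)
  finally show ?thesis by simp
qed

lemma (in prob_space) indep_vars_of_prob:
  assumes X: "\<And>i. i \<in> I \<Longrightarrow> X i \<in> measurable M (N i)"
    and p: "\<And>J B. J \<subseteq> I \<Longrightarrow> finite J \<Longrightarrow> J \<noteq> {} \<Longrightarrow> (\<And>j. j \<in> J \<Longrightarrow> B j \<in> sets (N j)) \<Longrightarrow>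
      prob {a\<in>space M. \<forall>j\<in>J. X j a \<in> B j} = (\<Prod>j\<in>J. prob {a\<in>space M. X j a \<in> B j})"
  shows "indep_vars N X I"
  unfolding indep_vars_def2
proof (intro conjI ballI X indep_setsI)
  fix i assume "i \<in> I"
  then show "{X i -` A \<inter> space M |A. A \<in> sets (N i)} \<subseteq> events" using X by (auto intro: measurable_sets)
next
  fix A J assume J: "J \<noteq> {}" "J \<subseteq> I" "finite J" and "\<forall>j\<in>J. A j \<in> {X j -` A \<inter> space M |A. A \<in> sets (N j)}"
  then obtain B where B: "\<And>j. j \<in> J \<Longrightarrow> B j \<in> sets (N j) \<and> A j = X j -` B j \<inter> space M" by simp metis
  have "(\<Inter>j\<in>J. A j) = {a\<in>space M. \<forall>j\<in>J. X j a \<in> B j}" using J(1) B by auto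
  moreover have "A j = {a\<in>space M. X j a \<in> B j}" if "j \<in> J" for j using B[OF that] by auto
  ultimately show "prob (\<Inter>j\<in>J. A j) = (\<Prod>j\<in>J. prob (A j))"
    using p[OF J(2,3,1), of B] B by simp
qed auto

section \<open>The causal model generated by a chain\<close>

locale chain_model =
  fixes m L :: nat and \<X> :: "nat \<Rightarrow> 'x set" and \<iota> :: "nat \<Rightarrow> nat"
    and \<kappa> :: "nat \<Rightarrow> (nat \<Rightarrow> nat) \<Rightarrow> (nat \<Rightarrow> nat) pmf" and B :: "nat \<Rightarrow> nat \<Rightarrow> nat"
    and Kh :: "nat \<Rightarrow> (nat \<Rightarrow> nat) \<Rightarrow> (nat \<Rightarrow> 'x) pmf"
  assumes m: "m \<ge> 1" and perm: "\<iota> permutes {1..m}" and fin\<X>: "\<And>i. i \<in> {1..m} \<Longrightarrow> finite (\<X> i)"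
    and range: "\<And>p z r. r \<in> set_pmf (\<kappa> p z) \<Longrightarrow> r \<in> PiE {p<..m} (\<lambda>q. {..<B p q})"
    and Kh: "\<And>p v. p \<in> {1..m} \<Longrightarrow> set_pmf (Kh p v) \<subseteq> PiE {..<L} (\<lambda>_. \<X> (\<iota> p))"
begin

definition V :: "nat \<Rightarrow> (nat \<Rightarrow> nat) set" where
  "V p = PiE ({1..m} - {p}) (\<lambda>q. {..<B (min p q) (max p q)})"

text \<open>The local randomness of vertex \<open>p\<close> is a table with one output for every view.\<close>

definition Tab :: "nat \<Rightarrow> ((nat \<Rightarrow> nat) \<Rightarrow> nat \<Rightarrow> 'x) pmf" where
  "Tab p = Pi_pmf (V p) undefined (Kh p)"

definition D :: "((nat \<Rightarrow> nat \<Rightarrow> nat) \<times> (nat \<Rightarrow> (nat \<Rightarrow> nat) \<Rightarrow> nat \<Rightarrow> 'x)) pmf" where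
  "D = pair_pmf (chain \<kappa> m) (Pi_pmf {1..m} undefined Tab)"

text \<open>Sample points are codes of an assignment paired with the tables of all vertices. An
  unordered pair of parties becomes an edge by taking the smaller and the larger of the two
  positions. The structural equations are deterministic and look up the table at the view.\<close>

definition G :: "'x causal_model" where
  "G = \<lparr> sample = measure_pmf (map_pmf (enc D) D),
    latent_alph = (\<lambda>e. {..<B (Min (inv \<iota> ` e)) (Max (inv \<iota> ` e))}),
    latent = (\<lambda>e a. fst (dec D a) (Min (inv \<iota> ` e)) (Max (inv \<iota> ` e))),
    loc_space = (\<lambda>_. count_space UNIV),
    loc = (\<lambda>i a. enc (Tab (inv \<iota> i)) (snd (dec D a) (inv \<iota> i))),
    theta_space = measure_pmf (return_pmf 0),
    struct_eq = (\<lambda>t i w u. dec (Tab (inv \<iota> i)) u (\<lambda>q\<in>{1..m} - {inv \<iota> i}. w (\<iota> q))) \<rparr>"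

lemma G_simps [simp]:
  "sample G = measure_pmf (map_pmf (enc D) D)"
  "latent_alph G e = {..<B (Min (inv \<iota> ` e)) (Max (inv \<iota> ` e))}"
  "latent G e a = fst (dec D a) (Min (inv \<iota> ` e)) (Max (inv \<iota> ` e))"
  "loc_space G i = count_space UNIV"
  "loc G i a = enc (Tab (inv \<iota> i)) (snd (dec D a) (inv \<iota> i))"
  "theta_space G = measure_pmf (return_pmf 0)"
  "struct_eq G t i w u = dec (Tab (inv \<iota> i)) u (\<lambda>q\<in>{1..m} - {inv \<iota> i}. w (\<iota> q))"
  by (simp_all add: G_def)

lemma inv_iota [simp]: "inv \<iota> (\<iota> p) = p" "\<iota> (inv \<iota> i) = i"
  using permutes_inverses[OF perm] by auto

lemma inv_in: "i \<in> {1..m} \<Longrightarrow> inv \<iota> i \<in> {1..m}"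
  using permutes_in_image[OF permutes_inv[OF perm]] by blast

lemma finite_kernel: "finite (set_pmf (\<kappa> p z))"
  by (rule finite_subset[of _ "PiE {p<..m} (\<lambda>q. {..<B p q})"]) (auto intro!: finite_PiE range)

lemma finite_V: "finite (V p)"
  unfolding V_def by (intro finite_PiE) auto

lemma chain_bound:
  assumes "s \<in> set_pmf (chain \<kappa> m)" "(p, q) \<in> edges m"
  shows "s p q < B p q"
proof -
  obtain z where "s p \<in> set_pmf (\<kappa> p z)" using chain_kernel[OF assms(1), of p] assms(2) by (auto simp: edges_def)
  from PiE_mem[OF range[OF this], of q] assms(2) show ?thesis by (simp add: edges_def)
qed

lemma fst_dec: "fst (dec D a) \<in> set_pmf (chain \<kappa> m)"
  using dec_in[of D a] by (auto simp: D_def)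

lemma loc_prob:
  assumes J: "J \<subseteq> {1..m}"
  shows "measure_pmf.prob (map_pmf (enc D) D) {a. \<forall>j\<in>J. loc G j a \<in> A j}
    = (\<Prod>j\<in>J. measure_pmf.prob (Tab (inv \<iota> j)) {T. enc (Tab (inv \<iota> j)) T \<in> A j})"
proof -
  let ?E = "\<lambda>i. if i \<in> J then {T. enc (Tab (inv \<iota> i)) T \<in> A i} else UNIV"
  have "measure_pmf.prob (map_pmf (enc D) D) {a. \<forall>j\<in>J. loc G j a \<in> A j}
    = measure_pmf.prob D {x. (\<lambda>_. True) (fst x) \<and> (\<forall>j\<in>J. enc (Tab (inv \<iota> j)) (snd x (inv \<iota> j)) \<in> A j)}"
    using prob_dec[of D "\<lambda>x. \<forall>j\<in>J. enc (Tab (inv \<iota> j)) (snd x (inv \<iota> j)) \<in> A j"] by simp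
  also have "\<dots> = measure_pmf.prob (Pi_pmf {1..m} undefined Tab) {y. \<forall>j\<in>J. enc (Tab (inv \<iota> j)) (y (inv \<iota> j)) \<in> A j}"
    unfolding D_def by (subst prob_pair[of _ _ "\<lambda>_. True"]) simp
  also have "{y. \<forall>j\<in>J. enc (Tab (inv \<iota> j)) (y (inv \<iota> j)) \<in> A j} = Pi {1..m} (\<lambda>p. ?E (\<iota> p))"
  proof (intro set_eqI iffI)
    fix y assume y: "y \<in> Pi {1..m} (\<lambda>p. ?E (\<iota> p))"
    have "enc (Tab (inv \<iota> j)) (y (inv \<iota> j)) \<in> A j" if "j \<in> J" for j
      using Pi_mem[OF y inv_in[of j]] that J by auto
    then show "y \<in> {y. \<forall>j\<in>J. enc (Tab (inv \<iota> j)) (y (inv \<iota> j)) \<in> A j}" by simp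
  next
    fix y assume y: "y \<in> {y. \<forall>j\<in>J. enc (Tab (inv \<iota> j)) (y (inv \<iota> j)) \<in> A j}"
    show "y \<in> Pi {1..m} (\<lambda>p. ?E (\<iota> p))"
    proof (rule Pi_I)
      fix p
      show "y p \<in> ?E (\<iota> p)"
      proof (cases "\<iota> p \<in> J")
        case True
        then have "enc (Tab (inv \<iota> (\<iota> p))) (y (inv \<iota> (\<iota> p))) \<in> A (\<iota> p)" using y by blast
        then show ?thesis using True by simp
      qed simp
    qed
  qed
  also have "measure_pmf.prob (Pi_pmf {1..m} undefined Tab) (Pi {1..m} (\<lambda>p. ?E (\<iota> p))) = (\<Prod>p=1..m. measure_pmf.prob (Tab p) (?E (\<iota> p)))"
    by (simp add: measure_Pi_pmf_Pi)
  also have "\<dots> = (\<Prod>i=1..m. measure_pmf.prob (Tab (inv \<iota> i)) (?E i))"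
    by (subst prod.permute[OF permutes_inv[OF perm]]) (simp add: comp_def cong: if_cong)
  also have "\<dots> = (\<Prod>j\<in>J. measure_pmf.prob (Tab (inv \<iota> j)) (?E j))"
    using J by (intro prod.mono_neutral_right) auto
  finally show ?thesis by simp
qed

lemma view_V:
  assumes i: "i \<in> {1..m}" and w: "w \<in> PiE ({1..m} - {i}) (\<lambda>j. latent_alph G {i, j})"
  shows "(\<lambda>q\<in>{1..m} - {inv \<iota> i}. w (\<iota> q)) \<in> V (inv \<iota> i)"
  unfolding V_def
proof (rule restrict_PiE_iff[THEN iffD2], rule ballI)
  fix q assume q: "q \<in> {1..m} - {inv \<iota> i}"
  then have "\<iota> q \<in> {1..m} - {i}" using permutes_in_image[OF perm, of q] by auto
  from PiE_mem[OF w this] q show "w (\<iota> q) \<in> {..<B (min (inv \<iota> i) q) (max (inv \<iota> i) q)}" by simp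
qed

lemma table_out:
  assumes "p \<in> {1..m}" "v \<in> V p"
  shows "dec (Tab p) u v \<in> PiE {..<L} (\<lambda>_. \<X> (\<iota> p))"
proof -
  have "dec (Tab p) u \<in> PiE_dflt (V p) undefined (set_pmf \<circ> Kh p)"
    using dec_in[of "Tab p" u] unfolding Tab_def by (simp add: set_Pi_pmf finite_V)
  then have "dec (Tab p) u v \<in> set_pmf (Kh p v)" using assms(2) by (simp add: PiE_dflt_def)
  then show ?thesis using Kh[OF assms(1)] by blast
qed

lemma latent_in: "e \<in> pairs m \<Longrightarrow> latent G e a \<in> latent_alph G e"
proof -
  assume "e \<in> pairs m"
  then obtain i j where e: "i \<in> {1..m}" "j \<in> {1..m}" "i \<noteq> j" "e = {i, j}" by (auto simp: pairs_def)
  have "inv \<iota> i \<noteq> inv \<iota> j" using e(3) inv_iota(2) by metis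
  then have "(Min (inv \<iota> ` e), Max (inv \<iota> ` e)) \<in> edges m"
    using inv_in[OF e(1)] inv_in[OF e(2)] by (auto simp: e(4) edges_def min_def max_def)
  from chain_bound[OF fst_dec this] show ?thesis by simp
qed

lemma latent_measurable_G: "e \<in> pairs m \<Longrightarrow> latent G e \<in> measurable (sample G) (count_space (latent_alph G e))"
  using latent_in unfolding measurable_def by auto

lemma is_causal_model_G: "is_causal_model m L \<X> G"
  unfolding is_causal_model_def
proof (intro conjI ballI)
  show "prob_space (sample G)" "prob_space (theta_space G)" by (simp_all add: measure_pmf.prob_space_axioms)
  fix e assume e: "e \<in> pairs m"
  show "finite (latent_alph G e)" by simp
  show "latent G e \<in> measurable (sample G) (count_space (latent_alph G e))"
    by (rule latent_measurable_G[OF e])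
next
  have "prob_space.indep_vars (measure_pmf (map_pmf (enc D) D)) (loc_space G) (loc G) {1..m}"
  proof (rule prob_space.indep_vars_of_prob[OF measure_pmf.prob_space_axioms])
    fix J :: "nat set" and A assume J: "J \<subseteq> {1..m}"
    have "measure_pmf.prob (map_pmf (enc D) D) {a. loc G j a \<in> A j} = measure_pmf.prob (Tab (inv \<iota> j)) {T. enc (Tab (inv \<iota> j)) T \<in> A j}"
      if "j \<in> J" for j
      using loc_prob[of "{j}" A] that J by (auto simp del: measure_map_pmf G_simps)
    then show "measure_pmf.prob (map_pmf (enc D) D) {a\<in>space (measure_pmf (map_pmf (enc D) D)). \<forall>j\<in>J. loc G j a \<in> A j}
        = (\<Prod>j\<in>J. measure_pmf.prob (map_pmf (enc D) D) {a\<in>space (measure_pmf (map_pmf (enc D) D)). loc G j a \<in> A j})"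
      using loc_prob[OF J, of A] by (simp del: measure_map_pmf G_simps)
  qed simp
  then show "prob_space.indep_vars (sample G) (loc_space G) (loc G) {1..m}" by simp
next
  fix i w assume i: "i \<in> {1..m}" and w: "w \<in> PiE ({1..m} - {i}) (\<lambda>j. latent_alph G {i, j})"
  have "(\<lambda>u. struct_eq G 0 i w u) \<in> measurable (count_space UNIV) (count_space (block_alph L \<X> i))"
    using table_out[OF inv_in[OF i] view_V[OF i w]] by (simp add: block_alph_def)
  from measurable_compose[OF measurable_snd this]
  show "(\<lambda>(t, u). struct_eq G t i w u) \<in> measurable (theta_space G \<Otimes>\<^sub>M loc_space G i) (count_space (block_alph L \<X> i))"
    by (simp add: case_prod_unfold)
qed

lemma sources_independent_G: "sources_independent m G"
  unfolding sources_independent_def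
proof (intro conjI ballI impI)
  let ?Lat = "\<lambda>s. \<lambda>e\<in>pairs m. s (Min (inv \<iota> ` e)) (Max (inv \<iota> ` e))"
  let ?Lc = "\<lambda>T. \<lambda>i\<in>{1..m}. enc (Tab (inv \<iota> i)) (T (inv \<iota> i))"
  have lat: "(\<lambda>a. \<lambda>e\<in>pairs m. latent G e a) \<in> measurable (sample G) (PiM (pairs m) (\<lambda>e. count_space (latent_alph G e)))"
    by (intro measurable_restrict latent_measurable_G)
  have loc: "(\<lambda>a. \<lambda>i\<in>{1..m}. loc G i a) \<in> measurable (sample G) (PiM {1..m} (loc_space G))"
    by (intro measurable_restrict) simp
  show "mutual_info (sample G) (PiM (pairs m) (\<lambda>e. count_space (latent_alph G e))) (PiM {1..m} (loc_space G))
      (\<lambda>a. \<lambda>e\<in>pairs m. latent G e a) (\<lambda>a. \<lambda>i\<in>{1..m}. loc G i a) = 0"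
  proof (subst mutual_info_eq_0_iff[OF _ lat loc], goal_cases)
    case 2
    show ?case
    proof (intro ballI)
      fix A A'
      have "measure_pmf.prob (map_pmf (enc D) D) {a. ?Lat (fst (dec D a)) \<in> A \<and> ?Lc (snd (dec D a)) \<in> A'}
        = measure_pmf.prob (chain \<kappa> m) {s. ?Lat s \<in> A} * measure_pmf.prob (Pi_pmf {1..m} undefined Tab) {T. ?Lc T \<in> A'}"
        using prob_dec[of D "\<lambda>x. ?Lat (fst x) \<in> A \<and> ?Lc (snd x) \<in> A'"]
          prob_pair[of "chain \<kappa> m" "Pi_pmf {1..m} undefined Tab" "\<lambda>s. ?Lat s \<in> A" "\<lambda>T. ?Lc T \<in> A'"] by (simp only: D_def)
      moreover have "measure_pmf.prob (map_pmf (enc D) D) {a. ?Lat (fst (dec D a)) \<in> A} = measure_pmf.prob (chain \<kappa> m) {s. ?Lat s \<in> A}"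
        using prob_dec[of D "\<lambda>x. ?Lat (fst x) \<in> A \<and> True"]
          prob_pair[of "chain \<kappa> m" "Pi_pmf {1..m} undefined Tab" "\<lambda>s. ?Lat s \<in> A" "\<lambda>T. True"] by (simp add: D_def)
      moreover have "measure_pmf.prob (map_pmf (enc D) D) {a. ?Lc (snd (dec D a)) \<in> A'} = measure_pmf.prob (Pi_pmf {1..m} undefined Tab) {T. ?Lc T \<in> A'}"
        using prob_dec[of D "\<lambda>x. True \<and> ?Lc (snd x) \<in> A'"]
          prob_pair[of "chain \<kappa> m" "Pi_pmf {1..m} undefined Tab" "\<lambda>s. True" "\<lambda>T. ?Lc T \<in> A'"] by (simp add: D_def)
      ultimately show "measure (sample G) {a\<in>space (sample G). (\<lambda>e\<in>pairs m. latent G e a) \<in> A \<and> (\<lambda>i\<in>{1..m}. loc G i a) \<in> A'}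
        = measure (sample G) {a\<in>space (sample G). (\<lambda>e\<in>pairs m. latent G e a) \<in> A} * measure (sample G) {a\<in>space (sample G). (\<lambda>i\<in>{1..m}. loc G i a) \<in> A'}"
        by (simp del: measure_map_pmf)
    qed
  qed (simp add: measure_pmf.prob_space_axioms)
  fix i j assume ij: "i \<in> {1..m}" "j \<in> {1..m}" "i \<noteq> j"
  show "mutual_info (sample G) (loc_space G i) (loc_space G j) (loc G i) (loc G j) = 0"
  proof (subst mutual_info_eq_0_iff, goal_cases)
    case 4
    show ?case
    proof (intro ballI)
      fix A A' :: "real set"
      have "measure_pmf.prob (map_pmf (enc D) D) {a. loc G i a \<in> A \<and> loc G j a \<in> A'}
        = measure_pmf.prob (map_pmf (enc D) D) {a. loc G i a \<in> A} * measure_pmf.prob (map_pmf (enc D) D) {a. loc G j a \<in> A'}"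
        using loc_prob[of "{i, j}" "\<lambda>k. if k = i then A else A'"] loc_prob[of "{i}" "\<lambda>_. A"] loc_prob[of "{j}" "\<lambda>_. A'"] ij
        by (simp del: measure_map_pmf G_simps)
      then show "measure (sample G) {a\<in>space (sample G). loc G i a \<in> A \<and> loc G j a \<in> A'}
        = measure (sample G) {a\<in>space (sample G). loc G i a \<in> A} * measure (sample G) {a\<in>space (sample G). loc G j a \<in> A'}"
        by (simp del: measure_map_pmf)
    qed
  qed (simp_all add: measure_pmf.prob_space_axioms)
qed

sublocale causal_network m L \<X> G \<iota>
  by unfold_locales (use is_causal_model_G perm fin\<X> m sources_independent_G in auto)

text \<open>Extensional rows make the assignments of the chain canonical already, so reading them
  back from the latent variables of the model returns them unchanged.\<close>

lemma P_eq_chain: "P = chain \<kappa> m"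
proof -
  have W: "W a = fst (dec D a)" for a
  proof -
    have "fst (dec D a) p q = undefined" if "(p, q) \<notin> edges m" for p q
    proof (cases "p \<in> {1..m}")
      case True
      then obtain z where "fst (dec D a) p \<in> set_pmf (\<kappa> p z)" using chain_kernel[OF fst_dec] by blast
      from PiE_arb[OF range[OF this], of q] show ?thesis using that True by (auto simp: edges_def)
    qed (simp add: chain_undefined[OF fst_dec])
    moreover have "W a p q = fst (dec D a) p q" if "(p, q) \<in> edges m" for p q
      using that by (simp add: W_entry edges_def)
    moreover have "W a p q = undefined" if "(p, q) \<notin> edges m" for p q
      using that by (subst canon_W[symmetric]) (simp add: canon_def)
    ultimately show ?thesis by (intro ext) metis
  qed
  show ?thesis
  proof (rule pmf_eqI)
    fix s
    have "pmf P s = measure_pmf.prob (map_pmf (enc D) D) {a. fst (dec D a) = s}"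
      unfolding P_def pmf_law[OF prob_S simple_W] by (auto simp: W intro!: arg_cong2[where f = measure] simp del: measure_map_pmf)
    also have "\<dots> = measure_pmf.prob D {x. fst x = s \<and> True}" using prob_dec[of D "\<lambda>x. fst x = s"] by simp
    also have "\<dots> = pmf (chain \<kappa> m) s"
      unfolding D_def using prob_pair[of "chain \<kappa> m" "Pi_pmf {1..m} undefined Tab" "\<lambda>t. t = s" "\<lambda>_. True"] by (simp add: measure_pmf_single)
    finally show "pmf P s = pmf (chain \<kappa> m) s" .
  qed
qed

lemma latents_ordered_G: "latents_ordered m \<iota> G"
  unfolding latents_ordered_iff_markov P_eq_chain
  using range by (intro markov_chain finite_kernel) (auto simp: PiE_def)

text \<open>Reading a table of independent entries at one view gives the law prescribed for that
  view.\<close>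

lemma K_eq: 
  assumes p: "p \<in> {1..m}" and v: "v \<in> V p"
  shows "K 0 p v = Kh p v"
proof (rule pmf_eqI)
  fix y
  have views: "views p = V p"
    unfolding views_def V_def by (intro PiE_cong) simp
  have lab: "(\<lambda>q\<in>{1..m} - {p}. lab p v (\<iota> q)) = v"
  proof
    fix q show "(\<lambda>q\<in>{1..m} - {p}. lab p v (\<iota> q)) q = v q"
    proof (cases "q \<in> {1..m} - {p}")
      case True
      then have "\<iota> q \<in> {1..m} - {\<iota> p}" using permutes_in_image[OF perm, of q] iota_eq[of q p] by blast
      then show ?thesis using True by (simp only: restrict_apply' lab_def inv_iota)
    next
      case False
      then show ?thesis using PiE_arb[OF v[unfolded V_def] False] by (simp only: restrict_def if_False)
    qed
  qed
  have "pmf (K 0 p v) y = measure (sample G) (out 0 p v -` {y} \<inter> space (sample G))"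
    using v by (intro pmf_K p) (auto simp: views)
  also have "\<dots> = measure_pmf.prob (map_pmf (enc D) D) {a. dec (Tab p) (enc (Tab p) (snd (dec D a) p)) v = y}"
    by (auto simp: out_def[abs_def] lab[simplified] vimage_def simp del: measure_map_pmf)
  also have "\<dots> = measure_pmf.prob D {x. True \<and> dec (Tab p) (enc (Tab p) (snd x p)) v = y}"
    using prob_dec[of D "\<lambda>x. dec (Tab p) (enc (Tab p) (snd x p)) v = y"] by simp
  also have "\<dots> = measure_pmf.prob (Pi_pmf {1..m} undefined Tab) {T. dec (Tab p) (enc (Tab p) (T p)) v = y}"
    unfolding D_def by (subst prob_pair[of _ _ "\<lambda>_. True"]) simp
  also have "\<dots> = measure_pmf.prob (map_pmf (\<lambda>T. T p) (Pi_pmf {1..m} undefined Tab)) {T. dec (Tab p) (enc (Tab p) T) v = y}"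
    by (simp add: vimage_def)
  also have "map_pmf (\<lambda>T. T p) (Pi_pmf {1..m} undefined Tab) = Tab p"
    using p by (simp add: Pi_pmf_component)
  also have "measure_pmf.prob (Tab p) {T. dec (Tab p) (enc (Tab p) T) v = y} = measure_pmf.prob (Tab p) {T. T v = y}"
    by (intro measure_pmf.finite_measure_eq_AE AE_pmfI) (auto simp: dec_enc)
  also have "\<dots> = pmf (map_pmf (\<lambda>T. T v) (Tab p)) y" by (simp add: pmf_map vimage_def)
  also have "map_pmf (\<lambda>T. T v) (Tab p) = Kh p v"
    unfolding Tab_def using v finite_V by (simp add: Pi_pmf_component)
  finally show "pmf (K 0 p v) y = pmf (Kh p v) y" .
qed

lemma outputs_eq:
  "map_pmf snd (network m P (K 0)) = bind_pmf (chain \<kappa> m) (\<lambda>s. Pi_pmf {1..m} undefined (\<lambda>p. Kh p (view m p s)))"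
  unfolding map_snd_network P_eq_chain
proof (intro bind_pmf_cong refl Pi_pmf_cong)
  fix s p assume s: "s \<in> set_pmf (chain \<kappa> m)" and p: "p \<in> {1..m}"
  have "view m p s \<in> V p"
    unfolding V_def view_def
  proof (rule restrict_PiE_iff[THEN iffD2], rule ballI)
    fix q assume "q \<in> {1..m} - {p}"
    then show "(if q < p then s q p else s p q) \<in> {..<B (min p q) (max p q)}"
      using chain_bound[OF s, of p q] chain_bound[OF s, of q p] p by (auto simp: edges_def min_def max_def)
  qed
  then show "K 0 p (view m p s) = Kh p (view m p s)" by (rule K_eq[OF p])
qed

lemma model_rate_G: "model_rate m L G = (\<Sum>(p, q)\<in>edges m. log 2 (real (B p q))) / L"
proof -
  have "(\<Sum>e\<in>pairs m. log 2 (real (card (latent_alph G e)))) = (\<Sum>(p, q)\<in>edges m. log 2 (real (B p q)))"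
    unfolding sum_pairs by (intro sum.cong refl) (auto simp: edges_def)
  then show ?thesis by (simp add: model_rate_def)
qed

end

section \<open>Converse and achievability for one block length\<close>

context source
begin

abbreviation tv :: "nat \<Rightarrow> 'x causal_model \<Rightarrow> real \<Rightarrow> real" where
  "tv n G t \<equiv> tv_dist (observed_law m n \<X> G t) (iid_law m n \<X> PX)"

definition mean_tv :: "nat \<Rightarrow> 'x causal_model \<Rightarrow> real" where
  "mean_tv n G = (LINT t|theta_space G. tv n G t)"

definition mean_residual :: "nat \<Rightarrow> 'x causal_model \<Rightarrow> nat \<Rightarrow> real" where
  "mean_residual n G i = (LINT t|theta_space G. cond_entropy (sample G) (neighbours m G i) (observed m G t i))"

definition admissible :: "(nat \<Rightarrow> nat) \<Rightarrow> nat \<Rightarrow> 'x causal_model \<Rightarrow> bool" where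
  "admissible \<iota> n G \<longleftrightarrow> is_causal_model m n \<X> G \<and> latents_ordered m \<iota> G \<and> sources_independent m G"

lemma admissible_network:
  assumes "admissible \<iota> n G" "\<iota> permutes {1..m}"
  shows "causal_network m n \<X> G \<iota>"
  using assms fin\<X> m by (simp add: admissible_def causal_network_def ordered_model_def causal_network_axioms_def)

context
  fixes \<iota> n G
  assumes adm: "admissible \<iota> n G" and perm: "\<iota> permutes {1..m}"
begin

interpretation N: causal_network m n \<X> G \<iota>
  by (rule admissible_network[OF adm perm])

lemma close_R:
  assumes t: "t \<in> space (theta_space G)"
  shows "close (tv n G t) (N.R t) (iid_blocks m n pX)"
  by (rule close_tv_dist[OF N.observed_law_R(1)[OF t] prob_iid_law N.observed_law_R(2)[OF t]
        N.observed_law_R(3)[OF t] N.set_R[OF t] measure_iid_law set_iid_blocks])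

lemma tv_bounds: "t \<in> space (theta_space G) \<Longrightarrow> 0 \<le> tv n G t \<and> tv n G t \<le> 1"
  using tv_dist_bounds(2,3)[OF N.observed_law_R(1) prob_iid_law] by simp

lemma mean_tv_nonneg: "0 \<le> mean_tv n G"
  unfolding mean_tv_def using tv_bounds by (intro integral_nonneg_AE AE_I2) simp

lemma mean_residual_eq: "i \<in> {1..m} \<Longrightarrow> mean_residual n G i = (LINT t|theta_space G. residual m N.P (N.K t) (inv \<iota> i))"
  unfolding mean_residual_def
proof (rule Bochner_Integration.integral_cong[OF refl])
  fix t assume i: "i \<in> {1..m}" and t: "t \<in> space (theta_space G)"
  show "cond_entropy (sample G) (neighbours m G i) (observed m G t i) = residual m N.P (N.K t) (inv \<iota> i)"
    using N.cond_entropy_eq_residual[OF t, of "inv \<iota> i"] i by simp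
qed

lemma mean_residual_nonneg: "i \<in> {1..m} \<Longrightarrow> 0 \<le> mean_residual n G i"
  unfolding mean_residual_eq using N.residual_bounds(1) by (intro integral_nonneg_AE AE_I2)

text \<open>For each choice of structural equations, \<open>sum_ent_lo_ge\<close> at the position of
  party \<open>i\<close> places its residual and the correlation together below the logarithms of
  the alphabet sizes. The resulting bound is affine in the total variation distance, so it can be
  averaged directly.\<close>

lemma mean_residual_le:
  assumes i: "i \<in> {1..m}" and n: "n \<ge> 1"
  shows "mean_residual n G i \<le> n * (model_rate m n G - C) + 2 * (m + 1) + 2 * mean_tv n G * (n * lsize)"
proof -
  let ?p = "inv \<iota> i"
  have p: "?p \<in> {1..m}" using i by simp
  have rate: "n * model_rate m n G = (\<Sum>e\<in>pairs m. log 2 (real (card (latent_alph G e))))"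
    using n by (simp add: model_rate_def)
  interpret T: prob_space "theta_space G" by (rule N.prob_theta)
  have pt: "residual m N.P (N.K t) ?p \<le> n * (model_rate m n G - C) + 2 * (m + 1) + 2 * tv n G t * (n * lsize)"
    if t: "t \<in> space (theta_space G)" for t
  proof -
    interpret markov_network m N.P "N.K t"
      using adm t by (intro N.markov_network) (simp_all add: admissible_def)
    have "correlation m (N.R t) + residual m N.P (N.K t) ?p \<le> n * model_rate m n G"
      using sum_ent_lo_ge[OF p] sum_ent_lo_le_edges N.sum_ent_edges_le unfolding rate N.correlation_R[OF t] by linarith
    moreover have "n * C \<le> correlation m (N.R t) + 2 * (m + 1) + 2 * tv n G t * (n * lsize)"
      using tv_bounds[OF t] by (intro correlation_near(2) N.set_R t close_R) simp
    ultimately show ?thesis by (simp add: right_diff_distrib)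
  qed
  have int: "integrable (theta_space G) (\<lambda>t. tv n G t)" by (rule N.tv_integrable[OF prob_iid_law])
  have "mean_residual n G i \<le> (LINT t|theta_space G. n * (model_rate m n G - C) + 2 * (m + 1) + 2 * tv n G t * (n * lsize))"
    unfolding mean_residual_eq[OF i] using int by (intro integral_mono N.residual_integrable pt) auto
  also have "\<dots> = n * (model_rate m n G - C) + 2 * (m + 1) + 2 * mean_tv n G * (n * lsize)"
    unfolding mean_tv_def using int by (simp add: T.prob_space)
  finally show ?thesis .
qed

text \<open>The distance and all residuals have to be small for the same \<open>t\<close>; averaging
  their sum ensures this.\<close>

lemma good_choice:
  fixes \<delta> :: real
  assumes n: "n \<ge> 1" and \<delta>: "\<And>i. i \<in> {1..m} \<Longrightarrow> mean_residual n G i \<le> n * \<delta>"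
  shows "\<exists>t\<in>space (theta_space G). tv n G t + (\<Sum>p=1..m. residual m N.P (N.K t) p) / n \<le> mean_tv n G + m * \<delta>"
proof (rule ccontr)
  interpret T: prob_space "theta_space G" by (rule N.prob_theta)
  let ?f = "\<lambda>t. tv n G t + (\<Sum>p=1..m. residual m N.P (N.K t) p) / n"
  assume "\<not> ?thesis"
  then have less: "mean_tv n G + m * \<delta> < ?f t" if "t \<in> space (theta_space G)" for t using that by force
  have int: "integrable (theta_space G) (\<lambda>t. tv n G t)" by (rule N.tv_integrable[OF prob_iid_law])
  have int': "integrable (theta_space G) ?f"
    by (intro Bochner_Integration.integrable_add int Bochner_Integration.integrable_divide Bochner_Integration.integrable_sum N.residual_integrable)
  have "T.expectation (\<lambda>_. mean_tv n G + m * \<delta>) < T.expectation ?f"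
    by (rule T.integral_less_AE_space) (use int' less in \<open>auto simp: T.emeasure_space_1\<close>)
  moreover have "T.expectation ?f = mean_tv n G + (\<Sum>p=1..m. T.expectation (\<lambda>t. residual m N.P (N.K t) p)) / n"
    using int N.residual_integrable by (simp add: mean_tv_def)
  moreover have "(\<Sum>p=1..m. T.expectation (\<lambda>t. residual m N.P (N.K t) p)) \<le> (\<Sum>p=1..m. n * \<delta>)"
  proof (rule sum_mono)
    fix p assume "p \<in> {1..m}"
    then show "T.expectation (\<lambda>t. residual m N.P (N.K t) p) \<le> n * \<delta>"
      using \<delta>[of "\<iota> p"] mean_residual_eq[of "\<iota> p"] by simp
  qed
  then have "(\<Sum>p=1..m. T.expectation (\<lambda>t. residual m N.P (N.K t) p)) / n \<le> m * \<delta>"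
    using n by (simp add: field_simps)
  ultimately show False by (simp add: T.prob_space)
qed

text \<open>The source with its coordinates in position order, the order in which a network lists
  its outputs.\<close>

definition pXp :: "(nat \<Rightarrow> 'x) pmf" where
  "pXp = map_pmf (\<lambda>x p. x (\<iota> p)) pX"

lemma iid_blocks_pXp: "iid_blocks m l pXp = map_pmf (\<lambda>x. \<lambda>p\<in>{1..m}. \<lambda>k\<in>{..<l}. x k (\<iota> p)) (Pi_pmf {..<l} undefined (\<lambda>_. pX))"
proof -
  have "Pi_pmf {..<l} undefined (\<lambda>_. pXp) = map_pmf (\<lambda>x. \<lambda>k\<in>{..<l}. \<lambda>p. x k (\<iota> p)) (Pi_pmf {..<l} undefined (\<lambda>_. pX))"
    unfolding pXp_def by (rule Pi_pmf_map_restrict) simp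
  then show ?thesis
    unfolding iid_blocks_def by (simp add: map_pmf_comp) (intro map_pmf_cong refl; auto simp: fun_eq_iff)
qed

lemma relab_iid_blocks: "map_pmf (\<lambda>y. \<lambda>i\<in>{1..m}. y (inv \<iota> i)) (iid_blocks m l pXp) = iid_blocks m l pX"
  unfolding iid_blocks_pXp unfolding iid_blocks_def map_pmf_comp
  by (intro map_pmf_cong refl) (auto simp: fun_eq_iff)

lemma unrelab_iid_blocks: "map_pmf (\<lambda>y. \<lambda>p\<in>{1..m}. y (\<iota> p)) (iid_blocks m l pX) = iid_blocks m l pXp"
  unfolding iid_blocks_pXp unfolding iid_blocks_def map_pmf_comp
  by (intro map_pmf_cong refl) (auto simp: fun_eq_iff)

lemma close_outputs:
  assumes t: "t \<in> space (theta_space G)" and e: "close e (N.R t) (iid_blocks m n pX)"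
  shows "close e (map_pmf snd (network m N.P (N.K t))) (iid_blocks m n pXp)"
proof -
  have eq: "map_pmf (\<lambda>y. \<lambda>p\<in>{1..m}. y (\<iota> p)) (N.R t) = map_pmf (\<lambda>y. y) (map_pmf snd (network m N.P (N.K t)))"
    unfolding N.R_def map_pmf_comp[of _ N.relab]
  proof (intro map_pmf_cong refl)
    fix y assume "y \<in> set_pmf (map_pmf snd (network m N.P (N.K t)))"
    then have y: "y \<in> PiE {1..m} N.blk" by (rule subsetD[OF N.set_outputs[OF t]])
    show "(\<lambda>p\<in>{1..m}. N.relab y (\<iota> p)) = y"
    proof
      fix p show "(\<lambda>p\<in>{1..m}. N.relab y (\<iota> p)) p = y p"
        using PiE_arb[OF y, of p] by (cases "p \<in> {1..m}") (auto simp: N.relab_def)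
    qed
  qed
  from close_map[OF e, of "\<lambda>y. \<lambda>p\<in>{1..m}. y (\<iota> p)"] show ?thesis
    unfolding eq unrelab_iid_blocks by (simp only: map_pmf_ident)
qed

lemma lsize_ge:
  assumes p: "p \<in> {1..m}"
  shows "log 2 (card (N.blk p)) \<le> n * lsize"
proof -
  have ip: "\<iota> p \<in> {1..m}" using p by simp
  have pos: "card (\<X> i) \<ge> 1" if "i \<in> {1..m}" for i
    using that fin\<X> \<X>_ne by (simp add: Suc_leI card_gt_0_iff)
  have "log 2 (card (\<X> (\<iota> p))) \<le> lsize"
    unfolding lsize_def
  proof (rule member_le_sum[OF ip])
    fix i assume "i \<in> {1..m} - {\<iota> p}"
    then show "0 \<le> log 2 (card (\<X> i))" using pos[of i] by simp
  qed simp
  then have "n * log 2 (card (\<X> (\<iota> p))) \<le> n * lsize" by (rule mult_left_mono) simp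
  then show ?thesis using pos[OF ip] by (simp add: N.blk_def block_alph_def card_PiE log_nat_power)
qed

text \<open>Everything is measured per symbol: tolerance, cut-off and entropy bound are multiples of
  \<open>n\<close>, so \<open>n\<close> cancels from the Chebyshev term.\<close>

lemma achieve_step:
  fixes l N :: nat and \<epsilon> \<eta> :: real
  assumes n: "n \<ge> 1" and N: "N \<ge> 1" and l: "l \<ge> 1" "l \<le> N * n" and \<epsilon>: "\<epsilon> > 0" and \<eta>: "\<eta> \<le> 1"
    and t: "t \<in> space (theta_space G)" and small: "tv n G t + (\<Sum>p=1..m. residual m N.P (N.K t) p) / n \<le> \<eta>"
  shows "\<exists>G'. admissible \<iota> l G' \<and>
    mean_tv l G' \<le> card (edges m) * (2 * (N * (2 powr (- real n) + \<eta>) + (lsize + 2) * (lsize + 1) / (N * \<epsilon>\<^sup>2)) + 2 * 2 powr (- (N * (n * \<epsilon>)))) + N * \<eta> \<and>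
    model_rate m l G' \<le> (N * (n * C + 2 * (m + 1) + 2 * \<eta> * (n * lsize) + n * \<eta>) + card (edges m) * (2 * N * (n * \<epsilon>) + 1)) / l"
proof -
  interpret MN: markov_network m N.P "N.K t"
    using adm t by (intro N.markov_network) (simp_all add: admissible_def)
  have n0: "real n > 0" using n by simp
  have tv0: "0 \<le> tv n G t" using tv_bounds[OF t] by simp
  have res_sum: "(\<Sum>p=1..m. residual m N.P (N.K t) p) \<le> n * \<eta>"
  proof -
    have "(\<Sum>p=1..m. residual m N.P (N.K t) p) / n \<le> \<eta>" using small tv0 by linarith
    then show ?thesis unfolding pos_divide_le_eq[OF n0] by (simp only: mult.commute)
  qed
  have res: "residual m N.P (N.K t) p \<le> n * \<eta>" if "p \<in> {1..m}" for p
    using member_le_sum[OF that, of "residual m N.P (N.K t)"] N.residual_bounds(1)[OF t] res_sum by force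
  have \<eta>0: "\<eta> \<ge> 0" using small tv0 sum_nonneg[of "{1..m}" "residual m N.P (N.K t)"] N.residual_bounds(1)[OF t]
    by (smt (verit) divide_nonneg_nonneg of_nat_0_le_iff)
  have tv\<eta>: "tv n G t \<le> \<eta>"
    using small sum_nonneg[of "{1..m}" "residual m N.P (N.K t)"] N.residual_bounds(1)[OF t]
    by (smt (verit) divide_nonneg_nonneg of_nat_0_le_iff)
  have cl: "close \<eta> (N.R t) (iid_blocks m n pX)" by (rule close_mono[OF close_R[OF t] tv\<eta>])
  let ?T = "n * (lsize + 2)" and ?H = "n * (lsize + 1)"
  have H: "ent N.P (view m p) \<le> ?H" if p: "p \<in> {1..m}" for p
  proof -
    have "ent N.P (view m p) \<le> log 2 (card (N.blk p)) + residual m N.P (N.K t) p"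
      by (rule MN.ent_view_le[OF N.finite_blk[OF p] p N.set_K[OF t p]])
    also have "\<dots> \<le> n * lsize + n * \<eta>" by (intro add_mono lsize_ge res p)
    also have "\<dots> \<le> ?H" using \<eta> n0 by (simp add: distrib_left)
    finally show ?thesis .
  qed
  have tail: "measure_pmf.prob N.P {w. info N.P (view m p) w > ?T} \<le> 2 powr (- real n) + \<eta>" if p: "p \<in> {1..m}" for p
  proof -
    have "measure_pmf.prob N.P {w. info N.P (view m p) w > ?T}
      \<le> measure_pmf.prob N.P {w. info N.P (view m p) w > log 2 (card (N.blk p)) + 2 * real n}"
      using lsize_ge[OF p] by (intro measure_pmf.finite_measure_mono) (auto simp: algebra_simps)
    also have "\<dots> \<le> 2 powr (- real n) + residual m N.P (N.K t) p / n"
      by (rule MN.info_view_tail[OF N.finite_blk[OF p] p N.set_K[OF t p] n0])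
    also have "\<dots> \<le> 2 powr (- real n) + \<eta>" using res[OF p] n0 by (simp add: field_simps)
    finally show ?thesis .
  qed
  have K: "set_pmf (N.K t p v) \<subseteq> PiE {..<n} (\<lambda>_. \<X> (\<iota> p))" if "p \<in> {1..m}" for p v
    using N.set_K[OF t that] by (simp add: N.blk_def block_alph_def)
  have pos: "n > 0" "N > 0" "n * \<epsilon> > 0" "?T > 0" using n N \<epsilon> lsize_nonneg by auto
  have fp: "finite (set_pmf pXp)" unfolding pXp_def using finite_pX by simp
  let ?err = "card (edges m) * (2 * (N * (2 powr (- real n) + \<eta>) + ?T * ?H / (N * (n * \<epsilon>)\<^sup>2)) + 2 * 2 powr (- (N * (n * \<epsilon>)))) + N * \<eta>"
  have "\<exists>\<kappa> Kh B. (\<forall>p q. B p q > 0) \<and> (\<forall>p z. \<forall>r\<in>set_pmf (\<kappa> p z). r \<in> PiE {p<..m} (\<lambda>q. {..<B p q})) \<and>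
    (\<Sum>(p, q)\<in>edges m. log 2 (real (B p q))) \<le> N * (\<Sum>q=1..m. ent N.P (lo q)) + card (edges m) * (2 * N * (n * \<epsilon>) + 1) \<and>
    (\<forall>i\<in>{1..m}. \<forall>v. set_pmf (Kh i v) \<subseteq> PiE {..<l} (\<lambda>_. \<X> (\<iota> i))) \<and>
    close ?err (bind_pmf (chain \<kappa> m) (\<lambda>s. Pi_pmf {1..m} undefined (\<lambda>i. Kh i (view m i s)))) (iid_blocks m l pXp)"
    by (rule simulation[OF MN.markov_network_axioms pos(1,2) l(2) pos(3,4) H tail close_outputs[OF t cl] fp K])
  then obtain \<kappa> Kh B where range: "\<forall>p z. \<forall>r\<in>set_pmf (\<kappa> p z). r \<in> PiE {p<..m} (\<lambda>q. {..<B p q})"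
    and rate: "(\<Sum>(p, q)\<in>edges m. log 2 (real (B p q))) \<le> N * (\<Sum>q=1..m. ent N.P (lo q)) + card (edges m) * (2 * N * (n * \<epsilon>) + 1)"
    and Kh: "\<forall>i\<in>{1..m}. \<forall>v. set_pmf (Kh i v) \<subseteq> PiE {..<l} (\<lambda>_. \<X> (\<iota> i))"
    and cl': "close ?err (bind_pmf (chain \<kappa> m) (\<lambda>s. Pi_pmf {1..m} undefined (\<lambda>i. Kh i (view m i s)))) (iid_blocks m l pXp)"
    by (elim exE conjE) (rule that)
  interpret Q: chain_model m l \<X> \<iota> \<kappa> B Kh
    by unfold_locales (fact m, fact perm, fact fin\<X>, use range in blast, use Kh in blast)
  have "admissible \<iota> l Q.G"
    unfolding admissible_def using Q.is_causal_model_G Q.latents_ordered_G Q.sources_independent_G by simp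
  moreover have "mean_tv l Q.G \<le> ?err"
  proof -
    have t0: "0 \<in> space (theta_space Q.G)" by simp
    have "map_pmf Q.relab (iid_blocks m l pXp) = iid_blocks m l pX"
      using relab_iid_blocks[of l] by (simp add: Q.relab_def[abs_def])
    then have c: "close ?err (Q.R 0) (iid_blocks m l pX)"
      using close_map[OF cl', of Q.relab] by (simp only: Q.R_def Q.outputs_eq)
    have "tv l Q.G 0 \<le> ?err"
      by (rule tv_dist_le[OF Q.observed_law_R(2)[OF t0] Q.observed_law_R(3)[OF t0] measure_iid_law c])
    then show ?thesis by (simp add: mean_tv_def)
  qed
  moreover have "?T * ?H / (N * (n * \<epsilon>)\<^sup>2) = (lsize + 2) * (lsize + 1) / (N * \<epsilon>\<^sup>2)"
    using n0 by (simp add: power2_eq_square)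
  moreover have "model_rate m l Q.G \<le> (N * (n * C + 2 * (m + 1) + 2 * \<eta> * (n * lsize) + n * \<eta>) + card (edges m) * (2 * N * (n * \<epsilon>) + 1)) / l"
  proof -
    have "(\<Sum>q=1..m. ent N.P (lo q)) \<le> correlation m (N.R t) + (\<Sum>p=1..m. residual m N.P (N.K t) p)"
      unfolding N.correlation_R[OF t] by (rule MN.sum_ent_lo_le)
    also have "\<dots> \<le> n * C + 2 * (m + 1) + 2 * \<eta> * (n * lsize) + n * \<eta>"
      using correlation_near(1)[OF N.set_R[OF t] cl \<eta>] res_sum by linarith
    finally have "N * (\<Sum>q=1..m. ent N.P (lo q)) \<le> N * (n * C + 2 * (m + 1) + 2 * \<eta> * (n * lsize) + n * \<eta>)"
      by (rule mult_left_mono) simp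
    then show ?thesis unfolding Q.model_rate_G using rate by (intro divide_right_mono) auto
  qed
  ultimately show ?thesis by (intro exI[of _ Q.G]) (simp only: simp_thms)
qed

end

end

section \<open>The limit of long blocks\<close>

lemma diagonal:
  fixes Q :: "nat \<Rightarrow> real \<Rightarrow> 'g \<Rightarrow> bool"
  assumes ev: "\<And>\<epsilon>. \<epsilon> > 0 \<Longrightarrow> \<forall>\<^sub>F n in sequentially. \<exists>G. Q n \<epsilon> G"
    and base: "\<And>n. \<exists>G. A n G" and QA: "\<And>n \<epsilon> G. Q n \<epsilon> G \<Longrightarrow> A n G"
  shows "\<exists>Gs e. (\<forall>n. A n (Gs n)) \<and> e \<longlonglongrightarrow> 0 \<and> (\<forall>\<^sub>F n in sequentially. Q n (e n) (Gs n))"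
proof -
  have "\<exists>n0. \<forall>n\<ge>n0. \<exists>G. Q n (1 / real (Suc k)) G" for k
    using ev[of "1 / real (Suc k)"] by (simp add: eventually_sequentially)
  then obtain n0 where n0: "\<And>k n. n \<ge> n0 k \<Longrightarrow> \<exists>G. Q n (1 / real (Suc k)) G" by metis
  define K where "K n = Max (insert 0 {k. k \<le> n \<and> n0 k \<le> n})" for n
  have K_in: "K n \<in> insert 0 {k. k \<le> n \<and> n0 k \<le> n}" for n unfolding K_def by (intro Max_in) auto
  have K_ge: "k \<le> K n" if "n \<ge> max k (n0 k)" for k n unfolding K_def using that by (intro Max_ge) auto
  have K: "filterlim K at_top sequentially"
    unfolding filterlim_at_top eventually_sequentially using K_ge by blast
  define e where "e n = 1 / real (Suc (K n))" for n
  have e: "e \<longlonglongrightarrow> 0"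
    unfolding e_def using filterlim_compose[OF LIMSEQ_inverse_real_of_nat K] by (simp add: inverse_eq_divide)
  have ex: "\<exists>G. Q n (e n) G" if "n \<ge> n0 0" for n
    unfolding e_def using K_in[of n] that by (intro n0) auto
  define Gs where "Gs n = (if \<exists>G. Q n (e n) G then SOME G. Q n (e n) G else SOME G. A n G)" for n
  have Gs: "Q n (e n) (Gs n)" if "\<exists>G. Q n (e n) G" for n
    unfolding Gs_def using someI_ex[OF that] that by simp
  have all: "A n (Gs n)" for n
  proof (cases "\<exists>G. Q n (e n) G")
    case False
    show ?thesis using someI_ex[OF base[of n]] by (simp only: Gs_def False if_False)
  qed (rule QA[OF Gs])
  have "\<forall>\<^sub>F n in sequentially. Q n (e n) (Gs n)"
    by (rule eventually_sequentiallyI[of "n0 0"]) (rule Gs[OF ex])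
  then show ?thesis using e all by (intro exI[of _ Gs] exI[of _ e] conjI allI)
qed

context source
begin

definition comp :: "(nat \<Rightarrow> nat) \<Rightarrow> (nat \<Rightarrow> 'x causal_model) \<Rightarrow> bool" where
  "comp \<iota> Gs \<longleftrightarrow> \<iota> permutes {1..m} \<and> (\<forall>n\<ge>1. admissible \<iota> n (Gs n)) \<and> (\<lambda>n. mean_tv n (Gs n)) \<longlonglongrightarrow> 0"

definition good :: "(nat \<Rightarrow> nat) \<Rightarrow> nat \<Rightarrow> real \<Rightarrow> 'x causal_model \<Rightarrow> bool" where
  "good \<iota> n \<epsilon> G \<longleftrightarrow> admissible \<iota> n G \<and> mean_tv n G \<le> \<epsilon> \<and> model_rate m n G \<le> C + \<epsilon>"

lemma compatible_iff: "compatible m \<X> PX Gs \<longleftrightarrow> (\<exists>\<iota>. comp \<iota> Gs)"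
  unfolding compatible_def comp_def admissible_def mean_tv_def by blast

lemma sequence_rate_ge:
  assumes c: "comp \<iota> Gs"
  shows "ereal C \<le> sequence_rate m Gs"
proof -
  let ?a = "\<lambda>n. C - (2 * (m + 1) / n + 2 * mean_tv n (Gs n) * lsize)"
  have 1: "1 \<in> {1..m}" using m by simp
  have "?a n \<le> model_rate m n (Gs n)" if n: "n \<ge> 1" for n
  proof -
    have adm: "admissible \<iota> n (Gs n)" "\<iota> permutes {1..m}" using c n by (auto simp: comp_def)
    have "0 \<le> n * (model_rate m n (Gs n) - C) + 2 * (m + 1) + 2 * mean_tv n (Gs n) * (n * lsize)"
      using mean_residual_nonneg[OF adm 1] mean_residual_le[OF adm 1 n] by linarith
    then show ?thesis using n by (simp add: field_simps)
  qed
  then have "limsup (\<lambda>n. ereal (?a n)) \<le> sequence_rate m Gs"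
    unfolding sequence_rate_def by (intro Limsup_mono eventually_sequentiallyI[of 1]) simp
  moreover have "?a \<longlonglongrightarrow> C - (0 + 2 * 0 * lsize)"
    using c unfolding comp_def by (intro tendsto_intros lim_const_over_n) auto
  then have "limsup (\<lambda>n. ereal (?a n)) = ereal C"
    by (intro lim_imp_Limsup) auto
  ultimately show ?thesis by simp
qed

lemma good_sequence:
  assumes perm: "\<iota> permutes {1..m}" and base: "\<And>n. n \<ge> 1 \<Longrightarrow> \<exists>G. admissible \<iota> n G"
    and ev: "\<And>\<epsilon>. \<epsilon> > 0 \<Longrightarrow> \<forall>\<^sub>F n in sequentially. \<exists>G. good \<iota> n \<epsilon> G"
  obtains Gs e where "comp \<iota> Gs" "e \<longlonglongrightarrow> 0" "\<forall>\<^sub>F n in sequentially. model_rate m n (Gs n) \<le> C + e n"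
proof -
  have "\<exists>Gs e. (\<forall>n. n \<ge> 1 \<longrightarrow> admissible \<iota> n (Gs n)) \<and> e \<longlonglongrightarrow> 0 \<and> (\<forall>\<^sub>F n in sequentially. good \<iota> n (e n) (Gs n))"
    by (rule diagonal[OF ev]) (use base in \<open>auto simp: good_def\<close>)
  then obtain Gs e where Gs: "\<And>n. n \<ge> 1 \<Longrightarrow> admissible \<iota> n (Gs n)" "e \<longlonglongrightarrow> 0" "\<forall>\<^sub>F n in sequentially. good \<iota> n (e n) (Gs n)"
    by blast
  have "(\<lambda>n. mean_tv n (Gs n)) \<longlonglongrightarrow> 0"
  proof (rule tendsto_sandwich[OF _ _ tendsto_const Gs(2)])
    show "\<forall>\<^sub>F n in sequentially. 0 \<le> mean_tv n (Gs n)"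
      by (intro eventually_sequentiallyI[of 1] mean_tv_nonneg[OF Gs(1) perm])
    show "\<forall>\<^sub>F n in sequentially. mean_tv n (Gs n) \<le> e n"
      using Gs(3) by eventually_elim (simp add: good_def)
  qed
  moreover have "\<forall>\<^sub>F n in sequentially. model_rate m n (Gs n) \<le> C + e n"
    using Gs(3) by eventually_elim (simp add: good_def)
  ultimately have "comp \<iota> Gs" "\<forall>\<^sub>F n in sequentially. model_rate m n (Gs n) \<le> C + e n"
    unfolding comp_def using Gs(1) perm by blast+
  then show ?thesis by (rule that[OF _ Gs(2)])
qed

lemma sequence_rate_le:
  assumes "e \<longlonglongrightarrow> 0" "\<forall>\<^sub>F n in sequentially. model_rate m n (Gs n) \<le> C + e n"
  shows "sequence_rate m Gs \<le> ereal C"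
proof -
  have "sequence_rate m Gs \<le> limsup (\<lambda>n. ereal (C + e n))"
    unfolding sequence_rate_def
    by (rule Limsup_mono) (use assms(2) in eventually_elim, simp only: ereal_less_eq)
  also have "(\<lambda>n. C + e n) \<longlonglongrightarrow> C" using tendsto_add[OF tendsto_const assms(1), of C] by simp
  then have "limsup (\<lambda>n. ereal (C + e n)) = ereal C" by (intro lim_imp_Limsup tendsto_ereal) simp_all
  finally show ?thesis .
qed

text \<open>There are only finitely many orders of the parties, so that one of them works for all
  \<open>\<epsilon>\<close>.\<close>

lemma good_of_rate:
  assumes rate: "resource_rate m \<X> PX = ereal C"
  obtains \<iota> where "\<iota> permutes {1..m}" "\<And>n. n \<ge> 1 \<Longrightarrow> \<exists>G. admissible \<iota> n G"
    "\<And>\<epsilon>. \<epsilon> > 0 \<Longrightarrow> \<forall>\<^sub>F n in sequentially. \<exists>G. good \<iota> n \<epsilon> G"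
proof -
  let ?\<Pi> = "{\<iota>. \<iota> permutes {1..m}}"
  have near: "\<exists>\<iota>\<in>?\<Pi>. \<exists>Gs. comp \<iota> Gs \<and> sequence_rate m Gs < ereal (C + \<epsilon>)" if "\<epsilon> > 0" for \<epsilon>
  proof -
    have "resource_rate m \<X> PX < ereal (C + \<epsilon>)" using rate that by simp
    then obtain Gs where "compatible m \<X> PX Gs" "sequence_rate m Gs < ereal (C + \<epsilon>)"
      unfolding resource_rate_def INF_less_iff by blast
    then show ?thesis unfolding compatible_iff by (auto simp: comp_def)
  qed
  have "\<exists>\<iota>\<in>?\<Pi>. \<forall>\<epsilon>>0. \<exists>Gs. comp \<iota> Gs \<and> sequence_rate m Gs < ereal (C + \<epsilon>)"
  proof (rule ccontr)
    assume "\<not> ?thesis"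
    then obtain E where E: "\<And>\<iota>. \<iota> \<in> ?\<Pi> \<Longrightarrow> E \<iota> > 0 \<and> \<not> (\<exists>Gs. comp \<iota> Gs \<and> sequence_rate m Gs < ereal (C + E \<iota>))"
      by metis
    have fin: "finite ?\<Pi>" by (intro finite_permutations) simp
    moreover have "?\<Pi> \<noteq> {}" using permutes_id[of "{1..m}"] by blast
    ultimately have "Min (E ` ?\<Pi>) > 0" using E by (subst Min_gr_iff) blast+
    then obtain \<iota> Gs where *: "\<iota> \<in> ?\<Pi>" "comp \<iota> Gs" "sequence_rate m Gs < ereal (C + Min (E ` ?\<Pi>))"
      using near by blast
    have "Min (E ` ?\<Pi>) \<le> E \<iota>" using fin *(1) by (intro Min_le) auto
    then have "sequence_rate m Gs < ereal (C + E \<iota>)" using *(3) by (simp add: less_le_trans)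
    then show False using E[OF *(1)] *(2) by blast
  qed
  then obtain \<iota> where \<iota>: "\<iota> permutes {1..m}" "\<And>\<epsilon>. \<epsilon> > 0 \<Longrightarrow> \<exists>Gs. comp \<iota> Gs \<and> sequence_rate m Gs < ereal (C + \<epsilon>)"
    by blast
  obtain Gs0 where Gs0: "comp \<iota> Gs0" using \<iota>(2)[of 1] by auto
  show ?thesis
  proof
    show "\<iota> permutes {1..m}" by fact
    show "\<exists>G. admissible \<iota> n G" if "n \<ge> 1" for n using Gs0 that by (auto simp: comp_def)
    fix \<epsilon> :: real assume \<epsilon>: "\<epsilon> > 0"
    obtain Gs where Gs: "comp \<iota> Gs" "sequence_rate m Gs < ereal (C + \<epsilon>)" using \<iota>(2)[OF \<epsilon>] by blast
    have "\<forall>\<^sub>F n in sequentially. ereal (model_rate m n (Gs n)) < ereal (C + \<epsilon>)"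
      using Gs(2) unfolding sequence_rate_def by (rule Limsup_lessD)
    moreover have "\<forall>\<^sub>F n in sequentially. mean_tv n (Gs n) < \<epsilon>"
      using Gs(1) \<epsilon> unfolding comp_def by (intro order_tendstoD(2)[of _ 0]) auto
    moreover have "\<forall>\<^sub>F n in sequentially. admissible \<iota> n (Gs n)"
      using Gs(1) unfolding comp_def by (intro eventually_sequentiallyI[of 1]) auto
    ultimately show "\<forall>\<^sub>F n in sequentially. \<exists>G. good \<iota> n \<epsilon> G"
      by eventually_elim (auto simp: good_def intro: less_imp_le)
  qed
qed

lemma good_of_recoverable:
  fixes \<delta> :: "nat \<Rightarrow> real"
  assumes c: "comp \<iota> Gs" and \<delta>: "\<delta> \<longlonglongrightarrow> 0"
    and rec: "\<And>n i. n \<ge> 1 \<Longrightarrow> i \<in> {1..m} \<Longrightarrow> mean_residual n (Gs n) i \<le> n * \<delta> n" and \<epsilon>: "\<epsilon> > 0"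
  shows "\<forall>\<^sub>F l in sequentially. \<exists>G. good \<iota> l \<epsilon> G"
proof -
  have perm: "\<iota> permutes {1..m}" using c by (simp add: comp_def)
  define \<eta> where "\<eta> n = mean_tv n (Gs n) + m * \<delta> n" for n
  have "(\<lambda>n. mean_tv n (Gs n) + m * \<delta> n) \<longlonglongrightarrow> 0 + real m * 0"
    using c \<delta> unfolding comp_def by (intro tendsto_intros) auto
  then have \<eta>: "\<eta> \<longlonglongrightarrow> 0" unfolding \<eta>_def by simp
  define c where "c = real (card (edges m))"
  define \<epsilon>1 where "\<epsilon>1 = \<epsilon> / (4 * c + 4)"
  have c0: "c \<ge> 0" by (simp add: c_def)
  have \<epsilon>1: "\<epsilon>1 > 0" using \<epsilon> c0 by (simp add: \<epsilon>1_def)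
  have c\<epsilon>1: "2 * c * \<epsilon>1 < \<epsilon>"
  proof -
    have "2 * c * \<epsilon>1 * (4 * c + 4) = 2 * c * \<epsilon>" using c0 by (simp add: \<epsilon>1_def)
    also have "\<dots> < 2 * c * \<epsilon> + \<epsilon> * (2 * c + 4)" using \<epsilon> c0 by simp
    also have "\<dots> = \<epsilon> * (4 * c + 4)" by (simp add: algebra_simps)
    finally show ?thesis using c0 by (subst (asm) mult_less_cancel_right_pos) auto
  qed
  define A where "A = (lsize + 2) * (lsize + 1) / \<epsilon>1\<^sup>2"
  have A0: "A \<ge> 0" using lsize_nonneg by (simp add: A_def)
  define N where "N = nat \<lceil>2 * c * A / \<epsilon>\<rceil> + 1"
  have N: "N \<ge> 1" by (simp add: N_def)
  have "2 * c * A / \<epsilon> < N"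
    unfolding N_def using real_nat_ceiling_ge[of "2 * c * A / \<epsilon>"] by linarith
  then have NA: "2 * c * (A / N) < \<epsilon>" using \<epsilon> N by (simp add: field_simps)
  define f where "f n = c * (2 * (N * (2 powr (- real n) + \<eta> n) + A / N) + 2 * 2 powr (- (N * (n * \<epsilon>1)))) + N * \<eta> n" for n
  have "f \<longlonglongrightarrow> c * (2 * (real N * (0 + 0) + A / N) + 2 * 0) + real N * 0"
  proof -
    have p: "(\<lambda>n. 2 powr (- (b * real n))) \<longlonglongrightarrow> 0" if b: "b > 0" for b :: real
    proof -
      have "2 powr (- b) < (2 :: real) powr 0" using b by (intro powr_less_mono) auto
      then have "(\<lambda>n. (2 powr (- b)) ^ n) \<longlonglongrightarrow> 0" by (intro LIMSEQ_realpow_zero) auto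
      then show ?thesis by (simp add: powr_realpow[symmetric] powr_powr)
    qed
    have 1: "(\<lambda>n. 2 powr (- real n)) \<longlonglongrightarrow> 0" using p[of 1] by simp
    have "(\<lambda>n. 2 powr (- (N * \<epsilon>1 * real n))) \<longlonglongrightarrow> 0" using \<epsilon>1 N by (intro p) simp
    then have 2: "(\<lambda>n. 2 powr (- (N * (n * \<epsilon>1)))) \<longlonglongrightarrow> 0" by (simp add: ac_simps)
    show ?thesis unfolding f_def by (intro tendsto_intros 1 2 \<eta>)
  qed
  then have f: "f \<longlonglongrightarrow> 2 * c * (A / N)" by (simp add: ac_simps)
  define q where "q l = l div N + 1" for l
  have q_top: "filterlim q sequentially sequentially"
    unfolding filterlim_at_top
  proof
    fix Z
    have "Z \<le> q l" if "l \<ge> Z * N" for l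
      using div_le_mono[OF that, of N] N by (simp add: q_def)
    then show "\<forall>\<^sub>F l in sequentially. Z \<le> q l" by (rule eventually_sequentiallyI)
  qed
  have qN: "l \<le> N * q l" "N * q l \<le> l + N" for l
  proof -
    have "l = N * (l div N) + l mod N" "N * q l = N * (l div N) + N" by (simp_all add: q_def)
    moreover have "l mod N < N" using N by simp
    ultimately show "l \<le> N * q l" "N * q l \<le> l + N" by linarith+
  qed
  have s: "(\<lambda>l. real (N * q l) / l) \<longlonglongrightarrow> 1"
  proof (rule tendsto_sandwich[OF _ _ tendsto_const])
    have "1 \<le> real (N * q l) / l" if "l \<ge> 1" for l
    proof -
      have "real l \<le> real (N * q l)" using qN(1) by (rule of_nat_mono)
      moreover have "real l > 0" using that by simp
      ultimately show ?thesis by (simp only: le_divide_eq_1_pos)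
    qed
    then show "\<forall>\<^sub>F l in sequentially. 1 \<le> real (N * q l) / l"
      by (rule eventually_sequentiallyI)
    have "real (N * q l) / l \<le> 1 + N / l" if "l \<ge> 1" for l
    proof -
      have "real (N * q l) \<le> real (l + N)" using qN(2)[of l] by (rule of_nat_mono)
      then have "real (N * q l) / l \<le> real (l + N) / l" by (rule divide_right_mono) simp
      also have "\<dots> = 1 + N / l" using that by (simp add: add_divide_distrib)
      finally show ?thesis .
    qed
    then show "\<forall>\<^sub>F l in sequentially. real (N * q l) / l \<le> 1 + N / l"
      by (rule eventually_sequentiallyI)
    have "(\<lambda>l. 1 + real N / real l) \<longlonglongrightarrow> 1 + 0" by (intro tendsto_intros lim_const_over_n)
    then show "(\<lambda>l. 1 + real N / real l) \<longlonglongrightarrow> 1" by simp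
  qed
  define g where "g l = (N * (q l * C + 2 * (m + 1) + 2 * \<eta> (q l) * (q l * lsize) + q l * \<eta> (q l)) + c * (2 * N * (q l * \<epsilon>1) + 1)) / l" for l
  have \<eta>q: "(\<lambda>l. \<eta> (q l)) \<longlonglongrightarrow> 0" by (rule filterlim_compose[OF \<eta> q_top])
  have "g l = real (N * q l) / l * (C + 2 * \<eta> (q l) * lsize + \<eta> (q l) + 2 * c * \<epsilon>1) + (N * (2 * (m + 1)) + c) / l" for l
  proof -
    have "N * (q l * C + 2 * (m + 1) + 2 * \<eta> (q l) * (q l * lsize) + q l * \<eta> (q l)) + c * (2 * N * (q l * \<epsilon>1) + 1)
      = real (N * q l) * (C + 2 * \<eta> (q l) * lsize + \<eta> (q l) + 2 * c * \<epsilon>1) + (N * (2 * (m + 1)) + c)"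
      by (simp add: algebra_simps)
    then show ?thesis by (simp only: g_def add_divide_distrib times_divide_eq_left)
  qed
  then have "g = (\<lambda>l. real (N * q l) / l * (C + 2 * \<eta> (q l) * lsize + \<eta> (q l) + 2 * c * \<epsilon>1) + (N * (2 * (m + 1)) + c) / l)"
    by (rule ext)
  also have "\<dots> \<longlonglongrightarrow> 1 * (C + 2 * 0 * lsize + 0 + 2 * c * \<epsilon>1) + 0"
    by (intro tendsto_intros s \<eta>q lim_const_over_n)
  finally have g: "g \<longlonglongrightarrow> C + 2 * c * \<epsilon>1" by simp
  have "\<forall>\<^sub>F l in sequentially. f (q l) < \<epsilon>"
    by (rule order_tendstoD(2)[OF filterlim_compose[OF f q_top] NA])
  moreover have "\<forall>\<^sub>F l in sequentially. \<eta> (q l) < 1"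
    by (rule order_tendstoD(2)[OF \<eta>q]) simp
  moreover have "\<forall>\<^sub>F l in sequentially. g l < C + \<epsilon>"
    using c\<epsilon>1 by (intro order_tendstoD(2)[OF g]) simp
  moreover have "\<forall>\<^sub>F l in sequentially. (l :: nat) \<ge> 1" by (rule eventually_ge_at_top)
  ultimately show ?thesis
  proof eventually_elim
    case (elim l)
    have n: "q l \<ge> 1" by (simp add: q_def)
    have adm: "admissible \<iota> (q l) (Gs (q l))" using \<open>comp \<iota> Gs\<close> n by (simp add: comp_def)
    interpret net: causal_network m "q l" \<X> "Gs (q l)" \<iota> by (rule admissible_network[OF adm perm])
    obtain t where t: "t \<in> space (theta_space (Gs (q l)))"
      "tv (q l) (Gs (q l)) t + (\<Sum>p=1..m. residual m net.P (net.K t) p) / q l \<le> \<eta> (q l)"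
      using good_choice[OF adm perm n rec[OF n]] unfolding \<eta>_def by blast
    have "\<eta> (q l) \<le> 1" using elim(2) by simp
    from achieve_step[OF adm perm n N elim(4) qN(1) \<epsilon>1 this t]
    obtain G' where G': "admissible \<iota> l G'"
      "mean_tv l G' \<le> c * (2 * (N * (2 powr (- real (q l)) + \<eta> (q l)) + (lsize + 2) * (lsize + 1) / (N * \<epsilon>1\<^sup>2)) + 2 * 2 powr (- (N * (q l * \<epsilon>1)))) + N * \<eta> (q l)"
      "model_rate m l G' \<le> g l"
      unfolding g_def c_def by blast
    have "(lsize + 2) * (lsize + 1) / (N * \<epsilon>1\<^sup>2) = A / N" by (simp add: A_def mult.commute)
    with G'(2) have "mean_tv l G' \<le> f (q l)" unfolding f_def by (simp only:)
    with G' elim(1,3) have "good \<iota> l \<epsilon> G'" unfolding good_def by linarith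
    then show ?case by blast
  qed
qed

lemma recoverable_of_rate:
  assumes c: "comp \<iota> Gs" and e: "e \<longlonglongrightarrow> 0" "\<forall>\<^sub>F n in sequentially. model_rate m n (Gs n) \<le> C + e n"
  shows "\<exists>\<delta>. (\<forall>n. \<delta> n > 0) \<and> \<delta> \<longlonglongrightarrow> 0 \<and> latents_recoverable m Gs \<delta>"
proof -
  define \<delta> where "\<delta> n = max 0 (model_rate m n (Gs n) - C) + 2 * (m + 1) / n + 2 * \<bar>mean_tv n (Gs n)\<bar> * lsize + inverse (real (Suc n))" for n
  have "\<delta> n > 0" for n
    unfolding \<delta>_def using lsize_nonneg by (intro add_nonneg_pos add_nonneg_nonneg) auto
  moreover have "\<delta> \<longlonglongrightarrow> 0"
  proof -
    have "(\<lambda>n. max 0 (model_rate m n (Gs n) - C)) \<longlonglongrightarrow> 0"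
    proof (rule tendsto_sandwich[OF _ _ tendsto_const])
      show "\<forall>\<^sub>F n in sequentially. max 0 (model_rate m n (Gs n) - C) \<le> \<bar>e n\<bar>"
        using e(2) by eventually_elim auto
      show "(\<lambda>n. \<bar>e n\<bar>) \<longlonglongrightarrow> 0" using e(1) by (rule tendsto_rabs_zero)
    qed simp
    moreover have "(\<lambda>n. \<bar>mean_tv n (Gs n)\<bar>) \<longlonglongrightarrow> 0" using c unfolding comp_def by (intro tendsto_rabs_zero) simp
    ultimately have "\<delta> \<longlonglongrightarrow> 0 + 0 + 2 * 0 * lsize + 0"
      unfolding \<delta>_def by (intro tendsto_intros lim_const_over_n LIMSEQ_inverse_real_of_nat)
    then show ?thesis by simp
  qed
  moreover have "latents_recoverable m Gs \<delta>"
    unfolding latents_recoverable_def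
  proof (intro allI impI ballI)
    fix n i :: nat assume n: "n \<ge> 1" and i: "i \<in> {1..m}"
    have adm: "admissible \<iota> n (Gs n)" "\<iota> permutes {1..m}" using c n by (auto simp: comp_def)
    have "mean_residual n (Gs n) i \<le> n * (model_rate m n (Gs n) - C) + 2 * (m + 1) + 2 * mean_tv n (Gs n) * (n * lsize)"
      by (rule mean_residual_le[OF adm i n])
    also have "\<dots> = n * ((model_rate m n (Gs n) - C) + 2 * (m + 1) / n + 2 * mean_tv n (Gs n) * lsize)"
      using n by (simp add: field_simps)
    also have "\<dots> \<le> n * \<delta> n"
    proof (rule mult_left_mono)
      have "0 \<le> inverse (real (Suc n))" "\<bar>mean_tv n (Gs n)\<bar> = mean_tv n (Gs n)"
        using mean_tv_nonneg[OF adm] by simp_all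
      then show "(model_rate m n (Gs n) - C) + 2 * (m + 1) / n + 2 * mean_tv n (Gs n) * lsize \<le> \<delta> n"
        unfolding \<delta>_def by linarith
    qed simp
    finally show "(LINT t|theta_space (Gs n). cond_entropy (sample (Gs n)) (neighbours m (Gs n) i) (observed m (Gs n) t i)) \<le> n * \<delta> n"
      by (simp add: mean_residual_def)
  qed
  ultimately show ?thesis by blast
qed

lemma rate_iff_recoverable:
  "resource_rate m \<X> PX = ereal C \<longleftrightarrow>
    (\<exists>Gs \<delta>. compatible m \<X> PX Gs \<and> (\<forall>n. \<delta> n > 0) \<and> \<delta> \<longlonglongrightarrow> 0 \<and> latents_recoverable m Gs \<delta>)"
    (is "?L \<longleftrightarrow> ?R")
  and rate_ge: "ereal C \<le> resource_rate m \<X> PX"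
proof -
  show ge: "ereal C \<le> resource_rate m \<X> PX"
    unfolding resource_rate_def by (rule INF_greatest) (use sequence_rate_ge in \<open>auto simp: compatible_iff\<close>)
  show "?L \<longleftrightarrow> ?R"
  proof
    assume ?L
    then obtain \<iota> where \<iota>: "\<iota> permutes {1..m}" "\<And>n. n \<ge> 1 \<Longrightarrow> \<exists>G. admissible \<iota> n G"
      "\<And>\<epsilon>. \<epsilon> > 0 \<Longrightarrow> \<forall>\<^sub>F n in sequentially. \<exists>G. good \<iota> n \<epsilon> G"
      using good_of_rate by metis
    obtain Gs e where Gs: "comp \<iota> Gs" "e \<longlonglongrightarrow> 0" "\<forall>\<^sub>F n in sequentially. model_rate m n (Gs n) \<le> C + e n"
      using good_sequence[OF \<iota>] by blast
    then show ?R using recoverable_of_rate[OF Gs] compatible_iff by blast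
  next
    assume ?R
    then obtain Gs \<delta> \<iota> where Gs: "comp \<iota> Gs" "\<delta> \<longlonglongrightarrow> 0" "latents_recoverable m Gs \<delta>"
      unfolding compatible_iff by blast
    have rec: "mean_residual n (Gs n) i \<le> n * \<delta> n" if "n \<ge> 1" "i \<in> {1..m}" for n i
      using Gs(3) that by (simp add: latents_recoverable_def mean_residual_def)
    have perm: "\<iota> permutes {1..m}" and base: "\<And>n. n \<ge> 1 \<Longrightarrow> \<exists>G. admissible \<iota> n G"
      using Gs(1) by (auto simp: comp_def)
    obtain Gs' e where Gs': "comp \<iota> Gs'" "e \<longlonglongrightarrow> 0" "\<forall>\<^sub>F n in sequentially. model_rate m n (Gs' n) \<le> C + e n"
      using good_sequence[OF perm base good_of_recoverable[OF Gs(1,2) rec]] by blast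
    have "resource_rate m \<X> PX \<le> sequence_rate m Gs'"
      unfolding resource_rate_def using Gs'(1) by (intro INF_lower) (auto simp: compatible_iff)
    also have "\<dots> \<le> ereal C" by (rule sequence_rate_le[OF Gs'(2,3)])
    finally show ?L using ge by simp
  qed
qed

end

theorem theorem1:
  fixes m :: nat
    and M :: "'a measure"
    and X :: "nat \<Rightarrow> 'a \<Rightarrow> 'x"
    and \<X> :: "nat \<Rightarrow> 'x set"
  assumes "m \<ge> 1"
    and "prob_space M"
    and "\<And>i. i \<in> {1..m} \<Longrightarrow> finite (\<X> i)"
    and "\<And>i. i \<in> {1..m} \<Longrightarrow> X i \<in> measurable M (count_space (\<X> i))"
  shows "(resource_rate m \<X> (joint_law m \<X> M X) = ereal (total_correlation m M X) \<longleftrightarrow>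
            (\<exists>Gs \<delta>. compatible m \<X> (joint_law m \<X> M X) Gs \<and>
               (\<forall>n. \<delta> n > 0) \<and> \<delta> \<longlonglongrightarrow> 0 \<and> latents_recoverable m Gs \<delta>)) \<and>
         (\<not> (\<exists>Gs \<delta>. compatible m \<X> (joint_law m \<X> M X) Gs \<and>
               (\<forall>n. \<delta> n > 0) \<and> \<delta> \<longlonglongrightarrow> 0 \<and> latents_recoverable m Gs \<delta>) \<longrightarrow>
            resource_rate m \<X> (joint_law m \<X> M X) > ereal (total_correlation m M X))"
proof -
  interpret source m M X \<X> by (rule source.intro[OF assms])
  show ?thesis unfolding rate_iff_recoverable[symmetric] using rate_ge by (auto simp: order_less_le)
qed

end
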